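(* For $\ell\in(0,+\infty)$ and $\nu\in S^1$ let $$\varphi_\ell(\nu):=\lim_{T\to+\infty}\frac{1}{2T}\inf\Big\{\ell\sum_{i\in TQ^\nu\cap\mathbb{Z}^2}(v^i-1)^2+\frac{1}{2\ell}\sum_{\substack{i,j\in TQ^\nu\cap\mathbb{Z}^2\\|i-j|=1}}|v^i-v^j|^2:\ v\in\mathcal{A}_1(TQ^\nu),\ \exists\text{ a channel }\mathscr{C}\text{ in }TQ^\nu\cap\mathbb{Z}^2\text{ with }v=0\text{ on }\mathscr{C},\ v=1\text{ otherwise near }\partial TQ^\nu\Big\}.$$ Then $$\lim_{\ell\to+\infty}\varphi_\ell(\nu)=+\infty\quad\text{and}\quad\lim_{\ell\to0}\varphi_\ell(\nu)=1$$ for every $\nu\in S^1$. Moreover, $$\lim_{\ell\to+\infty}\frac{\varphi_\ell(\nu)}{\ell}=|\nu|_\infty$$ for every $\nu\in S^1$.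
   Context: Notation. $|\nu|_\infty:=\max\{|\nu_1|,|\nu_2|\}$. For $\nu\in S^1$, $Q^\nu$ is the square centred at $0$ of side length $1$ with one side orthogonal to $\nu$, and $\nu^\perp$ is a unit vector orthogonal to $\nu$. $\mathcal{A}_1(TQ^\nu)$ is the set of $v\in L^1(TQ^\nu)$ constant on $i+[0,1)^2$ for all $i\in TQ^\nu\cap\mathbb{Z}^2$ (cells intersected with $TQ^\nu$), with value $v^i$ there. "$v=1$ otherwise near $\partial TQ^\nu$" means that there is a neighbourhood $U$ of $\partial TQ^\nu$ such that in $U\cap TQ^\nu$ one has $v=1$ a.e. outside the cells of the points of $\mathscr{C}$. Sums over $i,j$ with $|i-j|=1$ run over ordered pairs. The limit defining $\varphi_\ell(\nu)$ exists for every $\nu\in S^1$. Channels. A path in $\mathbb{Z}^2$ is a sequence $p=\{i_1,\dots,i_{l_p}\}\subset\mathbb{Z}^2$ with $|i_{k+1}-i_k|=1$ for every $k\in\{1,\dots,l_p-1\}$. It is a strong path if every $i_k\in p$ other than $i_1$ and $i_{l_p}$ satisfies: ($i_k+e_1\in p$ or $i_k-e_1\in p$) and ($i_k+e_2\in p$ or $i_k-e_2\in p$). Set $S^\nu:=\{i\in TQ^\nu\cap\mathbb{Z}^2:\exists\, l\in TQ^\nu\cap\mathbb{Z}^2,\ |i-l|=1,\ \mathrm{sign}\langle i,\nu\rangle\ne\mathrm{sign}\langle l,\nu\rangle\}$, $\partial_L:=\{i\in TQ^\nu\cap\mathbb{Z}^2:\exists\, j\in\mathbb{Z}^2,\ |i-j|=1,\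 \langle j,\nu^\perp\rangle\le-T/2\}$, $\partial_R:=\{i\in TQ^\nu\cap\mathbb{Z}^2:\exists\, j\in\mathbb{Z}^2,\ |i-j|=1,\ \langle j,\nu^\perp\rangle\ge T/2\}$. A channel in $TQ^\nu\cap\mathbb{Z}^2$ is a strong path $\mathscr{C}\subset TQ^\nu$ connecting $S^\nu\cap\partial_L$ and $S^\nu\cap\partial_R$. *)

theory Defs
  imports "HOL-Analysis.Analysis"
begin

definition Z2 :: "(real^2) set" where
  "Z2 = {x. \<forall>k. x $ k \<in> \<int>}"

definition cell :: "real^2 \<Rightarrow> (real^2) set" where
  "cell i = {x. \<forall>k. i $ k \<le> x $ k \<and> x $ k < i $ k + 1}"

(* One of the two unit vectors orthogonal to \<nu>; the opposite choice only exchanges bdL and bdR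
   below, hence reverses the channels. *)
definition perp :: "real^2 \<Rightarrow> real^2" where
  "perp \<nu> = vector [\<nu> $ 2, - (\<nu> $ 1)]"

(* The squares are open: the lattice points lying beyond the side <x, perp \<nu>> = T/2 are then
   exactly those with <x, perp \<nu>> \<ge> T/2, as in bdR, and every cell of a lattice point of the
   square meets the square in a set of positive measure. *)
definition unit_square :: "real^2 \<Rightarrow> (real^2) set" where
  "unit_square \<nu> = {x. \<bar>x \<bullet> \<nu>\<bar> < 1/2 \<and> \<bar>x \<bullet> perp \<nu>\<bar> < 1/2}"

definition TQ :: "real \<Rightarrow> real^2 \<Rightarrow> (real^2) set" where
  "TQ T \<nu> = (\<lambda>x. T *\<^sub>R x) ` unit_square \<nu>"

(* An element of L^1 is given by a representative that is pointwise constant on each cell, so that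
   the value on the cell of i is v i (values outside D play no role). *)
definition A1 :: "(real^2) set \<Rightarrow> (real^2 \<Rightarrow> real) set" where
  "A1 D = {v. v absolutely_integrable_on D \<and> (\<forall>i\<in>D \<inter> Z2. v constant_on (cell i \<inter> D))}"

(* Paths are lists of lattice points; points may be visited repeatedly. *)
definition is_path :: "(real^2) list \<Rightarrow> bool" where
  "is_path p \<longleftrightarrow> p \<noteq> [] \<and> set p \<subseteq> Z2 \<and> successively (\<lambda>i j. norm (j - i) = 1) p"

definition strong_path :: "(real^2) list \<Rightarrow> bool" where
  "strong_path p \<longleftrightarrow> is_path p \<and>
     (\<forall>i\<in>set p. i \<noteq> hd p \<and> i \<noteq> last p \<longrightarrow>
        (i + axis 1 1 \<in> set p \<or> i - axis 1 1 \<in> set p) \<and>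
        (i + axis 2 1 \<in> set p \<or> i - axis 2 1 \<in> set p))"

definition S_set :: "real \<Rightarrow> real^2 \<Rightarrow> (real^2) set" where
  "S_set T \<nu> = {i \<in> TQ T \<nu> \<inter> Z2.
     \<exists>l\<in>TQ T \<nu> \<inter> Z2. norm (i - l) = 1 \<and> sgn (i \<bullet> \<nu>) \<noteq> sgn (l \<bullet> \<nu>)}"

definition bdL :: "real \<Rightarrow> real^2 \<Rightarrow> (real^2) set" where
  "bdL T \<nu> = {i \<in> TQ T \<nu> \<inter> Z2. \<exists>j\<in>Z2. norm (i - j) = 1 \<and> j \<bullet> perp \<nu> \<le> - T/2}"

definition bdR :: "real \<Rightarrow> real^2 \<Rightarrow> (real^2) set" where
  "bdR T \<nu> = {i \<in> TQ T \<nu> \<inter> Z2. \<exists>j\<in>Z2. norm (i - j) = 1 \<and> j \<bullet> perp \<nu> \<ge> T/2}"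

definition channel :: "real \<Rightarrow> real^2 \<Rightarrow> (real^2) list \<Rightarrow> bool" where
  "channel T \<nu> p \<longleftrightarrow> strong_path p \<and> set p \<subseteq> TQ T \<nu> \<and>
     hd p \<in> S_set T \<nu> \<inter> bdL T \<nu> \<and> last p \<in> S_set T \<nu> \<inter> bdR T \<nu>"

definition one_otherwise_near_boundary ::
  "(real^2) set \<Rightarrow> (real^2) set \<Rightarrow> (real^2 \<Rightarrow> real) \<Rightarrow> bool" where
  "one_otherwise_near_boundary D C v \<longleftrightarrow>
     (\<exists>U. open U \<and> frontier D \<subseteq> U \<and>
        (AE x in lebesgue. x \<in> U \<inter> D - (\<Union>i\<in>C. cell i) \<longrightarrow> v x = 1))"

definition admissible :: "real \<Rightarrow> real^2 \<Rightarrow> (real^2 \<Rightarrow> real) set" where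
  "admissible T \<nu> = {v \<in> A1 (TQ T \<nu>). \<exists>p. channel T \<nu> p \<and> (\<forall>i\<in>set p. v i = 0) \<and>
     one_otherwise_near_boundary (TQ T \<nu>) (set p) v}"

definition energy :: "real \<Rightarrow> (real^2) set \<Rightarrow> (real^2 \<Rightarrow> real) \<Rightarrow> real" where
  "energy l D v =
     l * (\<Sum>i\<in>D \<inter> Z2. (v i - 1)\<^sup>2) +
     1 / (2 * l) *
       (\<Sum>(i, j)\<in>{(i, j). i \<in> D \<inter> Z2 \<and> j \<in> D \<inter> Z2 \<and> norm (i - j) = 1}. \<bar>v i - v j\<bar>\<^sup>2)"

definition scaled_min :: "real \<Rightarrow> real^2 \<Rightarrow> real \<Rightarrow> real" where
  "scaled_min l \<nu> T = 1 / (2 * T) * (INF v\<in>admissible T \<nu>. energy l (TQ T \<nu>) v)"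

definition phi :: "real \<Rightarrow> real^2 \<Rightarrow> real" where
  "phi l \<nu> = Lim at_top (scaled_min l \<nu>)"

end

theory Submission
  imports Defs "HOL-Real_Asymp.Real_Asymp"
begin

text \<open>Write \<open>u = 1 - v\<close>, so that \<open>u = 1\<close> on the channel, and let \<open>b\<close> be the larger of the absolute values of the two
components of \<open>\<nu>\<close>. Since the side length \<open>T\<close> tends to infinity while \<open>l\<close> is fixed, contributions that stay
bounded in \<open>T\<close> do not matter. The theorem follows from four bounds that hold for every \<open>l > 0\<close>:
  \<open>l b \<le> phi l \<nu> \<le> (l + 4 / l) b\<close> and \<open>1 \<le> phi l \<nu> \<le> 2 l b ((1 + l) exp (2 l))\<^sup>2 / (1 - exp (- 2 l b))\<close>.

The first pair counts the points of a channel. A strong path that crosses the square contains at least two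
points of each of the roughly \<open>b T\<close> lattice lines transversal to the larger component of its displacement
(\<open>lattice_channel_card_ge\<close>), and a digital straight line contains just two of each (\<open>exists_channel\<close>); the
indicator function of the latter is the competitor.

The second pair is the lattice version of the inequality \<open>l u\<^sup>2 + \<bar>\<nabla>u\<bar>\<^sup>2 / l \<ge> \<bar>\<nabla>(u\<^sup>2)\<bar>\<close>, with equality for
the exponential of \<open>- l\<close> times the distance to the line; each of the two sides of a channel costs its Euclidean
length. The competitor with the exponential profile is built in \<open>exists_profile\<close>. For the lower bound the
straight lines of direction \<open>\<nu>\<close> are replaced by lattice staircases. On average over the staircases the
horizontal and vertical edges are used with densities \<open>\<bar>\<nu>\<^sub>1\<bar>\<close> and \<open>\<bar>\<nu>\<^sub>2\<bar>\<close>; their squares add up to \<open>1\<close>, and so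
the Cauchy-Schwarz inequality loses nothing (\<open>weighted_variation_le_energy\<close>).

The difficulty of the lower bound is that a channel that runs along the boundary of the square pays on its inner
side only, hence \<open>1\<close> per unit length in place of \<open>2\<close>. The detour along the boundary has length \<open>2T\<close> and
ties with the direct route. The bound (\<open>crossing_energy_ge\<close>) is therefore proved for all \<open>u\<close> that are
\<open>1\<close> on a path joining the middles of two opposite sides. Call the staircases of direction \<open>\<nu>\<close> columns and the
orthogonal ones rows. A column gives \<open>2\<close> if the path meets it away from its ends. If the other columns lie close
together, this is enough. If two of them are far apart, then the path travels half a side length up or down before
the first and again after the second one; now every column counts once and the rows contribute \<open>T/2\<close> twice. Both
families can be used together with weights of sum \<open>1\<close>: each has weight \<open>1/2\<close> inside the square, where a
crossing counts on both sides, and weight \<open>1\<close> where its lines end, where a crossing counts on one side.\<close>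

section \<open>Points of an arithmetic progression in an interval\<close>

lemma card_samples_le:
  fixes S :: "int set"
  assumes fin: "finite S" and \<delta>: "0 < \<delta>" and pq: "p \<le> q"
    and S: "\<And>k. k \<in> S \<Longrightarrow> p \<le> \<delta> * real_of_int k \<and> \<delta> * real_of_int k \<le> q"
  shows "\<delta> * real (card S) \<le> (q - p) + \<delta>"
proof (cases "S = {}")
  case True
  then show ?thesis using \<delta> pq by simp
next
  case False
  have sub: "S \<subseteq> {Min S..Max S}"
    using fin by auto
  have MM: "Min S \<in> S" "Max S \<in> S" using fin False by auto
  have le: "Min S \<le> Max S" using MM fin by auto
  have "card S \<le> card {Min S..Max S}"
    using sub by (intro card_mono) auto
  then have "real (card S) \<le> real_of_int (Max S) - real_of_int (Min S) + 1"
    using le by simp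
  then have "\<delta> * real (card S) \<le> \<delta> * (real_of_int (Max S) - real_of_int (Min S) + 1)"
    using \<delta> by (intro mult_left_mono) auto
  also have "\<dots> = \<delta> * real_of_int (Max S) - \<delta> * real_of_int (Min S) + \<delta>"
    by (simp add: algebra_simps)
  also have "\<dots> \<le> (q - p) + \<delta>"
    using S[OF MM(1)] S[OF MM(2)] by linarith
  finally show ?thesis .
qed

lemma samples_eq:
  fixes p q :: real
  assumes \<delta>: "0 < \<delta>"
  shows "{k::int. p \<le> \<delta> * real_of_int k \<and> \<delta> * real_of_int k \<le> q} = {\<lceil>p / \<delta>\<rceil>..\<lfloor>q / \<delta>\<rfloor>}"
proof -
  have "p \<le> \<delta> * real_of_int k \<longleftrightarrow> \<lceil>p / \<delta>\<rceil> \<le> k" for k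
    using \<delta> by (simp add: ceiling_le_iff pos_divide_le_eq mult.commute)
  moreover have "\<delta> * real_of_int k \<le> q \<longleftrightarrow> k \<le> \<lfloor>q / \<delta>\<rfloor>" for k
    using \<delta> by (simp add: le_floor_iff pos_le_divide_eq mult.commute)
  ultimately show ?thesis by auto
qed

lemma finite_samples:
  fixes p q :: real
  assumes "0 < \<delta>"
  shows "finite {k::int. p \<le> \<delta> * real_of_int k \<and> \<delta> * real_of_int k \<le> q}"
  unfolding samples_eq[OF assms] by simp

lemma card_samples_ge:
  fixes p q :: real
  assumes \<delta>: "0 < \<delta>"
  shows "q - p - \<delta> \<le> \<delta> * real (card {k::int. p \<le> \<delta> * real_of_int k \<and> \<delta> * real_of_int k \<le> q})"
proof -
  have "real_of_int (\<lfloor>q / \<delta>\<rfloor> - \<lceil>p / \<delta>\<rceil> + 1) \<ge> (q / \<delta> - p / \<delta>) - 1"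
    by linarith
  moreover have "real (card {\<lceil>p / \<delta>\<rceil>..\<lfloor>q / \<delta>\<rfloor>}) \<ge> real_of_int (\<lfloor>q / \<delta>\<rfloor> - \<lceil>p / \<delta>\<rceil> + 1)"
    by simp
  ultimately have "(q / \<delta> - p / \<delta>) - 1 \<le> real (card {\<lceil>p / \<delta>\<rceil>..\<lfloor>q / \<delta>\<rfloor>})"
    by linarith
  then have "\<delta> * ((q / \<delta> - p / \<delta>) - 1) \<le> \<delta> * real (card {\<lceil>p / \<delta>\<rceil>..\<lfloor>q / \<delta>\<rfloor>})"
    using \<delta> by (intro mult_left_mono) auto
  moreover have "\<delta> * ((q / \<delta> - p / \<delta>) - 1) = q - p - \<delta>"
    using \<delta> by (simp add: field_simps)
  ultimately show ?thesis unfolding samples_eq[OF \<delta>] by simp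
qed

section \<open>Staircases approximating the straight lines of a given direction\<close>

text \<open>The strip \<open>s \<le> X < s + a + b\<close> has exactly the width for which it is a single monotone
  lattice path: from each of its points precisely one of the two steps stays inside. If \<open>s\<close> is
  uniformly distributed, the step \<open>g1\<close> at a given point is used with density \<open>a\<close> and \<open>g2\<close> with
  density \<open>b\<close>, so these paths decompose the constant vector field of components \<open>(a, b)\<close>.\<close>

locale staircase =
  fixes g1 g2 :: "'p::ab_group_add" and X Y :: "'p \<Rightarrow> real" and a b :: real
  assumes X_g1 [simp]: "\<And>z. X (z + g1) = X z + b" and X_g2 [simp]: "\<And>z. X (z + g2) = X z - a"
    and Y_g1 [simp]: "\<And>z. Y (z + g1) = Y z + a" and Y_g2 [simp]: "\<And>z. Y (z + g2) = Y z + b"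
    and a0: "0 \<le> a" and b0: "0 \<le> b" and a1: "a \<le> 1" and b1: "b \<le> 1"
begin

definition on_line :: "real \<Rightarrow> 'p \<Rightarrow> bool" where
  "on_line s z \<longleftrightarrow> s \<le> X z \<and> X z < s + a + b"

definition nxt :: "real \<Rightarrow> 'p \<Rightarrow> 'p" where
  "nxt s z = (if X z < s + a then z + g1 else z + g2)"

definition prv :: "real \<Rightarrow> 'p \<Rightarrow> 'p" where
  "prv s z = (if X z < s + b then z - g2 else z - g1)"

lemma X_mg1 [simp]: "X (z - g1) = X z - b"
  using X_g1[of "z - g1"] by simp

lemma X_mg2 [simp]: "X (z - g2) = X z + a"
  using X_g2[of "z - g2"] by simp

lemma Y_mg1 [simp]: "Y (z - g1) = Y z - a"
  using Y_g1[of "z - g1"] by simp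

lemma Y_mg2 [simp]: "Y (z - g2) = Y z - b"
  using Y_g2[of "z - g2"] by simp

lemma on_line_nxt: "on_line s z \<Longrightarrow> on_line s (nxt s z)"
  using a0 b0 by (auto simp: on_line_def nxt_def)

lemma on_line_prv: "on_line s z \<Longrightarrow> on_line s (prv s z)"
  using a0 b0 by (auto simp: on_line_def prv_def)

lemma Y_nxt: "on_line s z \<Longrightarrow> Y z < Y (nxt s z) \<and> Y (nxt s z) \<le> Y z + 1"
  using a0 b0 a1 b1 by (auto simp: on_line_def nxt_def)

lemma Y_prv: "on_line s z \<Longrightarrow> Y (prv s z) < Y z \<and> Y z - 1 \<le> Y (prv s z)"
  using a0 b0 a1 b1 by (auto simp: on_line_def prv_def)

lemma nxt_prv: "on_line s z \<Longrightarrow> nxt s (prv s z) = z"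
  by (auto simp: on_line_def prv_def nxt_def)

text \<open>Along the staircase upwards from \<open>z0\<close> the function \<open>g\<close> has to drop from \<open>g z0\<close> to \<open>0\<close> before the staircase
leaves \<open>D\<close>; it does leave \<open>D\<close>, because \<open>Y\<close> increases strictly along it. The sums here and in the
statement for the other direction run over disjoint sets of edges, so that the two bounds can be added.\<close>
lemma forward_variation:
  fixes g :: "'p \<Rightarrow> real"
  assumes fin: "finite D"
    and top: "\<And>z. z \<in> D \<Longrightarrow> on_line s z \<Longrightarrow> nxt s z \<notin> D \<Longrightarrow> g z = 0"
    and z0: "z0 \<in> D" "on_line s z0"
  shows "g z0 \<le> (\<Sum>z\<in>{z\<in>D. on_line s z \<and> nxt s z \<in> D \<and> Y z0 \<le> Y z}. \<bar>g (nxt s z) - g z\<bar>)"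
  using z0
proof (induction "card {z\<in>D. Y z0 \<le> Y z}" arbitrary: z0 rule: less_induct)
  case less
  let ?S = "\<lambda>z0. {z\<in>D. on_line s z \<and> nxt s z \<in> D \<and> Y z0 \<le> Y z}"
  let ?z = "nxt s z0"
  show ?case
  proof (cases "?z \<in> D")
    case False
    then have "g z0 = 0" using top less.prems by blast
    then show ?thesis by (simp add: sum_nonneg)
  next
    case True
    have Y: "Y z0 < Y ?z" using Y_nxt less.prems by blast
    have "{z\<in>D. Y ?z \<le> Y z} \<subseteq> {z\<in>D. Y z0 \<le> Y z}" "z0 \<in> {z\<in>D. Y z0 \<le> Y z}" "z0 \<notin> {z\<in>D. Y ?z \<le> Y z}"
      using Y less.prems by auto
    then have "{z\<in>D. Y ?z \<le> Y z} \<subset> {z\<in>D. Y z0 \<le> Y z}" by blast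
    then have "card {z\<in>D. Y ?z \<le> Y z} < card {z\<in>D. Y z0 \<le> Y z}"
      using fin by (intro psubset_card_mono) auto
    then have IH: "g ?z \<le> (\<Sum>z\<in>?S ?z. \<bar>g (nxt s z) - g z\<bar>)"
      using less.hyps True on_line_nxt less.prems by blast
    have "g z0 \<le> \<bar>g ?z - g z0\<bar> + g ?z" by simp
    also have "\<dots> \<le> \<bar>g ?z - g z0\<bar> + (\<Sum>z\<in>?S ?z. \<bar>g (nxt s z) - g z\<bar>)" using IH by simp
    also have "\<dots> = (\<Sum>z\<in>insert z0 (?S ?z). \<bar>g (nxt s z) - g z\<bar>)"
      using Y fin by (subst sum.insert) auto
    also have "\<dots> \<le> (\<Sum>z\<in>?S z0. \<bar>g (nxt s z) - g z\<bar>)"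
      using Y fin less.prems True by (intro sum_mono2) auto
    finally show ?thesis .
  qed
qed

lemma backward_variation:
  fixes g :: "'p \<Rightarrow> real"
  assumes fin: "finite D"
    and bot: "\<And>z. z \<in> D \<Longrightarrow> on_line s z \<Longrightarrow> prv s z \<notin> D \<Longrightarrow> g z = 0"
    and z0: "z0 \<in> D" "on_line s z0"
  shows "g z0 \<le> (\<Sum>z\<in>{z\<in>D. on_line s z \<and> nxt s z \<in> D \<and> Y z < Y z0}. \<bar>g (nxt s z) - g z\<bar>)"
  using z0
proof (induction "card {z\<in>D. Y z \<le> Y z0}" arbitrary: z0 rule: less_induct)
  case less
  let ?S = "\<lambda>z0. {z\<in>D. on_line s z \<and> nxt s z \<in> D \<and> Y z < Y z0}"
  let ?z = "prv s z0"
  show ?case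
  proof (cases "?z \<in> D")
    case False
    then have "g z0 = 0" using bot less.prems by blast
    then show ?thesis by (simp add: sum_nonneg)
  next
    case True
    have Y: "Y ?z < Y z0" using Y_prv less.prems by blast
    have np: "nxt s ?z = z0" using nxt_prv less.prems by blast
    have ol: "on_line s ?z" using on_line_prv less.prems by blast
    have "{z\<in>D. Y z \<le> Y ?z} \<subseteq> {z\<in>D. Y z \<le> Y z0}" "z0 \<in> {z\<in>D. Y z \<le> Y z0}" "z0 \<notin> {z\<in>D. Y z \<le> Y ?z}"
      using Y less.prems by auto
    then have "{z\<in>D. Y z \<le> Y ?z} \<subset> {z\<in>D. Y z \<le> Y z0}" by blast
    then have "card {z\<in>D. Y z \<le> Y ?z} < card {z\<in>D. Y z \<le> Y z0}"
      using fin by (intro psubset_card_mono) auto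
    then have IH: "g ?z \<le> (\<Sum>z\<in>?S ?z. \<bar>g (nxt s z) - g z\<bar>)"
      using less.hyps True ol by blast
    have "g z0 \<le> \<bar>g (nxt s ?z) - g ?z\<bar> + g ?z" unfolding np by simp
    also have "\<dots> \<le> \<bar>g (nxt s ?z) - g ?z\<bar> + (\<Sum>z\<in>?S ?z. \<bar>g (nxt s z) - g z\<bar>)" using IH by simp
    also have "\<dots> = (\<Sum>z\<in>insert ?z (?S ?z). \<bar>g (nxt s z) - g z\<bar>)"
      using Y fin by (subst sum.insert) auto
    also have "\<dots> \<le> (\<Sum>z\<in>?S z0. \<bar>g (nxt s z) - g z\<bar>)"
      using Y fin less.prems True ol np by (intro sum_mono2) auto
    finally show ?thesis .
  qed
qed

text \<open>Averaging over the staircases through the points \<open>\<delta> k\<close>: an edge \<open>(z, z + g1)\<close> is used by those with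
\<open>X z - a < \<delta> k \<le> X z\<close>, of which there are at most \<open>a / \<delta> + 1\<close>. Sampling replaces an integral over the
lines; it lets the bounds depend on \<open>k\<close> in an arbitrary way.\<close>
lemma line_sum_le:
  fixes F :: "int \<Rightarrow> 'p \<Rightarrow> 'p \<Rightarrow> real" and F0 :: "'p \<Rightarrow> 'p \<Rightarrow> real"
  assumes fin: "finite D" "finite K" and \<delta>: "0 < \<delta>"
    and F: "\<And>k z z'. k \<in> K \<Longrightarrow> z \<in> D \<Longrightarrow> z' \<in> D \<Longrightarrow> z' = z + g1 \<or> z' = z + g2 \<Longrightarrow> F k z z' \<le> F0 z z'"
    and F0: "\<And>z z'. 0 \<le> F0 z z'"
  shows "\<delta> * (\<Sum>k\<in>K. \<Sum>z\<in>{z\<in>D. on_line (\<delta> * of_int k) z \<and> nxt (\<delta> * of_int k) z \<in> D}.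
            F k z (nxt (\<delta> * of_int k) z))
         \<le> (a + \<delta>) * (\<Sum>z\<in>{z\<in>D. z + g1 \<in> D}. F0 z (z + g1))
           + (b + \<delta>) * (\<Sum>z\<in>{z\<in>D. z + g2 \<in> D}. F0 z (z + g2))"
proof -
  let ?s = "\<lambda>k::int. \<delta> * real_of_int k"
  define P1 where "P1 k z \<longleftrightarrow> z + g1 \<in> D \<and> ?s k \<le> X z \<and> X z < ?s k + a" for k z
  define P2 where "P2 k z \<longleftrightarrow> z + g2 \<in> D \<and> ?s k + a \<le> X z \<and> X z < ?s k + a + b" for k z
  have 1: "(\<Sum>z\<in>{z\<in>D. on_line (?s k) z \<and> nxt (?s k) z \<in> D}. F k z (nxt (?s k) z))
      \<le> (\<Sum>z\<in>D. of_bool (P1 k z) * F0 z (z + g1) + of_bool (P2 k z) * F0 z (z + g2))" if k: "k \<in> K" for k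
  proof -
    have "(\<Sum>z\<in>{z\<in>D. on_line (?s k) z \<and> nxt (?s k) z \<in> D}. F k z (nxt (?s k) z))
      \<le> (\<Sum>z\<in>{z\<in>D. on_line (?s k) z \<and> nxt (?s k) z \<in> D}.
            of_bool (P1 k z) * F0 z (z + g1) + of_bool (P2 k z) * F0 z (z + g2))"
    proof (rule sum_mono)
      fix z assume "z \<in> {z\<in>D. on_line (?s k) z \<and> nxt (?s k) z \<in> D}"
      then show "F k z (nxt (?s k) z) \<le> of_bool (P1 k z) * F0 z (z + g1) + of_bool (P2 k z) * F0 z (z + g2)"
        using F[OF k, of z "z + g1"] F[OF k, of z "z + g2"] F0
        by (auto simp: P1_def P2_def on_line_def nxt_def split: if_splits)
    qed
    also have "\<dots> \<le> (\<Sum>z\<in>D. of_bool (P1 k z) * F0 z (z + g1) + of_bool (P2 k z) * F0 z (z + g2))"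
      using fin F0 by (intro sum_mono2) auto
    finally show ?thesis .
  qed
  have n1: "\<delta> * real (card {k\<in>K. P1 k z}) \<le> of_bool (z + g1 \<in> D) * (a + \<delta>)" for z
  proof -
    have "\<delta> * real (card {k\<in>K. P1 k z}) \<le> (X z - (X z - a)) + \<delta>"
      using fin \<delta> a0 by (intro card_samples_le) (auto simp: P1_def)
    moreover have "card {k\<in>K. P1 k z} = 0" if "z + g1 \<notin> D" using that by (simp add: P1_def)
    ultimately show ?thesis by (cases "z + g1 \<in> D") auto
  qed
  have n2: "\<delta> * real (card {k\<in>K. P2 k z}) \<le> of_bool (z + g2 \<in> D) * (b + \<delta>)" for z
  proof -
    have "\<delta> * real (card {k\<in>K. P2 k z}) \<le> ((X z - a) - (X z - a - b)) + \<delta>"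
      using fin \<delta> b0 by (intro card_samples_le) (auto simp: P2_def)
    moreover have "card {k\<in>K. P2 k z} = 0" if "z + g2 \<notin> D" using that by (simp add: P2_def)
    ultimately show ?thesis by (cases "z + g2 \<in> D") auto
  qed
  have s1: "(\<Sum>k\<in>K. of_bool (P k) * c) = real (card {k\<in>K. P k}) * c" for P and c :: real
  proof -
    have "(\<Sum>k\<in>K. of_bool (P k) * c) = (\<Sum>k\<in>{k\<in>K. P k}. c)"
      unfolding sum.inter_filter[OF fin(2)] by (intro sum.cong) auto
    then show ?thesis by simp
  qed
  have filt: "(\<Sum>z\<in>D. of_bool (P z) * h z) = (\<Sum>z\<in>{z\<in>D. P z}. h z)" for P and h :: "'p \<Rightarrow> real"
    unfolding sum.inter_filter[OF fin(1)] by (intro sum.cong) auto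
  have "\<delta> * (\<Sum>k\<in>K. \<Sum>z\<in>{z\<in>D. on_line (?s k) z \<and> nxt (?s k) z \<in> D}. F k z (nxt (?s k) z))
      \<le> \<delta> * (\<Sum>k\<in>K. \<Sum>z\<in>D. of_bool (P1 k z) * F0 z (z + g1) + of_bool (P2 k z) * F0 z (z + g2))"
    using 1 \<delta> by (intro mult_left_mono sum_mono) auto
  also have "\<dots> = (\<Sum>z\<in>D. (\<delta> * real (card {k\<in>K. P1 k z})) * F0 z (z + g1)
                       + (\<delta> * real (card {k\<in>K. P2 k z})) * F0 z (z + g2))"
  proof -
    have "\<delta> * (\<Sum>k\<in>K. of_bool (P1 k z) * F0 z (z + g1) + of_bool (P2 k z) * F0 z (z + g2))
      = (\<delta> * real (card {k\<in>K. P1 k z})) * F0 z (z + g1)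
        + (\<delta> * real (card {k\<in>K. P2 k z})) * F0 z (z + g2)" for z
      by (simp only: sum.distrib s1 distrib_left mult.assoc)
    then show ?thesis
      by (subst sum.swap) (simp only: sum_distrib_left)
  qed
  also have "\<dots> \<le> (\<Sum>z\<in>D. (of_bool (z + g1 \<in> D) * (a + \<delta>)) * F0 z (z + g1)
                       + (of_bool (z + g2 \<in> D) * (b + \<delta>)) * F0 z (z + g2))"
    by (intro sum_mono add_mono mult_right_mono n1 n2 F0)
  also have "\<dots> = (a + \<delta>) * (\<Sum>z\<in>D. of_bool (z + g1 \<in> D) * F0 z (z + g1))
             + (b + \<delta>) * (\<Sum>z\<in>D. of_bool (z + g2 \<in> D) * F0 z (z + g2))"
    unfolding sum.distrib sum_distrib_left by (intro arg_cong2[of _ _ _ _ "(+)"] sum.cong) (simp_all add: ac_simps)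
  also have "\<dots> = (a + \<delta>) * (\<Sum>z\<in>{z\<in>D. z + g1 \<in> D}. F0 z (z + g1))
           + (b + \<delta>) * (\<Sum>z\<in>{z\<in>D. z + g2 \<in> D}. F0 z (z + g2))"
    by (simp only: filt)
  finally show ?thesis .
qed

text \<open>Each staircase contributes through one crossing point \<open>z\<close> with \<open>u z = 1\<close>. The variation of \<open>u\<^sup>2\<close> with
weight \<open>\<beta>\<close> is bounded from below by that of \<open>c u\<^sup>2\<close>, where \<open>c \<le> \<beta>\<close> vanishes at the ends of the line and has
slope \<open>1 / R\<close>; the slope of \<open>c\<close> costs a term with \<open>u\<^sup>2 / R\<close>. If \<open>z\<close> has distance more than \<open>R\<close> from both
ends, there is room for a cut-off on both sides, and the crossing counts twice. Otherwise it counts once, towards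
the far end, since \<open>u\<close> may stay equal to \<open>1\<close> up to the near end.\<close>
lemma gain:
  fixes u \<beta> :: "'p \<Rightarrow> real" and H R \<gamma> \<delta> :: real
  assumes fin: "finite D" "finite K" and \<delta>: "0 < \<delta>" and R: "0 < R" "R + 1 \<le> H"
    and D: "D = {z. \<bar>X z\<bar> < H \<and> \<bar>Y z\<bar> < H}"
    and \<beta>0: "\<And>z. 0 \<le> \<beta> z" and \<beta>1: "\<And>z. \<beta> z \<le> 1"
    and lip1: "\<And>z. \<bar>\<beta> (z + g1) - \<beta> z\<bar> \<le> 1 / R" and lip2: "\<And>z. \<bar>\<beta> (z + g2) - \<beta> z\<bar> \<le> 1 / R"
    and K: "\<And>k. k \<in> K \<Longrightarrow> - H < \<delta> * of_int k \<and> \<delta> * of_int k + a + b \<le> H"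
    and crossing: "\<And>k. k \<in> K \<Longrightarrow> \<exists>z\<in>D. on_line (\<delta> * of_int k) z \<and> u z = 1 \<and>
                       (if \<bar>Y z\<bar> \<le> H - R - 1 then \<gamma> \<le> 2 * \<beta> z else \<gamma> \<le> \<beta> z)"
  defines "F \<equiv> \<lambda>z z'. (\<beta> z + \<beta> z') / 2 * \<bar>(u z')\<^sup>2 - (u z)\<^sup>2\<bar> + 1 / R * (((u z)\<^sup>2 + (u z')\<^sup>2) / 2)"
  shows "\<gamma> * (\<delta> * real (card K)) \<le> (a + \<delta>) * (\<Sum>z\<in>{z\<in>D. z + g1 \<in> D}. F z (z + g1))
           + (b + \<delta>) * (\<Sum>z\<in>{z\<in>D. z + g2 \<in> D}. F z (z + g2))"
proof -
  let ?s = "\<lambda>k::int. \<delta> * real_of_int k"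
  let ?E = "\<lambda>k. {z\<in>D. on_line (?s k) z \<and> nxt (?s k) z \<in> D}"
  define clip where "clip t = max 0 (min 1 t)" for t :: real
  define top where "top z = clip ((H - 1 - Y z) / R)" for z
  define bot where "bot z = clip ((H - 1 + Y z) / R)" for z
  have clip_lip: "\<bar>clip t - clip t'\<bar> \<le> \<bar>t - t'\<bar>" for t t'
    by (auto simp: clip_def max_def min_def abs_if)
  have Ystep: "\<bar>Y z' - Y z\<bar> \<le> 1" if "z' = z + g1 \<or> z' = z + g2" for z z'
    using that a0 b0 a1 b1 by auto
  have top_lip: "\<bar>top z' - top z\<bar> \<le> 1 / R" if "z' = z + g1 \<or> z' = z + g2" for z z'
  proof -
    have "\<bar>top z' - top z\<bar> \<le> \<bar>(H - 1 - Y z') / R - (H - 1 - Y z) / R\<bar>"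
      unfolding top_def by (rule clip_lip)
    also have "\<dots> = \<bar>Y z' - Y z\<bar> / R"
      using R by (simp add: diff_divide_distrib[symmetric] abs_minus_commute)
    also have "\<dots> \<le> 1 / R" using Ystep[OF that] R by (intro divide_right_mono) auto
    finally show ?thesis .
  qed
  have bot_lip: "\<bar>bot z' - bot z\<bar> \<le> 1 / R" if "z' = z + g1 \<or> z' = z + g2" for z z'
  proof -
    have "\<bar>bot z' - bot z\<bar> \<le> \<bar>(H - 1 + Y z') / R - (H - 1 + Y z) / R\<bar>"
      unfolding bot_def by (rule clip_lip)
    also have "\<dots> = \<bar>Y z' - Y z\<bar> / R"
      using R by (simp add: diff_divide_distrib[symmetric])
    also have "\<dots> \<le> 1 / R" using Ystep[OF that] R by (intro divide_right_mono) auto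
    finally show ?thesis .
  qed
  have \<beta>_lip: "\<bar>\<beta> z' - \<beta> z\<bar> \<le> 1 / R" if "z' = z + g1 \<or> z' = z + g2" for z z'
    using that lip1 lip2 by auto
  have min_lip: "\<bar>min p q - min p' q'\<bar> \<le> r" if "\<bar>p - p'\<bar> \<le> r" "\<bar>q - q'\<bar> \<le> r" for p q p' q' r :: real
    using that by (auto simp: min_def abs_if split: if_splits)
  have top_exit: "top z = 0" if "k \<in> K" "z \<in> D" "on_line (?s k) z" "nxt (?s k) z \<notin> D" for k z
  proof -
    have "on_line (?s k) (nxt (?s k) z)" using that on_line_nxt by blast
    then have "\<bar>X (nxt (?s k) z)\<bar> < H" using K[OF that(1)] by (auto simp: on_line_def)
    then have "Y z \<ge> H - 1" using that Y_nxt[OF that(3)] by (auto simp: D)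
    then show ?thesis using R by (simp add: top_def clip_def divide_nonpos_pos)
  qed
  have bot_exit: "bot z = 0" if "k \<in> K" "z \<in> D" "on_line (?s k) z" "prv (?s k) z \<notin> D" for k z
  proof -
    have "on_line (?s k) (prv (?s k) z)" using that on_line_prv by blast
    then have "\<bar>X (prv (?s k) z)\<bar> < H" using K[OF that(1)] by (auto simp: on_line_def)
    then have "- Y z \<ge> H - 1" using that Y_prv[OF that(3)] by (auto simp: D)
    then show ?thesis using R by (simp add: bot_def clip_def divide_nonpos_pos)
  qed
  define good where "good k c \<longleftrightarrow> (\<forall>z. 0 \<le> c z \<and> c z \<le> \<beta> z) \<and>
      (\<forall>z z'. z' = z + g1 \<or> z' = z + g2 \<longrightarrow> \<bar>c z' - c z\<bar> \<le> 1 / R) \<and>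
      \<gamma> \<le> (\<Sum>z\<in>?E k. \<bar>c (nxt (?s k) z) * (u (nxt (?s k) z))\<^sup>2 - c z * (u z)\<^sup>2\<bar>)" for k c
  have "\<exists>c. good k c" if k: "k \<in> K" for k
  proof -
    obtain z0 where z0: "z0 \<in> D" "on_line (?s k) z0" "u z0 = 1"
      and \<gamma>: "if \<bar>Y z0\<bar> \<le> H - R - 1 then \<gamma> \<le> 2 * \<beta> z0 else \<gamma> \<le> \<beta> z0"
      using crossing[OF k] by blast
    have top1: "top z0 = 1" if "Y z0 \<le> H - R - 1"
      using that R by (simp add: top_def clip_def)
    have bot1: "bot z0 = 1" if "- Y z0 \<le> H - R - 1"
      using that R by (simp add: bot_def clip_def)
    have rng: "0 \<le> top z" "0 \<le> bot z" for z by (auto simp: top_def bot_def clip_def)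
    let ?V = "\<lambda>c A. (\<Sum>z\<in>A. \<bar>c (nxt (?s k) z) * (u (nxt (?s k) z))\<^sup>2 - c z * (u z)\<^sup>2\<bar>)"
    let ?up = "{z\<in>D. on_line (?s k) z \<and> nxt (?s k) z \<in> D \<and> Y z0 \<le> Y z}"
    let ?dn = "{z\<in>D. on_line (?s k) z \<and> nxt (?s k) z \<in> D \<and> Y z < Y z0}"
    have fw: "c z0 \<le> ?V c ?up" if "\<And>z. c z = 0 \<or> c z \<le> top z" "\<And>z. 0 \<le> c z" for c
      using forward_variation[OF fin(1) _ z0(1,2), of "\<lambda>z. c z * (u z)\<^sup>2"] that top_exit[OF k] z0(3)
      by (metis (no_types, lifting) mult.right_neutral mult_zero_left order_antisym one_power2)
    have bw: "c z0 \<le> ?V c ?dn" if "\<And>z. c z = 0 \<or> c z \<le> bot z" "\<And>z. 0 \<le> c z" for c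
      using backward_variation[OF fin(1) _ z0(1,2), of "\<lambda>z. c z * (u z)\<^sup>2"] that bot_exit[OF k] z0(3)
      by (metis (no_types, lifting) mult.right_neutral mult_zero_left order_antisym one_power2)
    have up_le: "?V c ?up \<le> ?V c (?E k)" for c
      using fin by (intro sum_mono2) auto
    have dn_le: "?V c ?dn \<le> ?V c (?E k)" for c
      using fin by (intro sum_mono2) auto
    have split: "?V c (?E k) = ?V c ?up + ?V c ?dn" for c
      using fin by (subst sum.union_disjoint[symmetric]) (auto intro!: sum.cong)
    consider (mid) "\<bar>Y z0\<bar> \<le> H - R - 1" | (low) "\<not> \<bar>Y z0\<bar> \<le> H - R - 1" "Y z0 \<le> H - R - 1"
      | (high) "\<not> \<bar>Y z0\<bar> \<le> H - R - 1" "- Y z0 \<le> H - R - 1"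
      using R by linarith
    then show ?thesis
    proof cases
      case mid
      define c where "c z = min (\<beta> z) (min (top z) (bot z))" for z
      have c0: "0 \<le> c z" "c z \<le> top z" "c z \<le> bot z" "c z \<le> \<beta> z" for z
        using rng \<beta>0 by (auto simp: c_def)
      have "c z0 = \<beta> z0" using top1 bot1 mid \<beta>1[of z0] by (simp add: c_def)
      then have "\<gamma> \<le> 2 * c z0" using \<gamma> by (simp only: mid if_True)
      moreover have "c z0 \<le> ?V c ?up" by (rule fw) (simp_all add: c0)
      moreover have "c z0 \<le> ?V c ?dn" by (rule bw) (simp_all add: c0)
      ultimately have "\<gamma> \<le> ?V c (?E k)" unfolding split by linarith
      then have "good k c"
        unfolding good_def using c0 top_lip bot_lip \<beta>_lip by (auto simp: c_def intro!: min_lip)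
      then show ?thesis by blast
    next
      case low
      define c where "c z = min (\<beta> z) (top z)" for z
      have c0: "0 \<le> c z" "c z \<le> top z" "c z \<le> \<beta> z" for z
        using rng \<beta>0 by (auto simp: c_def)
      have "c z0 = \<beta> z0" using top1 low \<beta>1[of z0] by (simp add: c_def)
      then have "\<gamma> \<le> c z0" using \<gamma> by (simp only: low(1) if_False)
      also have "c z0 \<le> ?V c ?up" by (rule fw) (simp_all add: c0)
      also have "\<dots> \<le> ?V c (?E k)" by (rule up_le)
      finally have "\<gamma> \<le> ?V c (?E k)" .
      then have "good k c"
        unfolding good_def using c0 top_lip \<beta>_lip by (auto simp: c_def intro!: min_lip)
      then show ?thesis by blast
    next
      case high
      define c where "c z = min (\<beta> z) (bot z)" for z
      have c0: "0 \<le> c z" "c z \<le> bot z" "c z \<le> \<beta> z" for z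
        using rng \<beta>0 by (auto simp: c_def)
      have "c z0 = \<beta> z0" using bot1 high \<beta>1[of z0] by (simp add: c_def)
      then have "\<gamma> \<le> c z0" using \<gamma> by (simp only: high(1) if_False)
      also have "c z0 \<le> ?V c ?dn" by (rule bw) (simp_all add: c0)
      also have "\<dots> \<le> ?V c (?E k)" by (rule dn_le)
      finally have "\<gamma> \<le> ?V c (?E k)" .
      then have "good k c"
        unfolding good_def using c0 bot_lip \<beta>_lip by (auto simp: c_def intro!: min_lip)
      then show ?thesis by blast
    qed
  qed
  then have "\<forall>k\<in>K. \<exists>c. good k c" by blast
  then obtain c where "\<forall>k\<in>K. good k (c k)" by (rule bchoice[THEN exE])
  then have c: "\<And>k z. k \<in> K \<Longrightarrow> 0 \<le> c k z \<and> c k z \<le> \<beta> z"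
      and c_lip: "\<And>k z z'. k \<in> K \<Longrightarrow> z' = z + g1 \<or> z' = z + g2 \<Longrightarrow> \<bar>c k z' - c k z\<bar> \<le> 1 / R"
      and c_var: "\<And>k. k \<in> K \<Longrightarrow> \<gamma> \<le> (\<Sum>z\<in>?E k. \<bar>c k (nxt (?s k) z) * (u (nxt (?s k) z))\<^sup>2 - c k z * (u z)\<^sup>2\<bar>)"
    unfolding good_def by blast+
  have F: "\<bar>c k z' * (u z')\<^sup>2 - c k z * (u z)\<^sup>2\<bar> \<le> F z z'"
    if k: "k \<in> K" and z': "z' = z + g1 \<or> z' = z + g2" for k z z'
  proof -
    \<comment> \<open>discrete product rule\<close>
    have eq: "c k z' * (u z')\<^sup>2 - c k z * (u z)\<^sup>2
      = (c k z + c k z') / 2 * ((u z')\<^sup>2 - (u z)\<^sup>2) + (c k z' - c k z) * (((u z)\<^sup>2 + (u z')\<^sup>2) / 2)"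
      by (simp add: field_simps)
    have "\<bar>(c k z + c k z') / 2 * ((u z')\<^sup>2 - (u z)\<^sup>2)\<bar> \<le> (\<beta> z + \<beta> z') / 2 * \<bar>(u z')\<^sup>2 - (u z)\<^sup>2\<bar>"
      unfolding abs_mult using c[OF k, of z] c[OF k, of z'] by (intro mult_right_mono) auto
    moreover have "\<bar>(c k z' - c k z) * (((u z)\<^sup>2 + (u z')\<^sup>2) / 2)\<bar> \<le> 1 / R * (((u z)\<^sup>2 + (u z')\<^sup>2) / 2)"
      unfolding abs_mult using c_lip[OF k z'] R by (intro mult_mono) auto
    ultimately show ?thesis unfolding F_def eq by linarith
  qed
  have F0: "0 \<le> F z z'" for z z'
    using \<beta>0[of z] \<beta>0[of z'] R unfolding F_def by (intro add_nonneg_nonneg mult_nonneg_nonneg) auto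
  have "\<gamma> * (\<delta> * real (card K)) = \<delta> * (\<Sum>k\<in>K. \<gamma>)" by simp
  also have "\<dots> \<le> \<delta> * (\<Sum>k\<in>K. \<Sum>z\<in>?E k. \<bar>c k (nxt (?s k) z) * (u (nxt (?s k) z))\<^sup>2 - c k z * (u z)\<^sup>2\<bar>)"
    using \<delta> by (intro mult_left_mono sum_mono c_var) auto
  also have "\<dots> \<le> (a + \<delta>) * (\<Sum>z\<in>{z\<in>D. z + g1 \<in> D}. F z (z + g1))
           + (b + \<delta>) * (\<Sum>z\<in>{z\<in>D. z + g2 \<in> D}. F z (z + g2))"
    by (rule line_sum_le[OF fin \<delta> F F0])
  finally show ?thesis .
qed

end

section \<open>The energy in lattice coordinates\<close>

definition lattice_energy :: "real \<Rightarrow> (int \<times> int) set \<Rightarrow> (int \<times> int \<Rightarrow> real) \<Rightarrow> real" where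
  "lattice_energy l D u = l * (\<Sum>z\<in>D. (u z)\<^sup>2) +
     1 / l * ((\<Sum>z\<in>{z\<in>D. z + (1, 0) \<in> D}. (u (z + (1, 0)) - u z)\<^sup>2) +
              (\<Sum>z\<in>{z\<in>D. z + (0, 1) \<in> D}. (u (z + (0, 1)) - u z)\<^sup>2))"

lemma sum_edge_endpoints_le:
  fixes f :: "'p::ab_group_add \<Rightarrow> real"
  assumes fin: "finite D" and f: "\<And>z. 0 \<le> f z"
  shows "(\<Sum>z\<in>{z\<in>D. z + g \<in> D}. f z + f (z + g)) \<le> 2 * (\<Sum>z\<in>D. f z)"
proof -
  have "(\<Sum>z\<in>{z\<in>D. z + g \<in> D}. f z) \<le> (\<Sum>z\<in>D. f z)"
    using fin f by (intro sum_mono2) auto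
  moreover have "(\<Sum>z\<in>{z\<in>D. z + g \<in> D}. f (z + g)) \<le> (\<Sum>z\<in>D. f z)"
  proof -
    have "(\<Sum>z\<in>{z\<in>D. z + g \<in> D}. f (z + g)) = (\<Sum>z\<in>(\<lambda>z. z + g) ` {z\<in>D. z + g \<in> D}. f z)"
      by (subst sum.reindex) (auto simp: inj_on_def)
    also have "\<dots> \<le> (\<Sum>z\<in>D. f z)"
      using fin f by (intro sum_mono2) auto
    finally show ?thesis .
  qed
  ultimately show ?thesis by (simp add: sum.distrib)
qed

lemma sum_edges_reverse:
  fixes F :: "'p::ab_group_add \<Rightarrow> 'p \<Rightarrow> real"
  assumes "\<And>z z'. F z z' = F z' z"
  shows "(\<Sum>z\<in>{z\<in>D. z + (- g) \<in> D}. F z (z + (- g))) = (\<Sum>z\<in>{z\<in>D. z + g \<in> D}. F z (z + g))"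
proof (rule sum.reindex_bij_witness[where i = "\<lambda>z. z + g" and j = "\<lambda>z. z + (- g)"])
  fix z assume "z \<in> {z\<in>D. z + (- g) \<in> D}"
  then show "F (z + (- g)) (z + (- g) + g) = F z (z + (- g))" using assms by simp
qed auto

text \<open>For \<open>x, y\<close> the values of \<open>u\<close> at the ends of an edge, \<open>W \<bar>y\<^sup>2 - x\<^sup>2\<bar> = \<bar>y - x\<bar> (W \<bar>y + x\<bar>)\<close> is split by Young's
inequality. The weight of the edge is an average of those at its two ends; since the weights vary slowly, it may be
replaced at each end by the value there, with an error \<open>\<kappa>\<close>.\<close>
lemma edge_young:
  fixes p q \<delta> L \<kappa> l x y :: real
  assumes l: "0 < l" and pq: "0 \<le> p" "p \<le> 1" "0 \<le> q" "q \<le> 1" and \<delta>: "0 \<le> \<delta>" and L: "0 \<le> L"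
    and \<kappa>: "2 * L + \<delta> \<le> \<kappa>" "\<kappa> \<le> 1"
    and \<alpha>: "0 \<le> \<alpha>" "0 \<le> \<alpha>'" "\<bar>\<alpha>' - \<alpha>\<bar> \<le> L" and \<beta>: "0 \<le> \<beta>" "0 \<le> \<beta>'" "\<bar>\<beta>' - \<beta>\<bar> \<le> 2 * L"
    and le1: "\<alpha> + \<beta> \<le> 1" "\<alpha>' + \<beta>' \<le> 1"
  shows "((p + \<delta>) * ((\<alpha> + \<alpha>') / 2) + (q + \<delta>) * ((\<beta> + \<beta>') / 2)) * \<bar>y\<^sup>2 - x\<^sup>2\<bar>
     \<le> 1 / l * (y - x)\<^sup>2 + l / 2 * (((p * \<alpha> + q * \<beta>)\<^sup>2 + 3 * \<kappa>) * x\<^sup>2 + ((p * \<alpha>' + q * \<beta>')\<^sup>2 + 3 * \<kappa>) * y\<^sup>2)"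
proof -
  define M N where "M = (\<alpha> + \<alpha>') / 2" and "N = (\<beta> + \<beta>') / 2"
  define W where "W = (p + \<delta>) * M + (q + \<delta>) * N"
  have MN: "0 \<le> M" "0 \<le> N" "M + N \<le> 1"
    using \<alpha> \<beta> le1 by (simp_all add: M_def N_def field_simps)
  have W0: "0 \<le> W" unfolding W_def using MN pq \<delta> by simp
  have sq: "W\<^sup>2 \<le> (p * A + q * B)\<^sup>2 + 3 * \<kappa>"
    if A: "0 \<le> A" "0 \<le> B" "A + B \<le> 1" "M \<le> A + L" "N \<le> B + L" for A B
  proof -
    have "\<delta> * (M + N) \<le> \<delta> * 1"
      using MN by (intro mult_left_mono[OF _ \<delta>])
    moreover have "p * M \<le> p * A + p * L"
      using mult_left_mono[OF A(4) pq(1)] by (simp add: distrib_left)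
    moreover have "q * N \<le> q * B + q * L"
      using mult_left_mono[OF A(5) pq(3)] by (simp add: distrib_left)
    moreover have "p * L \<le> L" "q * L \<le> L"
      using pq L by (auto simp: mult_left_le_one_le)
    ultimately have W: "W \<le> (p * A + q * B) + \<kappa>"
      using \<kappa>(1) unfolding W_def by (simp add: algebra_simps)
    have "p * A \<le> A" "q * B \<le> B"
      using pq A by (auto simp: mult_left_le_one_le)
    then have P: "0 \<le> p * A + q * B" "p * A + q * B \<le> 1" using pq A by auto
    have \<kappa>0: "0 \<le> \<kappa>" using \<kappa> L \<delta> by linarith
    have "W\<^sup>2 \<le> ((p * A + q * B) + \<kappa>)\<^sup>2" using W W0 by (intro power_mono) auto
    also have "\<dots> = (p * A + q * B)\<^sup>2 + 2 * ((p * A + q * B) * \<kappa>) + \<kappa> * \<kappa>"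
      by (simp add: power2_eq_square algebra_simps)
    also have "\<dots> \<le> (p * A + q * B)\<^sup>2 + 2 * \<kappa> + \<kappa>"
      using P \<kappa>0 \<kappa>(2) by (intro add_mono mult_left_mono) (auto simp: mult_left_le_one_le)
    finally show ?thesis by simp
  qed
  have "(y\<^sup>2 - x\<^sup>2) = (y - x) * (y + x)" by (simp add: power2_eq_square algebra_simps)
  then have "W * \<bar>y\<^sup>2 - x\<^sup>2\<bar> = \<bar>y - x\<bar> * (W * \<bar>y + x\<bar>)" by (simp add: abs_mult)
  also have "\<dots> \<le> 1 / l * (y - x)\<^sup>2 + l / 4 * (W\<^sup>2 * (y + x)\<^sup>2)"
  proof -
    have "s * t \<le> 1 / l * s\<^sup>2 + l / 4 * t\<^sup>2" for s t :: real
    proof -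
      have "0 \<le> 1 / l * (s - l / 2 * t)\<^sup>2" using l by simp
      also have "\<dots> = 1 / l * s\<^sup>2 + l / 4 * t\<^sup>2 - s * t"
        using l by (simp add: power2_eq_square field_simps)
      finally show ?thesis by simp
    qed
    from this[of "\<bar>y - x\<bar>" "W * \<bar>y + x\<bar>"] show ?thesis
      by (simp add: power_mult_distrib)
  qed
  also have "(y + x)\<^sup>2 \<le> 2 * (x\<^sup>2 + y\<^sup>2)" 
    using zero_le_power2[of "y - x"] by (simp add: power2_eq_square algebra_simps)
  then have "l / 4 * (W\<^sup>2 * (y + x)\<^sup>2) \<le> l / 4 * (W\<^sup>2 * (2 * (x\<^sup>2 + y\<^sup>2)))"
    using l by (intro mult_left_mono) auto
  also have "l / 4 * (W\<^sup>2 * (2 * (x\<^sup>2 + y\<^sup>2))) = l / 2 * (W\<^sup>2 * x\<^sup>2 + W\<^sup>2 * y\<^sup>2)"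
    by (simp add: algebra_simps)
  also have "l / 2 * (W\<^sup>2 * x\<^sup>2 + W\<^sup>2 * y\<^sup>2) \<le> l / 2 * (((p * \<alpha> + q * \<beta>)\<^sup>2 + 3 * \<kappa>) * x\<^sup>2 + ((p * \<alpha>' + q * \<beta>')\<^sup>2 + 3 * \<kappa>) * y\<^sup>2)"
    using l \<alpha> \<beta> le1 L by (intro mult_left_mono add_mono mult_right_mono sq)
      (auto simp: abs_le_iff M_def N_def field_simps)
  finally show ?thesis unfolding W_def M_def N_def by simp
qed

text \<open>The weight of a horizontal edge is close to \<open>P = a \<alpha> + b \<beta>\<close> and that of a vertical one to
\<open>Q = b \<alpha> + a \<beta>\<close>, because columns have direction \<open>(a, b)\<close> and rows are orthogonal to them. As \<open>2 a b \<le> 1\<close>,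
\<open>P\<^sup>2 + Q\<^sup>2 \<le> (\<alpha> + \<beta>)\<^sup>2 \<le> 1\<close>, which makes the coefficient of \<open>u\<^sup>2\<close> at most \<open>l\<close> up to the errors.\<close>
lemma weighted_variation_le_energy:
  fixes u \<alpha> \<beta> :: "int \<times> int \<Rightarrow> real"
  assumes fin: "finite D" and l: "0 < l" and ab: "0 \<le> a" "0 \<le> b" "a\<^sup>2 + b\<^sup>2 = 1"
    and \<delta>: "0 \<le> \<delta>" and L: "0 \<le> L" and \<kappa>: "2 * L + \<delta> \<le> \<kappa>" "\<kappa> \<le> 1"
    and \<alpha>\<beta>: "\<And>z. 0 \<le> \<alpha> z" "\<And>z. 0 \<le> \<beta> z" "\<And>z. \<alpha> z + \<beta> z \<le> 1"
    and lip: "\<And>z g. g = (1, 0) \<or> g = (0, 1) \<Longrightarrow> \<bar>\<alpha> (z + g) - \<alpha> z\<bar> \<le> L \<and> \<bar>\<beta> (z + g) - \<beta> z\<bar> \<le> 2 * L"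
  defines "G \<equiv> \<lambda>p q z z'. ((p + \<delta>) * ((\<alpha> z + \<alpha> z') / 2) + (q + \<delta>) * ((\<beta> z + \<beta> z') / 2)) * \<bar>(u z')\<^sup>2 - (u z)\<^sup>2\<bar>
                   + 3 * L * ((u z)\<^sup>2 + (u z')\<^sup>2)"
  shows "(\<Sum>z\<in>{z\<in>D. z + (1, 0) \<in> D}. G a b z (z + (1, 0))) + (\<Sum>z\<in>{z\<in>D. z + (0, 1) \<in> D}. G b a z (z + (0, 1)))
      \<le> (1 + 6 * \<kappa> + 12 * L / l) * lattice_energy l D u"
proof -
  have "a\<^sup>2 \<le> 1\<^sup>2" "b\<^sup>2 \<le> 1\<^sup>2"
    using ab zero_le_power2[of a] zero_le_power2[of b] unfolding one_power2 by linarith+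
  then have a1: "a \<le> 1" "b \<le> 1"
    by (simp_all add: power2_le_imp_le)
  have edge: "(\<Sum>z\<in>{z\<in>D. z + g \<in> D}. G p q z (z + g)) \<le>
      1 / l * (\<Sum>z\<in>{z\<in>D. z + g \<in> D}. (u (z + g) - u z)\<^sup>2)
      + l * (\<Sum>z\<in>D. ((p * \<alpha> z + q * \<beta> z)\<^sup>2 + 3 * \<kappa>) * (u z)\<^sup>2) + 6 * L * (\<Sum>z\<in>D. (u z)\<^sup>2)"
    if g: "g = (1, 0) \<or> g = (0, 1)" and pq: "0 \<le> p" "p \<le> 1" "0 \<le> q" "q \<le> 1" for g p q
  proof -
    let ?f = "\<lambda>z. ((p * \<alpha> z + q * \<beta> z)\<^sup>2 + 3 * \<kappa>) * (u z)\<^sup>2"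
    have \<kappa>0: "0 \<le> \<kappa>" using \<kappa> L \<delta> by linarith
    have "(\<Sum>z\<in>{z\<in>D. z + g \<in> D}. G p q z (z + g)) \<le>
       (\<Sum>z\<in>{z\<in>D. z + g \<in> D}. 1 / l * (u (z + g) - u z)\<^sup>2 + l / 2 * (?f z + ?f (z + g)) + 3 * L * ((u z)\<^sup>2 + (u (z + g))\<^sup>2))"
    proof (rule sum_mono)
      fix z
      show "G p q z (z + g) \<le> 1 / l * (u (z + g) - u z)\<^sup>2 + l / 2 * (?f z + ?f (z + g)) + 3 * L * ((u z)\<^sup>2 + (u (z + g))\<^sup>2)"
        unfolding G_def using lip[OF g, of z]
        by (intro add_right_mono edge_young[OF l pq \<delta> L \<kappa>] \<alpha>\<beta>) simp_all
    qed
    also have "\<dots> = 1 / l * (\<Sum>z\<in>{z\<in>D. z + g \<in> D}. (u (z + g) - u z)\<^sup>2)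
        + l / 2 * (\<Sum>z\<in>{z\<in>D. z + g \<in> D}. ?f z + ?f (z + g)) + 3 * L * (\<Sum>z\<in>{z\<in>D. z + g \<in> D}. (u z)\<^sup>2 + (u (z + g))\<^sup>2)"
      by (simp only: sum.distrib sum_distrib_left distrib_left mult.assoc add.assoc)
    also have "\<dots> \<le> 1 / l * (\<Sum>z\<in>{z\<in>D. z + g \<in> D}. (u (z + g) - u z)\<^sup>2)
        + l / 2 * (2 * (\<Sum>z\<in>D. ?f z)) + 3 * L * (2 * (\<Sum>z\<in>D. (u z)\<^sup>2))"
      using l L \<kappa>0 by (intro add_mono mult_left_mono sum_edge_endpoints_le fin order_refl) auto
    finally show ?thesis by simp
  qed
  have quad: "(a * x + b * y)\<^sup>2 + (b * x + a * y)\<^sup>2 \<le> 1" if "0 \<le> x" "0 \<le> y" "x + y \<le> 1" for x y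
  proof -
    have "2 * a * b \<le> 1" using ab(3) sum_squares_bound[of a b] by simp
    then have "(2 * a * b) * (2 * x * y) \<le> 1 * (2 * x * y)" using that by (intro mult_right_mono) auto
    moreover have "(a * x + b * y)\<^sup>2 + (b * x + a * y)\<^sup>2 = (a\<^sup>2 + b\<^sup>2) * (x\<^sup>2 + y\<^sup>2) + (2 * a * b) * (2 * x * y)"
      by (simp add: power2_eq_square algebra_simps)
    ultimately have "(a * x + b * y)\<^sup>2 + (b * x + a * y)\<^sup>2 \<le> (x + y)\<^sup>2"
      unfolding ab(3) by (simp add: power2_sum)
    also have "\<dots> \<le> 1" using that by (simp add: power_le_one)
    finally show ?thesis .
  qed
  let ?M = "\<Sum>z\<in>D. (u z)\<^sup>2"
  let ?h = "\<Sum>z\<in>{z\<in>D. z + (1, 0) \<in> D}. (u (z + (1, 0)) - u z)\<^sup>2"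
  let ?v = "\<Sum>z\<in>{z\<in>D. z + (0, 1) \<in> D}. (u (z + (0, 1)) - u z)\<^sup>2"
  have \<kappa>0: "0 \<le> \<kappa>" using \<kappa> L \<delta> by linarith
  have M0: "0 \<le> ?M" "0 \<le> 1 / l * (?h + ?v)" using l by (auto intro!: sum_nonneg add_nonneg_nonneg divide_nonneg_pos)
  have "(\<Sum>z\<in>D. ((a * \<alpha> z + b * \<beta> z)\<^sup>2 + 3 * \<kappa>) * (u z)\<^sup>2) + (\<Sum>z\<in>D. ((b * \<alpha> z + a * \<beta> z)\<^sup>2 + 3 * \<kappa>) * (u z)\<^sup>2)
     = (\<Sum>z\<in>D. (((a * \<alpha> z + b * \<beta> z)\<^sup>2 + (b * \<alpha> z + a * \<beta> z)\<^sup>2) + 6 * \<kappa>) * (u z)\<^sup>2)"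
    unfolding sum.distrib[symmetric] by (intro sum.cong) (auto simp: algebra_simps)
  also have "\<dots> \<le> (\<Sum>z\<in>D. (1 + 6 * \<kappa>) * (u z)\<^sup>2)"
    using \<alpha>\<beta> by (intro sum_mono mult_right_mono add_right_mono quad) auto
  finally have pot: "(\<Sum>z\<in>D. ((a * \<alpha> z + b * \<beta> z)\<^sup>2 + 3 * \<kappa>) * (u z)\<^sup>2) + (\<Sum>z\<in>D. ((b * \<alpha> z + a * \<beta> z)\<^sup>2 + 3 * \<kappa>) * (u z)\<^sup>2)
     \<le> (1 + 6 * \<kappa>) * ?M" by (simp only: sum_distrib_left)
  have "(\<Sum>z\<in>{z\<in>D. z + (1, 0) \<in> D}. G a b z (z + (1, 0))) + (\<Sum>z\<in>{z\<in>D. z + (0, 1) \<in> D}. G b a z (z + (0, 1)))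
     \<le> 1 / l * (?h + ?v) + l * ((1 + 6 * \<kappa>) * ?M) + 12 * L * ?M"
    using edge[of "(1, 0)" a b] edge[of "(0, 1)" b a] ab a1 mult_left_mono[OF pot, of l] l
    by (simp add: distrib_left)
  also have "\<dots> \<le> (1 + 6 * \<kappa>) * (1 / l * (?h + ?v)) + (1 + 6 * \<kappa>) * (l * ?M) + 12 * L / l * (l * ?M + 1 / l * (?h + ?v))"
  proof -
    have "1 * (1 / l * (?h + ?v)) \<le> (1 + 6 * \<kappa>) * (1 / l * (?h + ?v))"
      using M0 \<kappa>0 by (intro mult_right_mono) auto
    moreover have "12 * L / l * (l * ?M) \<le> 12 * L / l * (l * ?M + 1 / l * (?h + ?v))"
      using M0 L l by (intro mult_left_mono) auto
    moreover have "12 * L / l * (l * ?M) = 12 * L * ?M" using l by simp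
    ultimately show ?thesis by (simp add: ac_simps)
  qed
  also have "\<dots> = (1 + 6 * \<kappa> + 12 * L / l) * lattice_energy l D u"
  proof -
    have "(1 + 6 * \<kappa>) * B + (1 + 6 * \<kappa>) * A + e * (A + B) = (1 + 6 * \<kappa> + e) * (A + B)" for A B e
      by (simp add: algebra_simps)
    then show ?thesis unfolding lattice_energy_def .
  qed
  finally show ?thesis .
qed

section \<open>Discrete intermediate values\<close>

lemma first_crossing:
  fixes h :: "'p \<Rightarrow> real"
  assumes p: "successively (\<lambda>z z'. \<bar>h z' - h z\<bar> \<le> w) p" "p \<noteq> []" and "h (hd p) < s" "s \<le> h (last p)"
  obtains p1 z p2 where "p = p1 @ z # p2" "p1 \<noteq> []" "\<And>x. x \<in> set p1 \<Longrightarrow> h x < s" "s \<le> h z" "h z < s + w"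
proof -
  have "\<exists>x\<in>set p. s \<le> h x" using p(2) assms(4) last_in_set by blast
  from split_list_first_prop[OF this] obtain p1 z p2
    where 1: "p = p1 @ z # p2" "s \<le> h z" "\<forall>x\<in>set p1. \<not> s \<le> h x" by blast
  have ne: "p1 \<noteq> []" using 1 assms(3) by auto
  have "\<bar>h z - h (last p1)\<bar> \<le> w" using p(1) ne unfolding 1(1) by (simp add: successively_append_iff)
  moreover have "h (last p1) < s" using 1 ne by (meson last_in_set not_le)
  ultimately have "h z < s + w" by linarith
  then show ?thesis using that[OF 1(1) ne] 1 by (auto simp: not_le)
qed

lemma last_crossing:
  fixes h :: "'p \<Rightarrow> real"
  assumes p: "successively (\<lambda>z z'. \<bar>h z' - h z\<bar> \<le> w) p" "p \<noteq> []" and "h (hd p) < s + w" "s + w \<le> h (last p)"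
  obtains p1 z p2 where "p = p1 @ z # p2" "p2 \<noteq> []" "\<And>x. x \<in> set p2 \<Longrightarrow> s + w \<le> h x" "s \<le> h z" "h z < s + w"
proof -
  have "\<exists>x\<in>set p. h x < s + w" using p(2) assms(3) hd_in_set by blast
  from split_list_last_prop[OF this] obtain p1 z p2
    where 1: "p = p1 @ z # p2" "h z < s + w" "\<forall>x\<in>set p2. \<not> h x < s + w" by blast
  have ne: "p2 \<noteq> []" using 1 assms(4) by auto
  have "\<bar>h (hd p2) - h z\<bar> \<le> w" using p(1) ne unfolding 1(1) by (auto simp: successively_append_iff successively_Cons)
  moreover have "s + w \<le> h (hd p2)" using 1 ne by (meson hd_in_set not_less)
  ultimately have "s \<le> h z" by linarith
  then show ?thesis using that[OF 1(1) ne] 1 by (auto simp: not_less)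
qed

lemma crossing_point:
  fixes h :: "'p \<Rightarrow> real"
  assumes p: "successively (\<lambda>z z'. \<bar>h z' - h z\<bar> \<le> w) p" "p \<noteq> []"
    and "h (hd p) < s \<and> s \<le> h (last p) \<or> h (last p) < s \<and> s \<le> h (hd p)"
  shows "\<exists>z\<in>set p. s \<le> h z \<and> h z < s + w"
  using assms(3)
proof
  assume "h (hd p) < s \<and> s \<le> h (last p)"
  then obtain p1 z p2 where "p = p1 @ z # p2" "s \<le> h z" "h z < s + w"
    using first_crossing[OF p, of s] by blast
  then show ?thesis by auto
next
  assume as: "h (last p) < s \<and> s \<le> h (hd p)"
  have r: "successively (\<lambda>z z'. \<bar>h z' - h z\<bar> \<le> w) (rev p)" "rev p \<noteq> []"
    using p by (auto simp: abs_minus_commute)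
  have "h (hd (rev p)) < s" "s \<le> h (last (rev p))" using as p by (auto simp: hd_rev last_rev)
  then obtain p1 z p2 where z: "rev p = p1 @ z # p2" "s \<le> h z" "h z < s + w"
    using first_crossing[OF r, of s] by blast
  have "set p = set (p1 @ z # p2)" unfolding z(1)[symmetric] by simp
  then show ?thesis using z by auto
qed

section \<open>A crossing path carries at least its length in energy\<close>

definition lattice_steps :: "(int \<times> int) set" where
  "lattice_steps = {(1, 0), (-1, 0), (0, 1), (0, -1)}"

abbreviation adjacent :: "int \<times> int \<Rightarrow> int \<times> int \<Rightarrow> bool" where
  "adjacent z z' \<equiv> z' - z \<in> lattice_steps"

text \<open>The coordinates \<open>X\<close> and \<open>Y\<close> of a lattice point along and across the direction of the channel; they arise
  from the integer coordinates by a rotation, and \<open>D H\<close> is the rotated open square of side \<open>2 H\<close>.\<close>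
locale rotated_lattice =
  fixes a b :: real
  assumes a0: "0 \<le> a" and b0: "0 \<le> b" and ab: "a\<^sup>2 + b\<^sup>2 = 1"
begin

definition X :: "int \<times> int \<Rightarrow> real" where "X z = b * of_int (fst z) - a * of_int (snd z)"
definition Y :: "int \<times> int \<Rightarrow> real" where "Y z = a * of_int (fst z) + b * of_int (snd z)"
definition D :: "real \<Rightarrow> (int \<times> int) set" where "D H = {z. \<bar>X z\<bar> < H \<and> \<bar>Y z\<bar> < H}"

lemma a_le_1: "a \<le> 1" and b_le_1: "b \<le> 1"
proof -
  have "a\<^sup>2 \<le> 1\<^sup>2" "b\<^sup>2 \<le> 1\<^sup>2"
    using ab zero_le_power2[of a] zero_le_power2[of b] unfolding one_power2 by linarith+
  then show "a \<le> 1" "b \<le> 1" by (simp_all add: power2_le_imp_le)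
qed

lemma one_le_sum: "1 \<le> a + b"
proof -
  have "a * a \<le> a * 1" "b * b \<le> b * 1"
    using mult_left_mono[OF a_le_1 a0] mult_left_mono[OF b_le_1 b0] .
  then show ?thesis using ab by (simp add: power2_eq_square)
qed

lemma fst_eq: "of_int (fst z) = b * X z + a * Y z"
proof -
  have "b * X z + a * Y z = (a\<^sup>2 + b\<^sup>2) * of_int (fst z)"
    by (simp add: X_def Y_def power2_eq_square algebra_simps)
  then show ?thesis by (simp add: ab)
qed

lemma snd_eq: "of_int (snd z) = b * Y z - a * X z"
proof -
  have "b * Y z - a * X z = (a\<^sup>2 + b\<^sup>2) * of_int (snd z)"
    by (simp add: X_def Y_def power2_eq_square algebra_simps)
  then show ?thesis by (simp add: ab)
qed

lemma finite_box: "finite {z. \<bar>X z\<bar> \<le> r \<and> \<bar>Y z\<bar> \<le> s}"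
proof (rule finite_subset)
  show "{z. \<bar>X z\<bar> \<le> r \<and> \<bar>Y z\<bar> \<le> s} \<subseteq> {-\<lceil>r + s\<rceil>..\<lceil>r + s\<rceil>} \<times> {-\<lceil>r + s\<rceil>..\<lceil>r + s\<rceil>}"
  proof
    fix z assume z: "z \<in> {z. \<bar>X z\<bar> \<le> r \<and> \<bar>Y z\<bar> \<le> s}"
    have m: "\<bar>b * x\<bar> \<le> \<bar>x\<bar>" "\<bar>a * x\<bar> \<le> \<bar>x\<bar>" for x
      using a0 b0 a_le_1 b_le_1 by (auto simp: abs_mult mult_left_le_one_le)
    have "\<bar>real_of_int (fst z)\<bar> \<le> r + s"
      using z m(1)[of "X z"] m(2)[of "Y z"] unfolding fst_eq by auto
    moreover have "\<bar>real_of_int (snd z)\<bar> \<le> r + s"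
      using z m(2)[of "X z"] m(1)[of "Y z"] unfolding snd_eq by auto
    ultimately have "\<bar>fst z\<bar> \<le> \<lceil>r + s\<rceil>" "\<bar>snd z\<bar> \<le> \<lceil>r + s\<rceil>"
      by linarith+
    then show "z \<in> {-\<lceil>r + s\<rceil>..\<lceil>r + s\<rceil>} \<times> {-\<lceil>r + s\<rceil>..\<lceil>r + s\<rceil>}"
      by (cases z) auto
  qed
qed simp

lemma finite_D: "finite (D H)"
  by (rule finite_subset[OF _ finite_box[of H H]]) (auto simp: D_def)

lemma step_le:
  assumes "adjacent z z'"
  shows "\<bar>X z' - X z\<bar> \<le> 1" "\<bar>Y z' - Y z\<bar> \<le> 1" "\<bar>X z' - X z\<bar> \<le> a + b" "\<bar>Y z' - Y z\<bar> \<le> a + b"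
proof -
  obtain g where g: "g \<in> lattice_steps" "z' = z + g" using assms by (metis add_diff_cancel_left' diff_add_cancel add.commute)
  then have "X z' - X z = b * of_int (fst g) - a * of_int (snd g)"
    "Y z' - Y z = a * of_int (fst g) + b * of_int (snd g)"
    by (simp_all add: X_def Y_def algebra_simps)
  then show "\<bar>X z' - X z\<bar> \<le> 1" "\<bar>Y z' - Y z\<bar> \<le> 1" "\<bar>X z' - X z\<bar> \<le> a + b" "\<bar>Y z' - Y z\<bar> \<le> a + b"
    using g(1) a0 b0 a_le_1 b_le_1 by (auto simp: lattice_steps_def)
qed

sublocale columns: staircase "(1, 0)" "(0, 1)" X Y a b
  by unfold_locales (auto simp: X_def Y_def algebra_simps a0 b0 a_le_1 b_le_1)

sublocale rows: staircase "(0, 1)" "- (1, 0)" Y "\<lambda>z. - X z" a b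
  by unfold_locales (auto simp: X_def Y_def algebra_simps a0 b0 a_le_1 b_le_1)


text \<open>The bounds for single families of lines are linear in the weights; hence their sum is a weighted variation with
weights \<open>\<alpha>\<close> for columns and \<open>\<beta>L + \<beta>R\<close> for rows, which the energy controls. Two
families of rows are needed to count crossings in the left and in the right part of the square separately.\<close>
lemma calibration:
  fixes u \<alpha> \<beta>L \<beta>R :: "int \<times> int \<Rightarrow> real" and H R l \<gamma> \<delta> :: real
  assumes R: "3 \<le> R" "R + 1 \<le> H" and l: "0 < l" and \<delta>: "\<delta> = 1 / R"
    and fin: "finite K" "finite K1" "finite K2"
    and nonneg: "\<And>z. 0 \<le> \<alpha> z" "\<And>z. 0 \<le> \<beta>L z" "\<And>z. 0 \<le> \<beta>R z" and sum1: "\<And>z. \<alpha> z + \<beta>L z + \<beta>R z \<le> 1"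
    and lip: "\<And>z g. g = (1, 0) \<or> g = (0, 1) \<Longrightarrow> \<bar>\<alpha> (z + g) - \<alpha> z\<bar> \<le> 1 / R \<and>
                \<bar>\<beta>L (z + g) - \<beta>L z\<bar> \<le> 1 / R \<and> \<bar>\<beta>R (z + g) - \<beta>R z\<bar> \<le> 1 / R"
    and range: "\<And>k. k \<in> K \<union> K1 \<union> K2 \<Longrightarrow> - H < \<delta> * of_int k \<and> \<delta> * of_int k + a + b \<le> H"
    and K: "\<And>k. k \<in> K \<Longrightarrow> \<exists>z\<in>D H. columns.on_line (\<delta> * of_int k) z \<and> u z = 1 \<and>
              (if \<bar>Y z\<bar> \<le> H - R - 1 then \<gamma> \<le> 2 * \<alpha> z else \<gamma> \<le> \<alpha> z)"
    and K1: "\<And>k. k \<in> K1 \<Longrightarrow> \<exists>z\<in>D H. rows.on_line (\<delta> * of_int k) z \<and> u z = 1 \<and>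
              (if \<bar>X z\<bar> \<le> H - R - 1 then \<gamma> \<le> 2 * \<beta>L z else \<gamma> \<le> \<beta>L z)"
    and K2: "\<And>k. k \<in> K2 \<Longrightarrow> \<exists>z\<in>D H. rows.on_line (\<delta> * of_int k) z \<and> u z = 1 \<and>
              (if \<bar>X z\<bar> \<le> H - R - 1 then \<gamma> \<le> 2 * \<beta>R z else \<gamma> \<le> \<beta>R z)"
  shows "\<gamma> * (\<delta> * real (card K) + \<delta> * real (card K1) + \<delta> * real (card K2))
     \<le> (1 + 18 / R + 12 / (R * l)) * lattice_energy l (D H) u"
proof -
  define F where "F f z z' = (f z + f z') / 2 * \<bar>(u z')\<^sup>2 - (u z)\<^sup>2\<bar> + 1 / R * (((u z)\<^sup>2 + (u z')\<^sup>2) / 2)"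
    for f :: "int \<times> int \<Rightarrow> real" and z z'
  let ?h = "\<lambda>f. \<Sum>z\<in>{z\<in>D H. z + (1, 0) \<in> D H}. F f z (z + (1, 0))"
  let ?v = "\<lambda>f. \<Sum>z\<in>{z\<in>D H. z + (0, 1) \<in> D H}. F f z (z + (0, 1))"
  have R0: "0 < R" and \<delta>0: "0 < \<delta>" and \<delta>1: "\<delta> \<le> 1" using R by (simp_all add: \<delta>)
  have le1: "\<alpha> z \<le> 1" "\<beta>L z \<le> 1" "\<beta>R z \<le> 1" for z
    using nonneg[of z] sum1[of z] by linarith+
  have F_sym: "F f z z' = F f z' z" for f z z'
    by (simp add: F_def add.commute abs_minus_commute)
  have col: "\<gamma> * (\<delta> * real (card K)) \<le> (a + \<delta>) * ?h \<alpha> + (b + \<delta>) * ?v \<alpha>"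
    unfolding F_def using lip range
    by (intro columns.gain[where H = H] finite_D fin \<delta>0 R R0 nonneg le1 K) (auto simp: D_def)
  have row: "\<gamma> * (\<delta> * real (card K')) \<le> (a + \<delta>) * ?v f + (b + \<delta>) * ?h f"
    if K': "finite K'" "\<And>k. k \<in> K' \<Longrightarrow> - H < \<delta> * of_int k \<and> \<delta> * of_int k + a + b \<le> H"
        "\<And>k. k \<in> K' \<Longrightarrow> \<exists>z\<in>D H. rows.on_line (\<delta> * of_int k) z \<and> u z = 1 \<and>
              (if \<bar>- X z\<bar> \<le> H - R - 1 then \<gamma> \<le> 2 * f z else \<gamma> \<le> f z)"
      and f: "\<And>z. 0 \<le> f z" "\<And>z. f z \<le> 1"
        "\<And>z g. g = (1, 0) \<or> g = (0, 1) \<Longrightarrow> \<bar>f (z + g) - f z\<bar> \<le> 1 / R" for f K'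
  proof -
    have f3: "\<bar>f (z + - (1, 0)) - f z\<bar> \<le> 1 / R" for z
      unfolding diff_conv_add_uminus[symmetric]
      using f(3)[of "(1, 0)" "z - (1, 0)"] by (simp add: abs_minus_commute)
    have f4: "\<bar>f (z + (0, 1)) - f z\<bar> \<le> 1 / R" for z
      using f(3)[of "(0, 1)" z] by simp
    have D: "D H = {z. \<bar>Y z\<bar> < H \<and> \<bar>- X z\<bar> < H}" by (auto simp: D_def)
    have "\<gamma> * (\<delta> * real (card K')) \<le> (a + \<delta>) * ?v f
      + (b + \<delta>) * (\<Sum>z\<in>{z\<in>D H. z + - (1, 0) \<in> D H}. F f z (z + - (1, 0)))"
      unfolding F_def
      by (rule rows.gain[OF finite_D K'(1) \<delta>0 R0 R(2) D f(1) f(2) f4 f3 K'(2) K'(3)])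
    also have "(\<Sum>z\<in>{z\<in>D H. z + - (1, 0) \<in> D H}. F f z (z + - (1, 0))) = ?h f"
      by (rule sum_edges_reverse) (rule F_sym)
    finally show ?thesis .
  qed
  have row1: "\<gamma> * (\<delta> * real (card K1)) \<le> (a + \<delta>) * ?v \<beta>L + (b + \<delta>) * ?h \<beta>L"
    using K1 range lip by (intro row fin nonneg le1) auto
  have row2: "\<gamma> * (\<delta> * real (card K2)) \<le> (a + \<delta>) * ?v \<beta>R + (b + \<delta>) * ?h \<beta>R"
    using K2 range lip by (intro row fin nonneg le1) auto
  define \<beta> where "\<beta> z = \<beta>L z + \<beta>R z" for z
  define G where "G c d z z' = ((c + \<delta>) * ((\<alpha> z + \<alpha> z') / 2) + (d + \<delta>) * ((\<beta> z + \<beta> z') / 2)) * \<bar>(u z')\<^sup>2 - (u z)\<^sup>2\<bar>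
                   + 3 * (1 / R) * ((u z)\<^sup>2 + (u z')\<^sup>2)" for c d z z'
  have FG: "(c + \<delta>) * F \<alpha> z z' + (d + \<delta>) * F \<beta>L z z' + (d + \<delta>) * F \<beta>R z z' \<le> G c d z z'"
    if "c \<le> 1" "d \<le> 1" for c d z z'
  proof -
    have eq: "(c + \<delta>) * F \<alpha> z z' + (d + \<delta>) * F \<beta>L z z' + (d + \<delta>) * F \<beta>R z z'
       = ((c + \<delta>) * ((\<alpha> z + \<alpha> z') / 2) + (d + \<delta>) * ((\<beta> z + \<beta> z') / 2)) * \<bar>(u z')\<^sup>2 - (u z)\<^sup>2\<bar>
         + ((c + \<delta>) / 2 + (d + \<delta>)) * (1 / R * ((u z)\<^sup>2 + (u z')\<^sup>2))"
      using R0 by (simp add: F_def \<beta>_def field_simps)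
    have "((c + \<delta>) / 2 + (d + \<delta>)) * (1 / R * ((u z)\<^sup>2 + (u z')\<^sup>2)) \<le> 3 * (1 / R * ((u z)\<^sup>2 + (u z')\<^sup>2))"
      using that \<delta>1 R0 by (intro mult_right_mono) (auto simp: field_simps)
    then show ?thesis unfolding eq G_def by (simp add: mult.assoc)
  qed
  have "\<gamma> * (\<delta> * real (card K) + \<delta> * real (card K1) + \<delta> * real (card K2))
     \<le> ((a + \<delta>) * ?h \<alpha> + (b + \<delta>) * ?h \<beta>L + (b + \<delta>) * ?h \<beta>R)
       + ((b + \<delta>) * ?v \<alpha> + (a + \<delta>) * ?v \<beta>L + (a + \<delta>) * ?v \<beta>R)"
    using col row1 row2 by (simp add: distrib_left)
  also have "\<dots> = (\<Sum>z\<in>{z\<in>D H. z + (1, 0) \<in> D H}. (a + \<delta>) * F \<alpha> z (z + (1, 0)) + (b + \<delta>) * F \<beta>L z (z + (1, 0)) + (b + \<delta>) * F \<beta>R z (z + (1, 0)))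
     + (\<Sum>z\<in>{z\<in>D H. z + (0, 1) \<in> D H}. (b + \<delta>) * F \<alpha> z (z + (0, 1)) + (a + \<delta>) * F \<beta>L z (z + (0, 1)) + (a + \<delta>) * F \<beta>R z (z + (0, 1)))"
    by (simp only: sum.distrib sum_distrib_left)
  also have "\<dots> \<le> (\<Sum>z\<in>{z\<in>D H. z + (1, 0) \<in> D H}. G a b z (z + (1, 0))) + (\<Sum>z\<in>{z\<in>D H. z + (0, 1) \<in> D H}. G b a z (z + (0, 1)))"
    using a_le_1 b_le_1 by (intro add_mono sum_mono FG)
  also have "\<dots> \<le> (1 + 6 * (3 / R) + 12 * (1 / R) / l) * lattice_energy l (D H) u"
    unfolding G_def
  proof (rule weighted_variation_le_energy[OF finite_D l a0 b0 ab])
    show "\<bar>\<alpha> (z + g) - \<alpha> z\<bar> \<le> 1 / R \<and> \<bar>\<beta> (z + g) - \<beta> z\<bar> \<le> 2 * (1 / R)"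
      if "g = (1, 0) \<or> g = (0, 1)" for z g
      using lip[OF that, of z] unfolding \<beta>_def by linarith
    show "\<alpha> z + \<beta> z \<le> 1" "0 \<le> \<beta> z" for z
      using sum1[of z] nonneg[of z] by (auto simp: \<beta>_def)
  qed (use R nonneg in \<open>auto simp: \<delta> field_simps\<close>)
  also have "\<dots> = (1 + 18 / R + 12 / (R * l)) * lattice_energy l (D H) u" by simp
  finally show ?thesis .
qed

end

definition clip :: "real \<Rightarrow> real" where
  "clip t = max 0 (min 1 t)"

lemma clip_bounds: "0 \<le> clip t" "clip t \<le> 1"
  by (auto simp: clip_def)

lemma clip_eq_1: "1 \<le> t \<Longrightarrow> clip t = 1"
  by (simp add: clip_def)

lemma clip_eq_0: "t \<le> 0 \<Longrightarrow> clip t = 0"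
  by (simp add: clip_def)

lemma clip_lipschitz: "\<bar>clip t - clip t'\<bar> \<le> \<bar>t - t'\<bar>"
  by (auto simp: clip_def max_def min_def abs_if)

lemma clip_divide_lipschitz:
  assumes "0 < K" "\<bar>s - t\<bar> \<le> 1"
  shows "\<bar>clip (s / K) - clip (t / K)\<bar> \<le> 1 / K"
proof -
  have "\<bar>clip (s / K) - clip (t / K)\<bar> \<le> \<bar>s / K - t / K\<bar>" by (rule clip_lipschitz)
  also have "\<dots> = \<bar>s - t\<bar> / K" using assms by (simp add: diff_divide_distrib[symmetric])
  also have "\<dots> \<le> 1 / K" using assms by (intro divide_right_mono) auto
  finally show ?thesis .
qed

lemma abs_min_diff_le:
  fixes p q p' q' r :: real
  shows "\<bar>p - p'\<bar> \<le> r \<Longrightarrow> \<bar>q - q'\<bar> \<le> r \<Longrightarrow> \<bar>min p q - min p' q'\<bar> \<le> r"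
  by (auto simp: min_def abs_if split: if_splits)

context rotated_lattice
begin

text \<open>The energy of a path between the middles of two opposite sides of a square of side \<open>2 H\<close> is at least \<open>4 H\<close>, up
to a relative error that vanishes as \<open>R\<close> tends to infinity and an additive constant that depends on \<open>R\<close> only.
There are two scales: cut-offs have slope \<open>1 / R\<close>, while the weights change over the length \<open>K = R\<^sup>2\<close>. Hence at
distance \<open>R\<close> from the end of a line that is not close to the parallel sides, the weight is still \<open>1\<close> up to
\<open>\<epsilon>\<close>.\<close>
lemma crossing_energy_ge:
  fixes H R l :: real and u :: "int \<times> int \<Rightarrow> real" and p :: "(int \<times> int) list"
  assumes R: "3 \<le> R" and H: "4 * R\<^sup>2 + 4 * R + 13 \<le> 4 * H" and l: "0 < l"
    and p: "p \<noteq> []" "successively adjacent p" "set p \<subseteq> D H"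
    and u: "\<And>z. z \<in> set p \<Longrightarrow> u z = 1"
    and hd: "X (hd p) \<le> - H + 1" "\<bar>Y (hd p)\<bar> \<le> 1" and last: "H - 1 \<le> X (last p)" "\<bar>Y (last p)\<bar> \<le> 1"
  shows "(1 - (R + 1) / (2 * R\<^sup>2)) * (4 * H - (4 * R\<^sup>2 + 4 * R + 13))
      \<le> (1 + 18 / R + 12 / (R * l)) * lattice_energy l (D H) u"
proof -
  define \<delta> where "\<delta> = 1 / R"
  define K where "K = R\<^sup>2"
  define \<epsilon> where "\<epsilon> = (R + 1) / (2 * R\<^sup>2)"
  define w where "w = a + b"
  have w: "0 \<le> w" "w \<le> 2" using a0 b0 a_le_1 b_le_1 by (auto simp: w_def)
  have K3: "3 * R \<le> K" using R by (simp add: K_def power2_eq_square)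
  have RH: "R + 1 \<le> H" using H K3 R by (simp add: K_def[symmetric])
  have \<delta>: "0 < \<delta>" "\<delta> \<le> 1" using R by (auto simp: \<delta>_def)
  have \<epsilon>0: "0 \<le> \<epsilon>" using R by (simp add: \<epsilon>_def)
  have \<epsilon>1: "\<epsilon> \<le> 1" using R K3 unfolding \<epsilon>_def K_def[symmetric] by (simp add: field_simps)
  have Rinv: "1 / K \<le> 1 / R" "0 < K" using K3 R by (auto intro: divide_left_mono)
  have on_col: "columns.on_line s z \<longleftrightarrow> s \<le> X z \<and> X z < s + w" for s z
    by (simp add: columns.on_line_def w_def add.assoc)
  have on_row: "rows.on_line s z \<longleftrightarrow> s \<le> Y z \<and> Y z < s + w" for s z
    by (simp add: rows.on_line_def w_def add.assoc)
  have sX: "successively (\<lambda>z z'. \<bar>X z' - X z\<bar> \<le> w) q" if "successively adjacent q" for q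
    by (rule successively_mono[OF that]) (use step_le in \<open>auto simp: w_def\<close>)
  have sY: "successively (\<lambda>z z'. \<bar>Y z' - Y z\<bar> \<le> w) q" if "successively adjacent q" for q
    by (rule successively_mono[OF that]) (use step_le in \<open>auto simp: w_def\<close>)
  define Kc where "Kc = {k::int. - H + K \<le> \<delta> * of_int k \<and> \<delta> * of_int k \<le> H - K - w}"
  have finK: "finite Kc" unfolding Kc_def by (rule finite_samples[OF \<delta>(1)])
  have cardK: "2 * H - 2 * K - w - \<delta> \<le> \<delta> * real (card Kc)"
    using card_samples_ge[OF \<delta>(1), of "H - K - w" "- H + K"] unfolding Kc_def by linarith
  have col_cross: "\<exists>z\<in>set p. columns.on_line (\<delta> * of_int k) z" if "k \<in> Kc" for k
    unfolding on_col
    using that hd last K3 R w by (intro crossing_point sX p) (auto simp: Kc_def)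
  define bad where "bad k \<longleftrightarrow> k \<in> Kc \<and> (\<forall>z\<in>set p. columns.on_line (\<delta> * of_int k) z \<longrightarrow> H - R - 1 < \<bar>Y z\<bar>)" for k
  have "(1 - \<epsilon>) * (4 * H - (4 * K + 4 * R + 13)) \<le> (1 + 18 / R + 12 / (R * l)) * lattice_energy l (D H) u"
  proof (cases "\<exists>k1 k2. bad k1 \<and> bad k2 \<and> 2 * R < \<delta> * of_int k2 - \<delta> * of_int k1")
    case False
    \<comment> \<open>The columns outside a set of diameter \<open>2 R\<close> are good, and each of them gives \<open>2\<close> with weight \<open>1\<close>.\<close>
    define S where "S = {k. bad k}"
    have finS: "finite S" using finK by (rule finite_subset[rotated]) (auto simp: S_def bad_def)
    have cardS: "\<delta> * real (card S) \<le> 2 * R + \<delta>"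
    proof (cases "S = {}")
      case True
      then show ?thesis using R \<delta> by simp
    next
      case ne: False
      have m: "Min S \<in> S" using finS ne by simp
      have "\<delta> * real (card S) \<le> (\<delta> * of_int (Min S) + 2 * R - \<delta> * of_int (Min S)) + \<delta>"
      proof (rule card_samples_le[OF finS \<delta>(1)])
        show "\<delta> * real_of_int (Min S) \<le> \<delta> * real_of_int k \<and> \<delta> * real_of_int k \<le> \<delta> * real_of_int (Min S) + 2 * R"
          if "k \<in> S" for k
        proof
          show "\<delta> * real_of_int (Min S) \<le> \<delta> * real_of_int k"
            using that finS \<delta> by (intro mult_left_mono) auto
          have "\<not> 2 * R < \<delta> * of_int k - \<delta> * of_int (Min S)"
            using False that m by (auto simp: S_def)
          then show "\<delta> * real_of_int k \<le> \<delta> * real_of_int (Min S) + 2 * R" by linarith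
        qed
      qed (use R in auto)
      then show ?thesis by simp
    qed
    have "card (Kc - S) = card Kc - card S" "card S \<le> card Kc"
      using finK by (auto intro!: card_Diff_subset card_mono finS simp: S_def bad_def)
    then have "real (card (Kc - S)) = real (card Kc) - real (card S)" by simp
    then have cd: "\<delta> * real (card (Kc - S)) = \<delta> * real (card Kc) - \<delta> * real (card S)"
      by (simp add: right_diff_distrib)
    have cal: "2 * (\<delta> * real (card (Kc - S)) + \<delta> * real (card ({} :: int set)) + \<delta> * real (card ({} :: int set)))
       \<le> (1 + 18 / R + 12 / (R * l)) * lattice_energy l (D H) u"
    proof (rule calibration[where \<alpha> = "\<lambda>_. 1" and \<beta>L = "\<lambda>_. 0" and \<beta>R = "\<lambda>_. 0", OF R RH l \<delta>_def])
      fix k assume k: "k \<in> Kc - S"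
      then obtain z where "z \<in> set p" "columns.on_line (\<delta> * of_int k) z" "\<not> H - R - 1 < \<bar>Y z\<bar>"
        by (auto simp: S_def bad_def)
      then show "\<exists>z\<in>D H. columns.on_line (\<delta> * of_int k) z \<and> u z = 1 \<and>
              (if \<bar>Y z\<bar> \<le> H - R - 1 then 2 \<le> 2 * (1::real) else 2 \<le> (1::real))"
        using p u by (intro bexI[of _ z]) auto
    next
      fix k assume "k \<in> Kc - S \<union> {} \<union> {}"
      then show "- H < \<delta> * of_int k \<and> \<delta> * of_int k + a + b \<le> H"
        using K3 R by (auto simp: Kc_def w_def)
    qed (use finK R in auto)
    have "(1 - \<epsilon>) * (4 * H - (4 * K + 4 * R + 13)) \<le> 1 * (4 * H - (4 * K + 4 * R + 13))"
      using \<epsilon>0 H by (intro mult_right_mono) (auto simp: K_def)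
    also have "\<dots> \<le> 2 * (\<delta> * real (card (Kc - S)) + \<delta> * real (card ({} :: int set)) + \<delta> * real (card ({} :: int set)))"
      using cd cardS cardK \<delta> w by simp
    also note cal
    finally show ?thesis .
  next
    case True
    then obtain k1 k2 where k12: "bad k1" "bad k2" and gap: "2 * R < \<delta> * of_int k2 - \<delta> * of_int k1" by blast
    define x1 where "x1 = \<delta> * of_int k1"
    define x2 where "x2 = \<delta> * of_int k2"
    \<comment> \<open>\<open>\<alpha>\<close> and \<open>\<beta>\<close> are both \<open>1/2\<close> at distance \<open>K\<close> from the boundary. Near the horizontal sides, where the columns end, \<open>\<alpha>\<close> grows to \<open>1\<close>; near the vertical sides \<open>\<beta>\<close> does. The rows are cut at the bad columns \<open>x1\<close> and \<open>x2\<close>.\<close>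
    define d1 where "d1 z = clip ((H - \<bar>X z\<bar>) / K)" for z
    define d2 where "d2 z = clip ((H - \<bar>Y z\<bar>) / K)" for z
    define \<alpha> where "\<alpha> z = (1 + d1 z - d2 z) / 2" for z
    define \<beta> where "\<beta> z = (1 + d2 z - d1 z) / 2" for z
    define \<beta>L where "\<beta>L z = min (\<beta> z) (clip ((x1 + R - X z) / R))" for z
    define \<beta>R where "\<beta>R z = min (\<beta> z) (clip ((X z - (x2 - R)) / R))" for z
    have dB: "0 \<le> d1 z" "d1 z \<le> 1" "0 \<le> d2 z" "d2 z \<le> 1" for z
      by (auto simp: d1_def d2_def clip_bounds)
    have \<alpha>\<beta>: "0 \<le> \<alpha> z" "0 \<le> \<beta> z" "\<alpha> z + \<beta> z = 1" for z
      using dB[of z] by (auto simp: \<alpha>_def \<beta>_def field_simps)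
    have \<beta>LR: "0 \<le> \<beta>L z" "0 \<le> \<beta>R z" "\<beta>L z + \<beta>R z \<le> \<beta> z" for z
    proof -
      show "0 \<le> \<beta>L z" "0 \<le> \<beta>R z" using \<alpha>\<beta>[of z] by (auto simp: \<beta>L_def \<beta>R_def clip_bounds)
      show "\<beta>L z + \<beta>R z \<le> \<beta> z"
      proof (cases "X z \<ge> x1 + R")
        case True
        then have "clip ((x1 + R - X z) / R) = 0" using R by (intro clip_eq_0) (simp add: divide_nonpos_pos)
        then show ?thesis using \<alpha>\<beta>[of z] by (simp add: \<beta>L_def \<beta>R_def)
      next
        case False
        then have "clip ((X z - (x2 - R)) / R) = 0" using R gap
          by (intro clip_eq_0) (simp add: divide_nonpos_pos x1_def x2_def)
        then show ?thesis using \<alpha>\<beta>[of z] by (simp add: \<beta>L_def \<beta>R_def)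
      qed
    qed
    have lip: "\<bar>\<alpha> (z + g) - \<alpha> z\<bar> \<le> 1 / R \<and> \<bar>\<beta>L (z + g) - \<beta>L z\<bar> \<le> 1 / R \<and> \<bar>\<beta>R (z + g) - \<beta>R z\<bar> \<le> 1 / R"
      if g: "g = (1, 0) \<or> g = (0, 1)" for z g
    proof -
      have ad: "adjacent z (z + g)" using g by (auto simp: lattice_steps_def)
      have "\<bar>d1 (z + g) - d1 z\<bar> \<le> 1 / K" "\<bar>d2 (z + g) - d2 z\<bar> \<le> 1 / K"
        unfolding d1_def d2_def using step_le[OF ad] Rinv by (auto intro!: clip_divide_lipschitz)
      then have "\<bar>\<alpha> (z + g) - \<alpha> z\<bar> \<le> 1 / K" "\<bar>\<beta> (z + g) - \<beta> z\<bar> \<le> 1 / K"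
        by (auto simp: \<alpha>_def \<beta>_def abs_le_iff field_simps)
      then have *: "\<bar>\<alpha> (z + g) - \<alpha> z\<bar> \<le> 1 / R" "\<bar>\<beta> (z + g) - \<beta> z\<bar> \<le> 1 / R"
        using Rinv(1) by linarith+
      have "\<bar>clip ((x1 + R - X (z + g)) / R) - clip ((x1 + R - X z) / R)\<bar> \<le> 1 / R"
        "\<bar>clip ((X (z + g) - (x2 - R)) / R) - clip ((X z - (x2 - R)) / R)\<bar> \<le> 1 / R"
        using step_le(1)[OF ad] R by (auto intro!: clip_divide_lipschitz)
      with * show ?thesis unfolding \<beta>L_def \<beta>R_def by (auto intro!: abs_min_diff_le)
    qed
    \<comment> \<open>A crossing that counts on one side only lies within \<open>R + 1\<close> of the end of its line; this costs at most \<open>\<epsilon>\<close>.\<close>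
    have near: "d \<le> \<epsilon> * 2" if "d = clip (t / K)" "t < R + 1" for d t
    proof -
      have "d \<le> max 0 (t / K)" unfolding that(1) clip_def by (auto simp: max_def min_def)
      also have "\<dots> \<le> (R + 1) / K" using that(2) R Rinv by (auto intro!: divide_right_mono)
      also have "\<dots> = \<epsilon> * 2" using R by (simp add: \<epsilon>_def K_def field_simps)
      finally show ?thesis .
    qed
    have col_val: "if \<bar>Y z\<bar> \<le> H - R - 1 then 1 - \<epsilon> \<le> 2 * \<alpha> z else 1 - \<epsilon> \<le> \<alpha> z" if "\<bar>X z\<bar> \<le> H - K" for z
    proof -
      have 1: "d1 z = 1" using that Rinv unfolding d1_def by (intro clip_eq_1) auto
      show ?thesis
      proof (cases "\<bar>Y z\<bar> \<le> H - R - 1")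
        case True
        then show ?thesis using 1 dB[of z] \<epsilon>0 by (simp add: \<alpha>_def)
      next
        case False
        then have "d2 z \<le> \<epsilon> * 2" by (intro near[OF d2_def]) auto
        then show ?thesis using 1 False by (simp add: \<alpha>_def field_simps)
      qed
    qed
    have row_val: "if \<bar>X z\<bar> \<le> H - R - 1 then 1 - \<epsilon> \<le> 2 * \<beta> z else 1 - \<epsilon> \<le> \<beta> z" if "\<bar>Y z\<bar> \<le> H - K" for z
    proof -
      have 1: "d2 z = 1" using that Rinv unfolding d2_def by (intro clip_eq_1) auto
      show ?thesis
      proof (cases "\<bar>X z\<bar> \<le> H - R - 1")
        case True
        then show ?thesis using 1 dB[of z] \<epsilon>0 by (simp add: \<beta>_def)
      next
        case False
        then have "d1 z \<le> \<epsilon> * 2" by (intro near[OF d1_def]) auto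
        then show ?thesis using 1 False by (simp add: \<beta>_def field_simps)
      qed
    qed
    have kc: "k1 \<in> Kc" "k2 \<in> Kc" using k12 by (auto simp: bad_def)
    have x12: "- H + K \<le> x1" "x1 \<le> H - K - w" "- H + K \<le> x2" "x2 \<le> H - K - w"
      using kc by (auto simp: Kc_def x1_def x2_def)
    \<comment> \<open>A piece of the path that joins the middle of the square to one of its horizontal sides
      crosses all the rows of half the square.\<close>
    have half: "\<exists>K'. finite K' \<and> H - K - w - 2 - \<delta> \<le> \<delta> * real (card K') \<and>
        (\<forall>k\<in>K'. - H + K \<le> \<delta> * of_int k \<and> \<delta> * of_int k \<le> H - K - w \<and>
          (\<exists>z\<in>set q. rows.on_line (\<delta> * of_int k) z))"
      if q: "q \<noteq> []" "successively adjacent q"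
        and ends: "\<bar>Y (hd q)\<bar> \<le> 1 \<and> H - R - 1 < \<bar>Y (last q)\<bar> \<or> \<bar>Y (last q)\<bar> \<le> 1 \<and> H - R - 1 < \<bar>Y (hd q)\<bar>" for q
    proof (cases "0 \<le> Y (hd q) + Y (last q)")
      case True
      let ?K = "{k::int. 2 \<le> \<delta> * of_int k \<and> \<delta> * of_int k \<le> H - K - w}"
      have "\<exists>z\<in>set q. rows.on_line (\<delta> * of_int k) z" if "k \<in> ?K" for k
        unfolding on_row using that ends True K3 R w RH
        by (intro crossing_point sY q) (auto simp: abs_if split: if_splits)
      moreover have "H - K - w - 2 - \<delta> \<le> \<delta> * real (card ?K)"
        using card_samples_ge[OF \<delta>(1), of "H - K - w" 2] by simp
      moreover have "finite ?K" by (rule finite_samples[OF \<delta>(1)])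
      moreover have "- H + K \<le> \<delta> * of_int k" if "k \<in> ?K" for k
        using that w by auto
      ultimately show ?thesis by (intro exI[of _ ?K]) auto
    next
      case False
      let ?K = "{k::int. - H + K \<le> \<delta> * of_int k \<and> \<delta> * of_int k \<le> - 2 - w}"
      have "\<exists>z\<in>set q. rows.on_line (\<delta> * of_int k) z" if "k \<in> ?K" for k
        unfolding on_row using that ends False K3 R w RH
        by (intro crossing_point sY q) (auto simp: abs_if split: if_splits)
      moreover have "H - K - w - 2 - \<delta> \<le> \<delta> * real (card ?K)"
        using card_samples_ge[OF \<delta>(1), of "- 2 - w" "- H + K"] by simp
      moreover have "finite ?K" by (rule finite_samples[OF \<delta>(1)])
      moreover have "\<delta> * of_int k \<le> H - K - w" if "k \<in> ?K" for k
        using that H w by (auto simp: K_def)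
      ultimately show ?thesis by (intro exI[of _ ?K]) auto
    qed
    have row_Y: "\<bar>Y z\<bar> \<le> H - K" if "- H + K \<le> \<delta> * of_int k" "\<delta> * of_int k \<le> H - K - w" "rows.on_line (\<delta> * of_int k) z" for k z
      using that by (auto simp: on_row)
    have e1: "X (hd p) < x1" "x1 \<le> X (last p)" using hd last x12 K3 R w by linarith+
    obtain p1 z1 p1' where z1: "p = p1 @ z1 # p1'" "p1 \<noteq> []" "\<And>x. x \<in> set p1 \<Longrightarrow> X x < x1" "x1 \<le> X z1" "X z1 < x1 + w"
      by (rule first_crossing[OF sX[OF p(2)] p(1) e1]) (rule that)
    have bad1: "H - R - 1 < \<bar>Y z1\<bar>" using k12(1) z1 by (auto simp: bad_def on_col x1_def)
    \<comment> \<open>At the bad column \<open>x1\<close> the path is close to a horizontal side, so its part left of \<open>x1\<close> crosses half of the rows.\<close>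
    obtain K1 where K1: "finite K1" "H - K - w - 2 - \<delta> \<le> \<delta> * real (card K1)"
       "\<forall>k\<in>K1. - H + K \<le> \<delta> * of_int k \<and> \<delta> * of_int k \<le> H - K - w \<and>
          (\<exists>z\<in>set (p1 @ [z1]). rows.on_line (\<delta> * of_int k) z)"
      using half[of "p1 @ [z1]"] p(2) hd bad1 z1 by (auto simp: successively_append_iff)
    have e2: "X (hd p) < x2 + w" "x2 + w \<le> X (last p)" using hd last x12 K3 R w by linarith+
    obtain p2' z2 p2 where z2: "p = p2' @ z2 # p2" "p2 \<noteq> []" "\<And>x. x \<in> set p2 \<Longrightarrow> x2 + w \<le> X x" "x2 \<le> X z2" "X z2 < x2 + w"
      by (rule last_crossing[OF sX[OF p(2)] p(1) e2]) (rule that)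
    have bad2: "H - R - 1 < \<bar>Y z2\<bar>" using k12(2) z2 by (auto simp: bad_def on_col x2_def)
    obtain K2 where K2: "finite K2" "H - K - w - 2 - \<delta> \<le> \<delta> * real (card K2)"
       "\<forall>k\<in>K2. - H + K \<le> \<delta> * of_int k \<and> \<delta> * of_int k \<le> H - K - w \<and>
          (\<exists>z\<in>set (z2 # p2). rows.on_line (\<delta> * of_int k) z)"
      using half[of "z2 # p2"] p(2) last bad2 z2 by (auto simp: successively_append_iff)
    have cal: "(1 - \<epsilon>) * (\<delta> * real (card Kc) + \<delta> * real (card K1) + \<delta> * real (card K2))
       \<le> (1 + 18 / R + 12 / (R * l)) * lattice_energy l (D H) u"
    proof (rule calibration[where \<alpha> = \<alpha> and \<beta>L = \<beta>L and \<beta>R = \<beta>R, OF R RH l \<delta>_def finK K1(1) K2(1) \<alpha>\<beta>(1) \<beta>LR(1) \<beta>LR(2) _ lip])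
      show "\<alpha> z + \<beta>L z + \<beta>R z \<le> 1" for z using \<alpha>\<beta>[of z] \<beta>LR[of z] by linarith
      show "- H < \<delta> * of_int k \<and> \<delta> * of_int k + a + b \<le> H" if "k \<in> Kc \<union> K1 \<union> K2" for k
      proof -
        have "- H + K \<le> \<delta> * of_int k \<and> \<delta> * of_int k \<le> H - K - w"
          using that K1(3) K2(3) by (auto simp: Kc_def)
        then show ?thesis using K3 R by (simp add: w_def)
      qed
    next
      fix k assume k: "k \<in> Kc"
      then obtain z where z: "z \<in> set p" "columns.on_line (\<delta> * of_int k) z" using col_cross by blast
      then have "\<bar>X z\<bar> \<le> H - K" using k by (auto simp: on_col Kc_def)
      then show "\<exists>z\<in>D H. columns.on_line (\<delta> * of_int k) z \<and> u z = 1 \<and>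
              (if \<bar>Y z\<bar> \<le> H - R - 1 then 1 - \<epsilon> \<le> 2 * \<alpha> z else 1 - \<epsilon> \<le> \<alpha> z)"
        using z p(3) u col_val by blast
    next
      fix k assume k: "k \<in> K1"
      then obtain z where z: "z \<in> set (p1 @ [z1])" "rows.on_line (\<delta> * of_int k) z" using K1(3) by blast
      have Yz: "\<bar>Y z\<bar> \<le> H - K" using row_Y z(2) k K1(3) by blast
      then have "z \<noteq> z1" using bad1 K3 R by auto
      then have zp: "z \<in> set p1" using z(1) by auto
      then have "clip ((x1 + R - X z) / R) = 1" using z1(3)[OF zp] R by (intro clip_eq_1) simp
      then have "\<beta>L z = \<beta> z" using \<alpha>\<beta>[of z] by (simp add: \<beta>L_def)
      then show "\<exists>z\<in>D H. rows.on_line (\<delta> * of_int k) z \<and> u z = 1 \<and>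
              (if \<bar>X z\<bar> \<le> H - R - 1 then 1 - \<epsilon> \<le> 2 * \<beta>L z else 1 - \<epsilon> \<le> \<beta>L z)"
        using row_val[OF Yz] z(2) zp u p(3) z1(1) by (intro bexI[of _ z]) auto
    next
      fix k assume k: "k \<in> K2"
      then obtain z where z: "z \<in> set (z2 # p2)" "rows.on_line (\<delta> * of_int k) z" using K2(3) by blast
      have Yz: "\<bar>Y z\<bar> \<le> H - K" using row_Y z(2) k K2(3) by blast
      then have "z \<noteq> z2" using bad2 K3 R by auto
      then have zp: "z \<in> set p2" using z(1) by auto
      then have "clip ((X z - (x2 - R)) / R) = 1" using z2(3)[OF zp] R w by (intro clip_eq_1) simp
      then have "\<beta>R z = \<beta> z" using \<alpha>\<beta>[of z] by (simp add: \<beta>R_def)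
      then show "\<exists>z\<in>D H. rows.on_line (\<delta> * of_int k) z \<and> u z = 1 \<and>
              (if \<bar>X z\<bar> \<le> H - R - 1 then 1 - \<epsilon> \<le> 2 * \<beta>R z else 1 - \<epsilon> \<le> \<beta>R z)"
        using row_val[OF Yz] z(2) zp u p(3) z2(1) by (intro bexI[of _ z]) auto
    qed
    have "(1 - \<epsilon>) * (4 * H - (4 * K + 4 * R + 13))
       \<le> (1 - \<epsilon>) * (\<delta> * real (card Kc) + \<delta> * real (card K1) + \<delta> * real (card K2))"
      using \<epsilon>1 cardK K1(2) K2(2) w \<delta> R by (intro mult_left_mono) auto
    also note cal
    finally show ?thesis .
  qed
  then show ?thesis unfolding \<epsilon>_def K_def .
qed

end

section \<open>Channels in lattice coordinates\<close>

context rotated_lattice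
begin

text \<open>Channels in coordinates, oriented from left to right: the last two lines say that the ends of the path lie in
\<open>S\<^sup>\<nu>\<close> and next to a lattice point beyond the left and the right side of the square, respectively.\<close>
definition lattice_channel :: "real \<Rightarrow> (int \<times> int) list \<Rightarrow> bool" where
  "lattice_channel H p \<longleftrightarrow> p \<noteq> [] \<and> successively adjacent p \<and> set p \<subseteq> D H \<and>
     (\<forall>z\<in>set p. z \<noteq> hd p \<and> z \<noteq> last p \<longrightarrow>
        (z + (1, 0) \<in> set p \<or> z - (1, 0) \<in> set p) \<and> (z + (0, 1) \<in> set p \<or> z - (0, 1) \<in> set p)) \<and>
     (\<exists>z\<in>D H. adjacent (hd p) z \<and> sgn (Y (hd p)) \<noteq> sgn (Y z)) \<and> (\<exists>z. adjacent (hd p) z \<and> X z \<le> - H) \<and>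
     (\<exists>z\<in>D H. adjacent (last p) z \<and> sgn (Y (last p)) \<noteq> sgn (Y z)) \<and> (\<exists>z. adjacent (last p) z \<and> H \<le> X z)"

lemma sgn_change_le:
  assumes "adjacent z z'" "sgn (Y z) \<noteq> sgn (Y z')"
  shows "\<bar>Y z\<bar> \<le> 1"
  using step_le(2)[OF assms(1)] assms(2) by (auto simp: sgn_real_def abs_le_iff split: if_splits)

lemma lattice_channel_ends:
  assumes "lattice_channel H p"
  shows "X (hd p) \<le> - H + 1" "\<bar>Y (hd p)\<bar> \<le> 1" "H - 1 \<le> X (last p)" "\<bar>Y (last p)\<bar> \<le> 1"
proof -
  obtain z where "adjacent (hd p) z" "X z \<le> - H" using assms by (auto simp: lattice_channel_def)
  then show "X (hd p) \<le> - H + 1" using step_le(1)[of z "hd p"] by linarith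
  obtain z where "adjacent (last p) z" "H \<le> X z" using assms by (auto simp: lattice_channel_def)
  then show "H - 1 \<le> X (last p)" using step_le(1)[of z "last p"] by linarith
  show "\<bar>Y (hd p)\<bar> \<le> 1" "\<bar>Y (last p)\<bar> \<le> 1"
    using assms sgn_change_le unfolding lattice_channel_def by blast+
qed

text \<open>Every lattice column strictly between the ends of a channel contains one of its points, and
  with it the vertical neighbour that strong paths provide.\<close>

lemma lattice_channel_card_ge:
  assumes p: "lattice_channel H p"
  shows "4 * b * H - 10 \<le> real (card (set p))"
proof -
  let ?m = "\<lambda>z::int \<times> int. real_of_int (fst z)"
  have ends: "?m (hd p) \<le> - (b * H) + 2" "b * H - 2 \<le> ?m (last p)"
  proof -
    have "b * X (hd p) \<le> b * (- H + 1)" "b * (H - 1) \<le> b * X (last p)"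
      using lattice_channel_ends[OF p] b0 by (simp_all only: mult_left_mono)
    then have "b * X (hd p) \<le> - (b * H) + b" "b * H - b \<le> b * X (last p)"
      by (simp_all add: algebra_simps)
    moreover have "\<bar>a * Y z\<bar> \<le> 1" if "\<bar>Y z\<bar> \<le> 1" for z
      using that a0 a_le_1 by (simp add: abs_mult mult_le_one)
    then have "\<bar>a * Y (hd p)\<bar> \<le> 1" "\<bar>a * Y (last p)\<bar> \<le> 1"
      using lattice_channel_ends[OF p] by blast+
    ultimately show "?m (hd p) \<le> - (b * H) + 2" "b * H - 2 \<le> ?m (last p)"
      unfolding fst_eq using b_le_1 by linarith+
  qed
  define M where "M = {fst (hd p)<..<fst (last p)}"
  let ?C = "\<lambda>m. {z\<in>set p. fst z = m}"
  have two: "2 \<le> card (?C m)" if m: "m \<in> M" for m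
  proof -
    have "successively (\<lambda>z z'. \<bar>?m z' - ?m z\<bar> \<le> 1) p"
    proof (rule successively_mono)
      show "successively adjacent p" using p by (simp add: lattice_channel_def)
      show "\<bar>?m z' - ?m z\<bar> \<le> 1" if "adjacent z z'" for z z'
        using that by (cases z; cases z') (auto simp: lattice_steps_def)
    qed
    then have "\<exists>z\<in>set p. real_of_int m \<le> ?m z \<and> ?m z < real_of_int m + 1"
      using m p by (intro crossing_point) (auto simp: M_def lattice_channel_def)
    then obtain z where z: "z \<in> set p" and zm: "real_of_int m \<le> ?m z" "?m z < real_of_int m + 1" by blast
    from zm have "fst z = m" by linarith
    note z = z this
    then have "z \<noteq> hd p" "z \<noteq> last p" using m by (auto simp: M_def)
    then have "z + (0, 1) \<in> set p \<or> z - (0, 1) \<in> set p" using p z(1) unfolding lattice_channel_def by blast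
    moreover have "fst (z + (0, 1)) = m" "fst (z - (0, 1)) = m" "z + (0, 1) \<noteq> z" "z - (0, 1) \<noteq> z"
      using z(2) by (cases z; simp)+
    ultimately obtain z' where z': "z' \<in> set p" "fst z' = m" "z' \<noteq> z" by blast
    have "card {z, z'} \<le> card (?C m)" using z z' by (intro card_mono) auto
    then show ?thesis using z'(3) by simp
  qed
  have "2 * card M = (\<Sum>m\<in>M. 2)" by simp
  also have "\<dots> \<le> (\<Sum>m\<in>M. card (?C m))" by (intro sum_mono two)
  also have "\<dots> = card (\<Union>m\<in>M. ?C m)"
    by (subst card_UN_disjoint) (auto simp: M_def)
  also have "\<dots> \<le> card (set p)" by (intro card_mono) auto
  finally have "2 * card M \<le> card (set p)" .
  moreover have "real (card M) \<ge> 2 * b * H - 5"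
  proof -
    have "real (card M) \<ge> real_of_int (fst (last p) - fst (hd p) - 1)" by (simp add: M_def)
    then show ?thesis using ends by simp
  qed
  ultimately show ?thesis by linarith
qed

end

text \<open>For \<open>a \<le> b\<close> the line \<open>Y = 0\<close> is flat enough that a strong path along it needs only the two
  lattice points of each column that lie next to the line.\<close>

locale flat_lattice = rotated_lattice +
  assumes a_le_b: "a \<le> b"
begin

lemma b_pos: "0 < b"
  using one_le_sum a_le_b by linarith

text \<open>In column \<open>m\<close> the points \<open>lo m\<close> and \<open>hi m\<close> are the last one with \<open>Y \<le> 0\<close> and the first one with \<open>Y > 0\<close>. In
particular \<open>sgn \<circ> Y\<close> differs between them, which puts them into \<open>S\<^sup>\<nu>\<close>.\<close>
definition bottom :: "int \<Rightarrow> int" where "bottom m = \<lfloor>- (a * of_int m) / b\<rfloor>"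
definition lo :: "int \<Rightarrow> int \<times> int" where "lo m = (m, bottom m)"
definition hi :: "int \<Rightarrow> int \<times> int" where "hi m = (m, bottom m + 1)"

lemma Y_lo: "- b < Y (lo m) \<and> Y (lo m) \<le> 0" and Y_hi: "0 < Y (hi m) \<and> Y (hi m) \<le> b"
proof -
  have "real_of_int (bottom m) \<le> - (a * of_int m) / b" "- (a * of_int m) / b < real_of_int (bottom m) + 1"
    unfolding bottom_def by linarith+
  then have "b * of_int (bottom m) \<le> - (a * of_int m)" "- (a * of_int m) < b * (of_int (bottom m) + 1)"
    using b_pos by (simp_all add: field_simps)
  then show "- b < Y (lo m) \<and> Y (lo m) \<le> 0" "0 < Y (hi m) \<and> Y (hi m) \<le> b"
    by (auto simp: Y_def lo_def hi_def algebra_simps)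
qed

lemma X_hi: "X (hi m) = X (lo m) - a"
  by (simp add: X_def lo_def hi_def algebra_simps)

lemma bottom_step: "bottom (m + 1) = bottom m \<or> bottom (m + 1) = bottom m - 1"
proof -
  have eq: "- (a * of_int (m + 1)) / b = - (a * of_int m) / b - a / b"
    using b_pos by (simp add: field_simps)
  have "0 \<le> a / b" "a / b \<le> 1" using a0 a_le_b b_pos by auto
  then have "\<lfloor>- (a * of_int (m + 1)) / b\<rfloor> \<le> \<lfloor>- (a * of_int m) / b\<rfloor>"
    "\<lfloor>- (a * of_int m) / b\<rfloor> \<le> \<lfloor>- (a * of_int (m + 1)) / b\<rfloor> + 1"
    unfolding eq by linarith+
  then show ?thesis unfolding bottom_def by linarith
qed

text \<open>Since the line has slope between \<open>-1\<close> and \<open>0\<close>, the pair of points moves horizontally to the next column, or down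
by one. In both cases \<open>hi (m + 1)\<close> has a left neighbour and \<open>lo m\<close> a right neighbour in the adjacent pair, as
strong paths require.\<close>
lemma step_cases:
  obtains (flat) "bottom (m + 1) = bottom m" "hi (m + 1) = hi m + (1, 0)" "lo (m + 1) = lo m + (1, 0)"
  | (down) "bottom (m + 1) = bottom m - 1" "hi (m + 1) = lo m + (1, 0)"
  using bottom_step[of m] by (auto simp: hi_def lo_def)

lemma X_lo_step: "X (lo m) + b \<le> X (lo (m + 1)) \<and> X (lo (m + 1)) \<le> X (lo m) + b + a"
proof -
  have "X (lo (m + 1)) = X (lo m) + b + a * of_int (bottom m - bottom (m + 1))"
    by (simp add: X_def lo_def algebra_simps)
  then show ?thesis using bottom_step[of m] a0 by auto
qed

lemma X_lo_mono: "m \<le> m' \<Longrightarrow> X (lo m) \<le> X (lo m')"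
proof (induction m' rule: int_ge_induct)
  case (step m')
  then show ?case using X_lo_step[of m'] b0 by linarith
qed simp

lemma X_lo_bounds: "of_int m / b \<le> X (lo m) \<and> X (lo m) \<le> of_int m / b + 1"
proof -
  have 1: "real_of_int m = b * X (lo m) + a * Y (lo m)" using fst_eq[of "lo m"] by (simp add: lo_def)
  have "a * - b \<le> a * Y (lo m)" "a * Y (lo m) \<le> a * 0"
    using Y_lo[of m] a0 by (simp_all only: mult_left_mono less_imp_le)
  then have "real_of_int m \<le> b * X (lo m)" "b * X (lo m) \<le> real_of_int m + a * b" using 1 by auto
  moreover have "a * b \<le> 1 * b" using a_le_1 b0 by (intro mult_right_mono)
  ultimately have "real_of_int m \<le> b * X (lo m)" "b * X (lo m) \<le> real_of_int m + b" by linarith+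
  then show ?thesis using b_pos by (simp add: field_simps)
qed

text \<open>In each column the path goes down from \<open>hi\<close> to \<open>lo\<close>. Where the line is flat, \<open>lo m\<close> and \<open>hi (m + 1)\<close> are not
adjacent, and the path returns to \<open>hi m\<close> before it proceeds.\<close>
fun chain :: "int \<Rightarrow> nat \<Rightarrow> (int \<times> int) list" where
  "chain m 0 = [hi m, lo m]"
| "chain m (Suc k) = chain m k @
     (if bottom (m + int k + 1) = bottom (m + int k) then [hi (m + int k)] else []) @
     [hi (m + int k + 1), lo (m + int k + 1)]"

lemma chain_ne [simp]: "chain m k \<noteq> []"
  by (induction k) auto

lemma hd_chain [simp]: "hd (chain m k) = hi m"
  by (induction k) auto

lemma last_chain [simp]: "last (chain m k) = lo (m + int k)"
  by (induction k) (auto simp: algebra_simps)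

lemma set_chain: "set (chain m k) = hi ` {m..m + int k} \<union> lo ` {m..m + int k}"
proof (induction k)
  case (Suc k)
  have "{m..m + int (Suc k)} = insert (m + int k + 1) {m..m + int k}" by auto
  then show ?case using Suc by auto
qed auto

lemma adjacent_hi_lo: "adjacent (hi m) (lo m)" "adjacent (lo m) (hi m)"
  by (auto simp: lattice_steps_def hi_def lo_def)

lemma adjacent_chain: "successively adjacent (chain m k)"
proof (induction k)
  case 0
  then show ?case by (simp add: adjacent_hi_lo)
next
  case (Suc k)
  show ?case
  proof (cases rule: step_cases[of "m + int k"])
    case flat
    then have "adjacent (hi (m + int k)) (hi (m + int k + 1))" by (simp add: lattice_steps_def)
    then show ?thesis using Suc flat(1) adjacent_hi_lo by (simp add: successively_append_iff)
  next
    case down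
    then have "adjacent (lo (m + int k)) (hi (m + int k + 1))" by (simp add: lattice_steps_def)
    then show ?thesis using Suc down(1) adjacent_hi_lo by (simp add: successively_append_iff)
  qed
qed

lemma int_threshold:
  fixes P :: "int \<Rightarrow> bool"
  assumes "\<not> P i" "P j" "i < j"
  obtains m where "P m" "\<not> P (m - 1)" "i < m" "m \<le> j"
proof -
  define S where "S = {m. i < m \<and> m \<le> j \<and> P m}"
  have "finite S" by (rule finite_subset[of _ "{i..j}"]) (auto simp: S_def)
  moreover have "j \<in> S" using assms by (auto simp: S_def)
  ultimately have m: "Min S \<in> S" "\<And>k. k \<in> S \<Longrightarrow> Min S \<le> k" using Min_in Min_le by blast+
  have "\<not> P (Min S - 1)"
  proof
    assume "P (Min S - 1)"
    then have "Min S - 1 \<in> S" using m(1) assms(1) by (cases "Min S - 1 = i") (auto simp: S_def)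
    then show False using m(2) by fastforce
  qed
  then show ?thesis using that m(1) by (auto simp: S_def)
qed

text \<open>The path starts in the first column \<open>m\<close> with \<open>hi m\<close> inside the square and stops in the last column \<open>M\<close> with
\<open>lo M\<close> inside. At a down step the neighbour \<open>lo (m - 1)\<close> of \<open>hi m\<close> may still be inside; then it is put in front,
and it lies next to \<open>hi (m - 1)\<close>, which is outside. The right end is treated in the same way.\<close>
lemma exists_channel:
  assumes H: "2 < H"
  shows "\<exists>p. lattice_channel H p \<and> (\<forall>z\<in>set p. \<bar>Y z\<bar> \<le> 1) \<and> real (card (set p)) \<le> 4 * b * H + 6"
proof -
  have Yb: "\<bar>Y (lo m)\<bar> \<le> 1" "\<bar>Y (hi m)\<bar> \<le> 1" for m
    using Y_lo[of m] Y_hi[of m] b_le_1 by auto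
  have inD: "lo m \<in> D H \<longleftrightarrow> \<bar>X (lo m)\<bar> < H" "hi m \<in> D H \<longleftrightarrow> \<bar>X (hi m)\<bar> < H" for m
    using Yb[of m] H by (auto simp: D_def)
  have sg: "sgn (Y (lo m)) \<noteq> sgn (Y (hi m'))" for m m'
    using Y_lo[of m] Y_hi[of m'] by (auto simp: sgn_real_def)
  have big: "X (hi m) \<le> - H" "X (lo m) \<le> - H" if "real_of_int m \<le> - H - 1" for m
  proof -
    have "real_of_int m / b \<le> of_int m"
      using that H b_pos b_le_1 by (simp add: divide_le_eq mult_le_cancel_left1)
    then show "X (hi m) \<le> - H" "X (lo m) \<le> - H"
      using X_lo_bounds[of m] that a0 by (auto simp: X_hi)
  qed
  have big': "H \<le> X (hi m)" "H \<le> X (lo m)" if "H + 1 \<le> real_of_int m" for m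
  proof -
    have "real_of_int m \<le> of_int m / b"
      using that H b_pos b_le_1 by (simp add: le_divide_eq mult_le_cancel_left1)
    then show "H \<le> X (hi m)" "H \<le> X (lo m)"
      using X_lo_bounds[of m] that a_le_1 by (auto simp: X_hi)
  qed
  have cH: "- \<lceil>H\<rceil> - 1 < \<lceil>H\<rceil> + 1" using H by linarith
  obtain m where m: "- H < X (hi m)" "\<not> - H < X (hi (m - 1))"
  proof (rule int_threshold[of "\<lambda>m. - H < X (hi m)" "- \<lceil>H\<rceil> - 1" "\<lceil>H\<rceil> + 1"])
    have "real_of_int (- \<lceil>H\<rceil> - 1) \<le> - H - 1" by simp
    from big(1)[OF this] show "\<not> - H < X (hi (- \<lceil>H\<rceil> - 1))" by simp
    have "H + 1 \<le> real_of_int (\<lceil>H\<rceil> + 1)" by simp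
    from big'(1)[OF this] show "- H < X (hi (\<lceil>H\<rceil> + 1))" using H by simp
  qed (rule cH, rule that)
  obtain n where n: "H \<le> X (lo n)" "\<not> H \<le> X (lo (n - 1))"
  proof (rule int_threshold[of "\<lambda>m. H \<le> X (lo m)" "- \<lceil>H\<rceil> - 1" "\<lceil>H\<rceil> + 1"])
    have "real_of_int (- \<lceil>H\<rceil> - 1) \<le> - H - 1" by simp
    from big(2)[OF this] show "\<not> H \<le> X (lo (- \<lceil>H\<rceil> - 1))" using H by simp
    have "H + 1 \<le> real_of_int (\<lceil>H\<rceil> + 1)" by simp
    from big'(2)[OF this] show "H \<le> X (lo (\<lceil>H\<rceil> + 1))" by simp
  qed (rule cH, rule that)
  define M where "M = n - 1"
  have M: "X (lo M) < H" "H \<le> X (lo (M + 1))" using n by (auto simp: M_def)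
  have m1: "X (hi (m - 1)) \<le> - H" using m by simp
  have "m \<le> M"
  proof (rule ccontr)
    assume "\<not> m \<le> M"
    then have "H \<le> X (lo m)" using M(2) X_lo_mono[of "M + 1" m] by linarith
    moreover have "X (lo m) \<le> X (lo (m - 1)) + b + a" using X_lo_step[of "m - 1"] by simp
    ultimately show False using m1 a_le_1 b_le_1 H unfolding X_hi by linarith
  qed
  then obtain k where k: "M = m + int k" using zle_iff_zadd by blast
  have in1: "lo i \<in> D H" "hi i \<in> D H" if "m \<le> i" "i \<le> M" for i
    using X_lo_mono[OF that(1)] X_lo_mono[OF that(2)] m(1) M(1) a0
    unfolding inD by (auto simp: X_hi abs_less_iff)
  define pre where "pre = (if bottom m = bottom (m - 1) - 1 \<and> - H < X (lo (m - 1)) then [lo (m - 1)] else [])"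
  define suf where "suf = (if bottom (M + 1) = bottom M - 1 \<and> X (hi (M + 1)) < H then [hi (M + 1)] else [])"
  define p where "p = pre @ chain m k @ suf"
  have step_m: "(bottom m = bottom (m - 1) \<and> hi m = hi (m - 1) + (1, 0) \<and> lo m = lo (m - 1) + (1, 0)) \<or>
      (bottom m = bottom (m - 1) - 1 \<and> hi m = lo (m - 1) + (1, 0))"
    by (cases rule: step_cases[of "m - 1"]) auto
  have step_M: "(bottom (M + 1) = bottom M \<and> hi (M + 1) = hi M + (1, 0) \<and> lo (M + 1) = lo M + (1, 0)) \<or>
      (bottom (M + 1) = bottom M - 1 \<and> hi (M + 1) = lo M + (1, 0))"
    by (cases rule: step_cases[of M]) auto
  have setp: "set p = set pre \<union> (hi ` {m..M} \<union> lo ` {m..M}) \<union> set suf"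
    by (simp add: p_def set_chain k Un_assoc)
  have pne: "p \<noteq> []" by (simp add: p_def)
  have hdp: "hd p = (if pre = [] then hi m else lo (m - 1))"
    by (auto simp: p_def pre_def)
  have lastp: "last p = (if suf = [] then lo M else hi (M + 1))"
    by (auto simp: p_def suf_def k)
  have pre_in: "lo (m - 1) \<in> D H" if "pre \<noteq> []"
    using that M(1) X_lo_mono[of "m - 1" M] \<open>m \<le> M\<close> by (auto simp: pre_def inD split: if_splits)
  have suf_in: "hi (M + 1) \<in> D H" if "suf \<noteq> []"
    using that m(1) X_lo_mono[of m "M + 1"] \<open>m \<le> M\<close> by (auto simp: suf_def inD X_hi split: if_splits)
  have chan: "lattice_channel H p"
    unfolding lattice_channel_def
  proof (intro conjI ballI impI)
    show "p \<noteq> []" by (rule pne)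
    have "adjacent (last pre) (hi m)" if "pre \<noteq> []"
      using that step_m by (auto simp: pre_def lattice_steps_def split: if_splits)
    moreover have "adjacent (lo M) (hd suf)" if "suf \<noteq> []"
      using that step_M by (auto simp: suf_def lattice_steps_def split: if_splits)
    moreover have "successively adjacent pre" "successively adjacent suf" by (auto simp: pre_def suf_def)
    ultimately show "successively adjacent p"
      by (simp add: p_def successively_append_iff adjacent_chain k) blast
    show "set p \<subseteq> D H"
      unfolding setp using in1 pre_in suf_in by (auto simp: pre_def suf_def split: if_splits)
    have "\<exists>z\<in>D H. adjacent (hd p) z \<and> sgn (Y (hd p)) \<noteq> sgn (Y z)"
    proof (cases "pre = []")
      case True
      then show ?thesis using in1(1)[of m] \<open>m \<le> M\<close> adjacent_hi_lo(1)[of m] sg[of m m] unfolding hdp by auto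
    next
      case False
      then have "adjacent (lo (m - 1)) (hi m)" using step_m by (auto simp: pre_def lattice_steps_def split: if_splits)
      then show ?thesis using False in1(2)[of m] \<open>m \<le> M\<close> sg[of "m - 1" m] unfolding hdp by auto
    qed
    then show "\<exists>z\<in>D H. adjacent (hd p) z \<and> sgn (Y (hd p)) \<noteq> sgn (Y z)" .
    show "\<exists>z. adjacent (hd p) z \<and> X z \<le> - H"
    proof (cases "pre = []")
      case True
      have "X (hi m - (1, 0)) \<le> - H" using step_m m1 True by (auto simp: pre_def split: if_splits)
      moreover have "adjacent (hi m) (hi m - (1, 0))" by (simp add: lattice_steps_def)
      ultimately have "\<exists>z. adjacent (hi m) z \<and> X z \<le> - H" by blast
      then show ?thesis by (simp only: hdp True refl if_True)
    next
      case False
      have "\<exists>z. adjacent (lo (m - 1)) z \<and> X z \<le> - H" using m1 adjacent_hi_lo(2)[of "m - 1"] by blast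
      then show ?thesis by (simp only: hdp False if_False)
    qed
    show "\<exists>z\<in>D H. adjacent (last p) z \<and> sgn (Y (last p)) \<noteq> sgn (Y z)"
    proof (cases "suf = []")
      case True
      then show ?thesis using in1(2)[of M] \<open>m \<le> M\<close> adjacent_hi_lo(2)[of M] sg[of M M] unfolding lastp by auto
    next
      case False
      then have "adjacent (hi (M + 1)) (lo M)" using step_M by (auto simp: suf_def lattice_steps_def split: if_splits)
      then show ?thesis using False in1(1)[of M] \<open>m \<le> M\<close> sg[of M "M + 1"] unfolding lastp by auto
    qed
    show "\<exists>z. adjacent (last p) z \<and> H \<le> X z"
    proof (cases "suf = []")
      case True
      have "H \<le> X (lo M + (1, 0))" using step_M M(2) True by (auto simp: suf_def split: if_splits)
      moreover have "adjacent (lo M) (lo M + (1, 0))" by (simp add: lattice_steps_def)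
      ultimately have "\<exists>z. adjacent (lo M) z \<and> H \<le> X z" by blast
      then show ?thesis by (simp only: lastp True refl if_True)
    next
      case False
      have "\<exists>z. adjacent (hi (M + 1)) z \<and> H \<le> X z" using M(2) adjacent_hi_lo(1)[of "M + 1"] by blast
      then show ?thesis by (simp only: lastp False if_False)
    qed
  next
    fix z assume z: "z \<in> set p" "z \<noteq> hd p \<and> z \<noteq> last p"
    then obtain i where i: "m \<le> i" "i \<le> M" "z = hi i \<or> z = lo i"
      using hdp lastp unfolding setp by (auto simp: pre_def suf_def split: if_splits)
    have both: "hi j \<in> set p" "lo j \<in> set p" if "m \<le> j" "j \<le> M" for j
      using that unfolding setp by auto
    have vert: "hi i - (0, 1) = lo i" "lo i + (0, 1) = hi i" by (auto simp: hi_def lo_def)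
    show "z + (0, 1) \<in> set p \<or> z - (0, 1) \<in> set p"
      using i(3) vert both[OF i(1,2)] by auto
    show "z + (1, 0) \<in> set p \<or> z - (1, 0) \<in> set p"
      using i(3)
    proof
      assume zi: "z = hi i"
      show ?thesis
      proof (cases "i = m")
        case True
        then have "pre \<noteq> []" using z(2) zi hdp by auto
        then have "hi m - (1, 0) = lo (m - 1)" "lo (m - 1) \<in> set p"
          using step_m unfolding setp by (auto simp: pre_def split: if_splits)
        then show ?thesis using zi True by simp
      next
        case False
        then have "hi (i - 1) \<in> set p" "lo (i - 1) \<in> set p" using both i by auto
        then show ?thesis unfolding zi by (cases rule: step_cases[of "i - 1"]) auto
      qed
    next
      assume zi: "z = lo i"
      show ?thesis
      proof (cases "i = M")
        case True
        then have "suf \<noteq> []" using z(2) zi lastp by auto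
        then have "lo M + (1, 0) = hi (M + 1)" "hi (M + 1) \<in> set p"
          using step_M unfolding setp by (auto simp: suf_def split: if_splits)
        then show ?thesis using zi True by simp
      next
        case False
        then have "hi (i + 1) \<in> set p" "lo (i + 1) \<in> set p" using both i by auto
        then show ?thesis unfolding zi by (cases rule: step_cases[of i]) auto
      qed
    qed
  qed
  have form: "\<exists>i. z = hi i \<or> z = lo i" if "z \<in> set p" for z
    using that unfolding setp by (auto simp: pre_def suf_def split: if_splits)
  have Yp: "\<bar>Y z\<bar> \<le> 1" if "z \<in> set p" for z
    using form[OF that] Yb by auto
  let ?I = "{i::int. - (b * H + 1) \<le> 1 * real_of_int i \<and> 1 * real_of_int i \<le> b * H + 1}"
  have finI: "finite ?I" by (rule finite_samples) simp
  have "set p \<subseteq> hi ` ?I \<union> lo ` ?I"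
  proof
    fix z assume z: "z \<in> set p"
    then obtain i where i: "z = hi i \<or> z = lo i" using form by blast
    have fz: "fst z = i" using i by (auto simp: hi_def lo_def)
    have "z \<in> D H" using z chan by (auto simp: lattice_channel_def)
    then have "\<bar>b * X z\<bar> \<le> b * H" using b0 by (auto simp: D_def abs_mult intro: mult_left_mono)
    moreover have "\<bar>a * Y z\<bar> \<le> 1" using Yp[OF z] a0 a_le_1 by (simp add: abs_mult mult_le_one)
    ultimately have "\<bar>real_of_int (fst z)\<bar> \<le> b * H + 1" unfolding fst_eq by linarith
    then have "i \<in> ?I" by (auto simp: fz)
    then show "z \<in> hi ` ?I \<union> lo ` ?I" using i by auto
  qed
  then have "card (set p) \<le> card (hi ` ?I \<union> lo ` ?I)" using finI by (intro card_mono) auto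
  also have "\<dots> \<le> card (hi ` ?I) + card (lo ` ?I)" by (rule card_Un_le)
  also have "\<dots> \<le> card ?I + card ?I" using finI by (intro add_mono card_image_le)
  finally have "real (card (set p)) \<le> 2 * real (card ?I)" by simp
  moreover have "1 * real (card ?I) \<le> (b * H + 1 - - (b * H + 1)) + 1"
    using b0 H by (intro card_samples_le finI) auto
  ultimately have "real (card (set p)) \<le> 4 * b * H + 6" by linarith
  then show ?thesis using chan Yp by blast
qed

end

section \<open>Competitors\<close>

lemma lattice_energy_le_mass:
  assumes fin: "finite D" and l: "0 < l" and u: "\<And>z. 0 \<le> u z"
  shows "lattice_energy l D u \<le> (l + 4 / l) * (\<Sum>z\<in>D. (u z)\<^sup>2)"
proof -
  have e: "(\<Sum>z\<in>{z\<in>D. z + g \<in> D}. (u (z + g) - u z)\<^sup>2) \<le> 2 * (\<Sum>z\<in>D. (u z)\<^sup>2)" for g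
  proof -
    have "(u (z + g) - u z)\<^sup>2 \<le> (u z)\<^sup>2 + (u (z + g))\<^sup>2" for z
      using mult_nonneg_nonneg[OF u[of z] u[of "z + g"]] by (simp add: power2_diff)
    then have "(\<Sum>z\<in>{z\<in>D. z + g \<in> D}. (u (z + g) - u z)\<^sup>2) \<le> (\<Sum>z\<in>{z\<in>D. z + g \<in> D}. (u z)\<^sup>2 + (u (z + g))\<^sup>2)"
      by (intro sum_mono)
    also have "\<dots> \<le> 2 * (\<Sum>z\<in>D. (u z)\<^sup>2)" by (rule sum_edge_endpoints_le[OF fin]) simp
    finally show ?thesis .
  qed
  have "lattice_energy l D u \<le> l * (\<Sum>z\<in>D. (u z)\<^sup>2) + 1 / l * (2 * (\<Sum>z\<in>D. (u z)\<^sup>2) + 2 * (\<Sum>z\<in>D. (u z)\<^sup>2))"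
    unfolding lattice_energy_def using l by (intro add_left_mono mult_left_mono add_mono e) auto
  also have "\<dots> = (l + 4 / l) * (\<Sum>z\<in>D. (u z)\<^sup>2)" by (simp add: algebra_simps)
  finally show ?thesis .
qed

lemma sum_powers_le:
  fixes \<rho> :: real and f :: "'i \<Rightarrow> nat"
  assumes "finite N" "inj_on f N" "0 \<le> \<rho>" "\<rho> < 1"
  shows "(\<Sum>n\<in>N. \<rho> ^ f n) \<le> 1 / (1 - \<rho>)"
proof -
  have "(\<Sum>n\<in>N. \<rho> ^ f n) = (\<Sum>k\<in>f ` N. \<rho> ^ k)" using assms by (simp add: sum.reindex)
  also have "\<dots> \<le> (\<Sum>k. \<rho> ^ k)" using assms by (intro sum_le_suminf summable_geometric) auto
  also have "\<dots> = 1 / (1 - \<rho>)" using assms by (intro suminf_geometric) auto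
  finally show ?thesis .
qed

text \<open>On each side of the line the points of a column have distances at least \<open>0, b, 2 b, \<dots>\<close> from it, so that two
geometric series bound the sum.\<close>
lemma sum_exp_column_le:
  fixes c t b :: real and N :: "int set"
  assumes fin: "finite N" and t: "0 < t" and b: "0 < b"
  shows "(\<Sum>n\<in>N. exp (- (t * \<bar>c + b * of_int n\<bar>))) \<le> 2 / (1 - exp (- (t * b)))"
proof -
  define \<rho> where "\<rho> = exp (- (t * b))"
  have \<rho>: "0 \<le> \<rho>" "\<rho> < 1" using t b by (auto simp: \<rho>_def)
  define n0 where "n0 = \<lceil>- c / b\<rceil>"
  have n0: "- c \<le> b * of_int n0" "b * (of_int n0 - 1) < - c"
  proof -
    have "- c / b \<le> of_int n0" "of_int n0 - 1 < - c / b" unfolding n0_def by linarith+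
    then show "- c \<le> b * of_int n0" "b * (of_int n0 - 1) < - c" using b by (simp_all add: field_simps)
  qed
  have bound: "exp (- (t * \<bar>c + b * of_int n\<bar>)) \<le> \<rho> ^ k" if "b * real k \<le> \<bar>c + b * of_int n\<bar>" for n k
  proof -
    have "t * (b * real k) \<le> t * \<bar>c + b * of_int n\<bar>" using that t by (intro mult_left_mono) auto
    moreover have "\<rho> ^ k = exp (- (t * (b * real k)))" by (simp add: \<rho>_def exp_of_nat_mult[symmetric] ac_simps)
    ultimately show ?thesis by simp
  qed
  have "(\<Sum>n\<in>{n\<in>N. n0 \<le> n}. exp (- (t * \<bar>c + b * of_int n\<bar>))) \<le> (\<Sum>n\<in>{n\<in>N. n0 \<le> n}. \<rho> ^ nat (n - n0))"
  proof (intro sum_mono bound)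
    fix n assume n: "n \<in> {n\<in>N. n0 \<le> n}"
    have "b * real (nat (n - n0)) = b * of_int n - b * of_int n0" using n by (simp add: algebra_simps)
    then show "b * real (nat (n - n0)) \<le> \<bar>c + b * of_int n\<bar>" using n0(1) by linarith
  qed
  also have "\<dots> \<le> 1 / (1 - \<rho>)" using fin \<rho> by (intro sum_powers_le) (auto simp: inj_on_def)
  finally have 1: "(\<Sum>n\<in>{n\<in>N. n0 \<le> n}. exp (- (t * \<bar>c + b * of_int n\<bar>))) \<le> 1 / (1 - \<rho>)" .
  have "(\<Sum>n\<in>{n\<in>N. \<not> n0 \<le> n}. exp (- (t * \<bar>c + b * of_int n\<bar>))) \<le> (\<Sum>n\<in>{n\<in>N. \<not> n0 \<le> n}. \<rho> ^ nat (n0 - 1 - n))"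
  proof (intro sum_mono bound)
    fix n assume n: "n \<in> {n\<in>N. \<not> n0 \<le> n}"
    have "b * real (nat (n0 - 1 - n)) = b * (of_int n0 - 1) - b * of_int n" using n by (simp add: algebra_simps)
    then show "b * real (nat (n0 - 1 - n)) \<le> \<bar>c + b * of_int n\<bar>" using n0(2) by linarith
  qed
  also have "\<dots> \<le> 1 / (1 - \<rho>)" using fin \<rho> by (intro sum_powers_le) (auto simp: inj_on_def)
  finally have 2: "(\<Sum>n\<in>{n\<in>N. \<not> n0 \<le> n}. exp (- (t * \<bar>c + b * of_int n\<bar>))) \<le> 1 / (1 - \<rho>)" .
  have "(\<Sum>n\<in>N. exp (- (t * \<bar>c + b * of_int n\<bar>)))
     = (\<Sum>n\<in>{n\<in>N. n0 \<le> n}. exp (- (t * \<bar>c + b * of_int n\<bar>))) + (\<Sum>n\<in>{n\<in>N. \<not> n0 \<le> n}. exp (- (t * \<bar>c + b * of_int n\<bar>)))"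
    using fin by (subst sum.union_disjoint[symmetric]) (auto intro!: sum.cong)
  also have "\<dots> \<le> 2 / (1 - \<rho>)" using 1 2 by simp
  finally show ?thesis unfolding \<rho>_def .
qed

context rotated_lattice
begin

lemma strip_sum_le:
  assumes b: "0 < b" and l: "0 < l" and H: "0 \<le> H" and M: "0 \<le> M"
  shows "(\<Sum>z\<in>{z\<in>D H. \<bar>Y z\<bar> \<le> M}. exp (- (l * \<bar>Y z\<bar>))) \<le> (2 * b * H + 2 * M + 1) * (2 / (1 - exp (- (l * b))))"
proof -
  let ?S = "{z\<in>D H. \<bar>Y z\<bar> \<le> M}"
  let ?I = "fst ` ?S"
  let ?N = "\<lambda>m. {n. (m, n) \<in> ?S}"
  have finS: "finite ?S" using finite_D by simp
  have finI: "finite ?I" using finS by simp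
  have finN: "finite (?N m)" for m
  proof (rule finite_subset)
    show "?N m \<subseteq> snd ` ?S" by force
  qed (use finS in simp)
  have S: "?S = Sigma ?I ?N" by force
  have "(\<Sum>z\<in>?S. exp (- (l * \<bar>Y z\<bar>))) = (\<Sum>z\<in>Sigma ?I ?N. exp (- (l * \<bar>Y z\<bar>)))"
    using S by (rule arg_cong)
  also have "\<dots> = (\<Sum>m\<in>?I. \<Sum>n\<in>?N m. exp (- (l * \<bar>Y (m, n)\<bar>)))"
    using finI finN by (subst sum.Sigma) (auto simp: case_prod_beta)
  also have "\<dots> \<le> (\<Sum>m\<in>?I. 2 / (1 - exp (- (l * b))))"
    unfolding Y_def fst_conv snd_conv by (intro sum_mono sum_exp_column_le l b) (use finN in \<open>simp add: Y_def\<close>)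
  also have "\<dots> = real (card ?I) * (2 / (1 - exp (- (l * b))))" by simp
  also have "\<dots> \<le> (2 * b * H + 2 * M + 1) * (2 / (1 - exp (- (l * b))))"
  proof (intro mult_right_mono)
    have "1 * real (card ?I) \<le> ((b * H + M) - - (b * H + M)) + 1"
    proof (rule card_samples_le[OF finI])
      fix m assume "m \<in> ?I"
      then obtain z where z: "z \<in> ?S" "m = fst z" by blast
      then have "\<bar>b * X z\<bar> \<le> b * H" using b0 by (auto simp: D_def abs_mult intro!: mult_left_mono)
      moreover have "\<bar>a * Y z\<bar> \<le> 1 * M" using z a0 a_le_1 unfolding abs_mult by (intro mult_mono) auto
      ultimately have "\<bar>real_of_int (fst z)\<bar> \<le> b * H + M" unfolding fst_eq by linarith
      then show "- (b * H + M) \<le> 1 * real_of_int m \<and> 1 * real_of_int m \<le> b * H + M" unfolding z(2) by linarith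
    qed (use b H M in auto)
    then show "real (card ?I) \<le> 2 * b * H + 2 * M + 1" by linarith
  qed (use l b in auto)
  finally show ?thesis .
qed

lemma card_box_le:
  assumes r: "0 \<le> r" and S: "\<And>z. z \<in> S \<Longrightarrow> \<bar>real_of_int (fst z) - c\<bar> \<le> r \<and> \<bar>real_of_int (snd z) - d\<bar> \<le> r"
  shows "finite S" "real (card S) \<le> (2 * r + 1)\<^sup>2"
proof -
  let ?I = "\<lambda>c. {k::int. c - r \<le> 1 * real_of_int k \<and> 1 * real_of_int k \<le> c + r}"
  have fin: "finite (?I c)" for c by (rule finite_samples) simp
  have card: "real (card (?I c)) \<le> 2 * r + 1" for c
    using card_samples_le[OF fin, of 1 "c - r" "c + r" c] r by auto
  have sub: "S \<subseteq> ?I c \<times> ?I d"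
    using S by (fastforce simp: abs_le_iff)
  then show "finite S" by (rule finite_subset) (intro finite_cartesian_product fin)
  have "card S \<le> card (?I c \<times> ?I d)" using sub fin by (intro card_mono) auto
  then have "real (card S) \<le> real (card (?I c)) * real (card (?I d))" by (simp add: card_cartesian_product flip: of_nat_mult)
  also have "\<dots> \<le> (2 * r + 1) * (2 * r + 1)" using card r by (intro mult_mono) auto
  finally show "real (card S) \<le> (2 * r + 1)\<^sup>2" by (simp add: power2_eq_square)
qed

text \<open>Near an end of the strip both integer coordinates are confined to intervals of fixed length, wherever the end lies.
This bounds the cost of the left and right ends of a competitor uniformly in the size of the square.\<close>
lemma card_ends_le:
  assumes M: "0 \<le> M"
  shows "real (card {z\<in>D H. H - 5 < \<bar>X z\<bar> \<and> \<bar>Y z\<bar> \<le> M}) \<le> 2 * (2 * (M + 5) + 1)\<^sup>2"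
proof -
  let ?R = "{z\<in>D H. H - 5 < X z \<and> \<bar>Y z\<bar> \<le> M}"
  let ?L = "{z\<in>D H. X z < 5 - H \<and> \<bar>Y z\<bar> \<le> M}"
  have m: "\<bar>b * x\<bar> \<le> \<bar>x\<bar>" "\<bar>a * x\<bar> \<le> \<bar>x\<bar>" for x
    using a0 b0 a_le_1 b_le_1 by (auto simp: abs_mult mult_left_le_one_le)
  have key: "\<bar>real_of_int (fst z) - b * x\<bar> \<le> M + 5 \<and> \<bar>real_of_int (snd z) - - (a * x)\<bar> \<le> M + 5"
    if "\<bar>X z - x\<bar> \<le> 5" "\<bar>Y z\<bar> \<le> M" for x z
  proof -
    have "real_of_int (fst z) - b * x = b * (X z - x) + a * Y z"
      "real_of_int (snd z) - - (a * x) = b * Y z - a * (X z - x)"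
      unfolding fst_eq snd_eq by (simp_all add: algebra_simps)
    then show ?thesis using m(1)[of "X z - x"] m(2)[of "Y z"] m(2)[of "X z - x"] m(1)[of "Y z"] that by linarith
  qed
  have "real (card ?R) \<le> (2 * (M + 5) + 1)\<^sup>2"
    using M by (intro card_box_le[where c = "b * H" and d = "- (a * H)"] key) (auto simp: D_def)
  moreover have "real (card ?L) \<le> (2 * (M + 5) + 1)\<^sup>2"
    using M by (intro card_box_le[where c = "b * - H" and d = "- (a * - H)"] key) (auto simp: D_def)
  moreover have "card {z\<in>D H. H - 5 < \<bar>X z\<bar> \<and> \<bar>Y z\<bar> \<le> M} \<le> card (?R \<union> ?L)"
    using finite_D by (intro card_mono) auto
  then have "card {z\<in>D H. H - 5 < \<bar>X z\<bar> \<and> \<bar>Y z\<bar> \<le> M} \<le> card ?R + card ?L"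
    using card_Un_le[of ?R ?L] by linarith
  ultimately show ?thesis by linarith
qed

end

lemma exp_diff_le:
  fixes l s t :: real
  assumes l: "0 < l" and st: "\<bar>t - s\<bar> \<le> 1"
  shows "\<bar>exp (- (l * (s - 1))) - exp (- (l * (t - 1)))\<bar> \<le> l * \<bar>t - s\<bar> * (exp (2 * l) * exp (- (l * s)))"
proof -
  have *: "\<bar>exp (- (l * x)) - exp (- (l * y))\<bar> \<le> l * (y - x) * exp (- (l * x))" if "x \<le> y" for x y
  proof -
    have "exp (- (l * y)) = exp (- (l * x)) * exp (- (l * (y - x)))"
      by (simp add: exp_add[symmetric] algebra_simps)
    moreover have "1 - l * (y - x) \<le> exp (- (l * (y - x)))" "exp (- (l * (y - x))) \<le> 1"
      using exp_ge_add_one_self[of "- (l * (y - x))"] l that by auto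
    ultimately have "\<bar>exp (- (l * x)) - exp (- (l * y))\<bar> = exp (- (l * x)) * (1 - exp (- (l * (y - x))))"
      by (simp add: right_diff_distrib mult_left_le)
    also have "\<dots> \<le> exp (- (l * x)) * (l * (y - x))"
      using \<open>1 - l * (y - x) \<le> exp (- (l * (y - x)))\<close> by (intro mult_left_mono) auto
    finally show ?thesis by (simp add: ac_simps)
  qed
  have fin: "exp (- (l * (x - 1))) \<le> exp (2 * l) * exp (- (l * s))" if "s - 1 \<le> x" for x
  proof -
    have "l * (s - 1) \<le> l * x" using l that by (intro mult_left_mono) auto
    then show ?thesis by (simp add: exp_add[symmetric] algebra_simps)
  qed
  show ?thesis
  proof (cases "s \<le> t")
    case True
    have "\<bar>exp (- (l * (s - 1))) - exp (- (l * (t - 1)))\<bar> \<le> l * (t - s) * exp (- (l * (s - 1)))"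
      using *[of "s - 1" "t - 1"] True by simp
    also have "\<dots> \<le> l * (t - s) * (exp (2 * l) * exp (- (l * s)))"
      using True l by (intro mult_left_mono fin) auto
    finally show ?thesis using True by simp
  next
    case False
    have "\<bar>exp (- (l * (s - 1))) - exp (- (l * (t - 1)))\<bar> \<le> l * (s - t) * exp (- (l * (t - 1)))"
      using *[of "t - 1" "s - 1"] False by (simp add: abs_minus_commute)
    also have "\<dots> \<le> l * (s - t) * (exp (2 * l) * exp (- (l * s)))"
      using False l st by (intro mult_left_mono fin) auto
    finally show ?thesis using False by simp
  qed
qed

context rotated_lattice
begin

text \<open>The optimal profile \<open>exp (- l t)\<close> as a function of the distance \<open>t\<close> from the line has to be \<open>1\<close> for \<open>t \<le> 1\<close>, on
the channel, and \<open>0\<close> near the boundary. Stretching its range from \<open>(0, 1]\<close> to \<open>(- l, 1]\<close> and clipping makes it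
vanish for \<open>t \<ge> M\<close>, with \<open>M\<close> independent of \<open>H\<close>, at the price of a factor \<open>1 + l\<close>. The window \<open>W\<close> removes it
near the left and right sides, which changes only the boundedly many edges at points of \<open>S'\<close>.\<close>
lemma exists_profile:
  assumes b: "0 < b" and l: "0 < l"
  shows "\<exists>C H0. \<forall>H p. H0 \<le> H \<longrightarrow> lattice_channel H p \<longrightarrow> (\<forall>z\<in>set p. \<bar>Y z\<bar> \<le> 1) \<longrightarrow>
    (\<exists>u. (\<forall>z\<in>set p. u z = 1) \<and> (\<forall>z. u z \<noteq> 0 \<longrightarrow> z \<notin> set p \<longrightarrow> \<bar>X z\<bar> \<le> H - 4 \<and> \<bar>Y z\<bar> \<le> H - 4) \<and>
      lattice_energy l (D H) u
        \<le> 2 * l * ((1 + l) * exp (2 * l))\<^sup>2 * (2 * b * H) * (2 / (1 - exp (- (2 * l * b)))) + C)"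
proof -
  define P where "P t = clip ((1 + l) * exp (- (l * (t - 1))) - l)" for t
  define M where "M = 1 + ln ((1 + l) / l) / l"
  define A where "A = (1 + l) * exp (2 * l)"
  define q where "q z = exp (- (2 * l * \<bar>Y z\<bar>))" for z
  have M1: "1 \<le> M" using l by (simp add: M_def)
  have P01: "0 \<le> P t" "P t \<le> 1" for t by (auto simp: P_def clip_bounds)
  have P_M: "P t = 0" if "M \<le> t" for t
  proof -
    have "ln ((1 + l) / l) \<le> l * (t - 1)" using that l by (simp add: M_def field_simps)
    then have "exp (- (l * (t - 1))) \<le> exp (- ln ((1 + l) / l))" by simp
    also have "\<dots> = l / (1 + l)" using l by (simp add: exp_minus)
    finally have "(1 + l) * exp (- (l * (t - 1))) \<le> l" using l by (simp add: field_simps)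
    then show ?thesis unfolding P_def by (intro clip_eq_0) simp
  qed
  have P_1: "P t = 1" if "t \<le> 1" for t
  proof -
    have "1 \<le> exp (- (l * (t - 1)))" using that l by (simp add: mult_nonneg_nonpos)
    then have "(1 + l) * 1 \<le> (1 + l) * exp (- (l * (t - 1)))" using l by (intro mult_left_mono) auto
    then show ?thesis unfolding P_def by (intro clip_eq_1) simp
  qed
  have P_le: "P t \<le> A * exp (- (l * t))" for t
  proof -
    have "P t \<le> (1 + l) * exp (- (l * (t - 1)))" using l unfolding P_def clip_def by (auto simp: max_def min_def)
    also have "exp (- (l * (t - 1))) \<le> exp (2 * l) * exp (- (l * t))"
      using l by (simp add: exp_add[symmetric] algebra_simps)
    then have "(1 + l) * exp (- (l * (t - 1))) \<le> (1 + l) * (exp (2 * l) * exp (- (l * t)))"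
      using l by (intro mult_left_mono) auto
    finally show ?thesis by (simp add: A_def ac_simps)
  qed
  have P_lip: "\<bar>P t - P s\<bar> \<le> l * \<bar>t - s\<bar> * (A * exp (- (l * s)))" if "\<bar>t - s\<bar> \<le> 1" for s t
  proof -
    have "\<bar>P t - P s\<bar> \<le> \<bar>((1 + l) * exp (- (l * (t - 1))) - l) - ((1 + l) * exp (- (l * (s - 1))) - l)\<bar>"
      unfolding P_def by (rule clip_lipschitz)
    also have "\<dots> = (1 + l) * \<bar>exp (- (l * (s - 1))) - exp (- (l * (t - 1)))\<bar>"
      using l by (simp add: abs_minus_commute abs_mult flip: right_diff_distrib)
    also have "\<dots> \<le> (1 + l) * (l * \<bar>t - s\<bar> * (exp (2 * l) * exp (- (l * s))))"
      using l by (intro mult_left_mono exp_diff_le that) auto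
    finally show ?thesis by (simp add: A_def ac_simps)
  qed
  have q_eq: "(exp (- (l * \<bar>Y z\<bar>)))\<^sup>2 = q z" for z
    by (simp add: q_def exp_double[symmetric] ac_simps)
  define B where "B = 2 / (1 - exp (- (2 * l * b)))"
  define E where "E = 2 * (2 * (M + 1 + 5) + 1)\<^sup>2"
  have "\<exists>u. (\<forall>z\<in>set p. u z = 1) \<and> (\<forall>z. u z \<noteq> 0 \<longrightarrow> z \<notin> set p \<longrightarrow> \<bar>X z\<bar> \<le> H - 4 \<and> \<bar>Y z\<bar> \<le> H - 4) \<and>
      lattice_energy l (D H) u \<le> 2 * l * A\<^sup>2 * (2 * b * H) * B + (2 * l * A\<^sup>2 * (2 * (M + 1) + 1) * B + 2 / l * E)"
    if H: "M + 4 \<le> H" and p: "lattice_channel H p" and Yp: "\<forall>z\<in>set p. \<bar>Y z\<bar> \<le> 1" for H p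
  proof -
    define W where "W z \<longleftrightarrow> z \<in> set p \<or> \<bar>X z\<bar> \<le> H - 4" for z
    define u where "u z = (if W z then P \<bar>Y z\<bar> else 0)" for z
    have u01: "0 \<le> u z" "u z \<le> 1" for z using P01 by (auto simp: u_def)
    have uM: "u z = 0" if "M \<le> \<bar>Y z\<bar>" for z using P_M[OF that] by (simp add: u_def)
    define S where "S = {z\<in>D H. \<bar>Y z\<bar> \<le> M + 1}"
    define S' where "S' = {z\<in>D H. H - 5 < \<bar>X z\<bar> \<and> \<bar>Y z\<bar> \<le> M + 1}"
    have fin: "finite S" "finite S'" using finite_D by (auto simp: S_def S'_def)
    have Q: "(\<Sum>z\<in>S. q z) \<le> (2 * b * H + 2 * (M + 1) + 1) * B"
      unfolding S_def q_def B_def using l H M1 by (intro strip_sum_le b) auto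
    have cS': "real (card S') \<le> E" unfolding S'_def E_def using M1 by (intro card_ends_le) simp
    have mass: "(\<Sum>z\<in>D H. (u z)\<^sup>2) \<le> A\<^sup>2 * (\<Sum>z\<in>S. q z)"
    proof -
      have "(\<Sum>z\<in>D H. (u z)\<^sup>2) = (\<Sum>z\<in>S. (u z)\<^sup>2)"
      proof (intro sum.mono_neutral_right finite_D ballI)
        fix z assume "z \<in> D H - S"
        then have "M \<le> \<bar>Y z\<bar>" by (auto simp: S_def)
        then show "(u z)\<^sup>2 = 0" by (simp add: uM)
      qed (simp add: S_def)
      also have "\<dots> \<le> (\<Sum>z\<in>S. A\<^sup>2 * q z)"
      proof (rule sum_mono)
        fix z
        have "u z \<le> A * exp (- (l * \<bar>Y z\<bar>))" using P_le[of "\<bar>Y z\<bar>"] order_trans[OF P01(1) P_le] by (auto simp: u_def)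
        then have "(u z)\<^sup>2 \<le> (A * exp (- (l * \<bar>Y z\<bar>)))\<^sup>2" using u01 by (intro power_mono)
        then show "(u z)\<^sup>2 \<le> A\<^sup>2 * q z" by (simp add: power_mult_distrib q_eq)
      qed
      finally show ?thesis by (simp add: sum_distrib_left)
    qed
    have grad: "(\<Sum>z\<in>{z\<in>D H. z + g \<in> D H}. (u (z + g) - u z)\<^sup>2) \<le> l\<^sup>2 * c\<^sup>2 * A\<^sup>2 * (\<Sum>z\<in>S. q z) + E"
      if g: "g \<in> lattice_steps" and c: "0 \<le> c" "c \<le> 1" "\<And>z. \<bar>Y (z + g) - Y z\<bar> \<le> c" for g c
    proof -
      have edge: "(u (z + g) - u z)\<^sup>2 \<le> of_bool (z \<in> S) * (l\<^sup>2 * c\<^sup>2 * A\<^sup>2 * q z) + of_bool (z \<in> S')" if z: "z \<in> D H" for z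
      proof -
        have tt: "\<bar>\<bar>Y (z + g)\<bar> - \<bar>Y z\<bar>\<bar> \<le> c" using c(3)[of z] by linarith
        have Xs: "\<bar>X (z + g) - X z\<bar> \<le> 1" using step_le(1)[of "z + g" z] g by simp
        consider (far) "M + 1 < \<bar>Y z\<bar>" | (win) "\<bar>Y z\<bar> \<le> M + 1" "W z" "W (z + g)"
          | (out) "\<bar>Y z\<bar> \<le> M + 1" "\<not> (W z \<and> W (z + g))" by linarith
        then show ?thesis
        proof cases
          case far
          then have "u z = 0" "u (z + g) = 0" using tt c by (auto intro!: uM)
          moreover have "0 \<le> of_bool (z \<in> S) * (l\<^sup>2 * c\<^sup>2 * A\<^sup>2 * q z)" by (simp add: q_def)
          ultimately show ?thesis by simp
        next
          case win
          then have "\<bar>u (z + g) - u z\<bar> \<le> l * \<bar>\<bar>Y (z + g)\<bar> - \<bar>Y z\<bar>\<bar> * (A * exp (- (l * \<bar>Y z\<bar>)))"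
            using P_lip[of "\<bar>Y (z + g)\<bar>" "\<bar>Y z\<bar>"] tt c by (simp add: u_def)
          also have "\<dots> \<le> l * c * (A * exp (- (l * \<bar>Y z\<bar>)))"
            using tt l by (intro mult_right_mono mult_left_mono) (auto simp: A_def)
          finally have "\<bar>u (z + g) - u z\<bar>\<^sup>2 \<le> (l * c * (A * exp (- (l * \<bar>Y z\<bar>))))\<^sup>2" by (intro power_mono) auto
          moreover have "z \<in> S" using win z by (simp add: S_def)
          ultimately show ?thesis by (simp add: power_mult_distrib q_eq ac_simps)
        next
          case out
          then have "H - 4 < \<bar>X z\<bar> \<or> H - 4 < \<bar>X (z + g)\<bar>" by (auto simp: W_def)
          then have "z \<in> S'" using Xs out(1) z by (auto simp: S'_def)
          moreover have "\<bar>u (z + g) - u z\<bar> \<le> 1" using u01[of z] u01[of "z + g"] by linarith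
          then have "(u (z + g) - u z)\<^sup>2 \<le> 1" by (simp add: abs_square_le_1)
          moreover have "0 \<le> of_bool (z \<in> S) * (l\<^sup>2 * c\<^sup>2 * A\<^sup>2 * q z)" by (simp add: q_def)
          ultimately show ?thesis by simp
        qed
      qed
      have "(\<Sum>z\<in>{z\<in>D H. z + g \<in> D H}. (u (z + g) - u z)\<^sup>2) \<le> (\<Sum>z\<in>D H. (u (z + g) - u z)\<^sup>2)"
        using finite_D by (intro sum_mono2) auto
      also have "\<dots> \<le> (\<Sum>z\<in>D H. of_bool (z \<in> S) * (l\<^sup>2 * c\<^sup>2 * A\<^sup>2 * q z) + of_bool (z \<in> S'))"
        by (intro sum_mono edge)
      also have "\<dots> = (\<Sum>z\<in>S. l\<^sup>2 * c\<^sup>2 * A\<^sup>2 * q z) + (\<Sum>z\<in>S'. 1)"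
      proof -
        have "(\<Sum>z\<in>D H. of_bool (z \<in> T) * f z) = (\<Sum>z\<in>T. f z)" if "T \<subseteq> D H" for T and f :: "int \<times> int \<Rightarrow> real"
          using that finite_D by (intro sum.mono_neutral_cong_right) auto
        from this[of S] this[of S' "\<lambda>_. 1"] show ?thesis by (simp add: sum.distrib S_def S'_def)
      qed
      also have "\<dots> \<le> l\<^sup>2 * c\<^sup>2 * A\<^sup>2 * (\<Sum>z\<in>S. q z) + E" using cS' by (simp add: sum_distrib_left)
      finally show ?thesis .
    qed
    have g1: "(\<Sum>z\<in>{z\<in>D H. z + (1, 0) \<in> D H}. (u (z + (1, 0)) - u z)\<^sup>2) \<le> l\<^sup>2 * a\<^sup>2 * A\<^sup>2 * (\<Sum>z\<in>S. q z) + E"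
      by (rule grad) (auto simp: lattice_steps_def a0 a_le_1)
    have g2: "(\<Sum>z\<in>{z\<in>D H. z + (0, 1) \<in> D H}. (u (z + (0, 1)) - u z)\<^sup>2) \<le> l\<^sup>2 * b\<^sup>2 * A\<^sup>2 * (\<Sum>z\<in>S. q z) + E"
      by (rule grad) (auto simp: lattice_steps_def b0 b_le_1)
    have "lattice_energy l (D H) u \<le> l * (A\<^sup>2 * (\<Sum>z\<in>S. q z))
       + 1 / l * ((l\<^sup>2 * a\<^sup>2 * A\<^sup>2 * (\<Sum>z\<in>S. q z) + E) + (l\<^sup>2 * b\<^sup>2 * A\<^sup>2 * (\<Sum>z\<in>S. q z) + E))"
      unfolding lattice_energy_def using l by (intro add_mono mult_left_mono mass g1 g2) auto
    also have "\<dots> = l * (A\<^sup>2 * (\<Sum>z\<in>S. q z)) + 1 / l * (l\<^sup>2 * (a\<^sup>2 + b\<^sup>2) * A\<^sup>2 * (\<Sum>z\<in>S. q z) + 2 * E)"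
      by (simp only: distrib_left distrib_right mult_2)
    also have "\<dots> = 2 * l * A\<^sup>2 * (\<Sum>z\<in>S. q z) + 2 / l * E"
      using l unfolding ab by (simp add: field_simps power2_eq_square)
    also have "\<dots> \<le> 2 * l * A\<^sup>2 * ((2 * b * H + 2 * (M + 1) + 1) * B) + 2 / l * E"
      using l by (intro add_right_mono mult_left_mono Q) auto
    also have "\<dots> = 2 * l * A\<^sup>2 * (2 * b * H) * B + (2 * l * A\<^sup>2 * (2 * (M + 1) + 1) * B + 2 / l * E)"
      by (simp add: algebra_simps)
    finally have en: "lattice_energy l (D H) u \<le> \<dots>" .
    have "u z = 1" if "z \<in> set p" for z
      using that Yp P_1 by (auto simp: u_def W_def)
    moreover have "\<bar>X z\<bar> \<le> H - 4 \<and> \<bar>Y z\<bar> \<le> H - 4" if "u z \<noteq> 0" "z \<notin> set p" for z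
    proof -
      have "\<not> M \<le> \<bar>Y z\<bar>" using uM that(1) by blast
      moreover have "\<bar>X z\<bar> \<le> H - 4" using that by (auto simp: u_def W_def split: if_splits)
      ultimately show ?thesis using H by simp
    qed
    ultimately show ?thesis using en by blast
  qed
  then show ?thesis unfolding A_def B_def by blast
qed

end

section \<open>From the plane to lattice coordinates\<close>

text \<open>A frame consists of lattice unit vectors \<open>e\<close> and \<open>f\<close>, with signs and order chosen such that the coordinates of
  \<open>\<nu>\<close> are \<open>0 \<le> a \<le> b\<close>. This removes the eight symmetries of the lattice from all further arguments. In the frame
  \<open>perp \<nu>\<close> may point to the left; then \<open>\<tau> = -1\<close>, and channels are read backwards.\<close>
locale lattice_frame = flat_lattice a b for a b :: real +
  fixes e f \<nu> :: "real^2" and \<tau> :: real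
  assumes axes: "(e = axis 1 1 \<or> e = - axis 1 1) \<and> (f = axis 2 1 \<or> f = - axis 2 1) \<or>
                 (e = axis 2 1 \<or> e = - axis 2 1) \<and> (f = axis 1 1 \<or> f = - axis 1 1)"
    and \<nu>_eq: "\<nu> = a *\<^sub>R e + b *\<^sub>R f" and perp_eq: "perp \<nu> = \<tau> *\<^sub>R (b *\<^sub>R e - a *\<^sub>R f)"
    and \<tau>: "\<tau> = 1 \<or> \<tau> = - 1"
begin

definition pt :: "int \<times> int \<Rightarrow> real^2" where
  "pt z = of_int (fst z) *\<^sub>R e + of_int (snd z) *\<^sub>R f"

lemma ef_inner: "e \<bullet> e = 1" "f \<bullet> f = 1" "e \<bullet> f = 0" "f \<bullet> e = 0"
  using axes by (auto simp: inner_axis_axis inner_commute)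

lemma inner_\<nu>: "pt z \<bullet> \<nu> = Y z"
  unfolding \<nu>_eq pt_def Y_def by (simp add: inner_add_left inner_add_right ef_inner)

lemma inner_perp: "pt z \<bullet> perp \<nu> = \<tau> * X z"
  unfolding perp_eq pt_def X_def
  by (simp add: inner_add_left inner_diff_right ef_inner algebra_simps)

lemma norm_\<nu>: "norm \<nu> = 1" "norm (perp \<nu>) = 1"
proof -
  have "(norm \<nu>)\<^sup>2 = a\<^sup>2 + b\<^sup>2" "(norm (perp \<nu>))\<^sup>2 = a\<^sup>2 + b\<^sup>2"
    unfolding power2_norm_eq_inner perp_eq unfolding \<nu>_eq using \<tau>
    by (auto simp: inner_add_left inner_add_right inner_diff_left inner_diff_right ef_inner power2_eq_square)
  then show "norm \<nu> = 1" "norm (perp \<nu>) = 1" unfolding ab by (simp_all add: power2_eq_imp_eq[of _ 1])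
qed

lemma pt_add: "pt (z + z') = pt z + pt z'"
  by (simp add: pt_def algebra_simps)

lemma pt_diff: "pt (z - z') = pt z - pt z'"
  by (simp add: pt_def algebra_simps)

lemma pt_basis [simp]: "pt (1, 0) = e" "pt (0, 1) = f"
  by (simp_all add: pt_def)

lemma norm_pt: "(norm (pt z))\<^sup>2 = (of_int (fst z))\<^sup>2 + (of_int (snd z))\<^sup>2"
  unfolding power2_norm_eq_inner pt_def
  by (simp add: inner_add_left inner_add_right ef_inner power2_eq_square)

lemma norm_pt_eq_1: "norm (pt z) = 1 \<longleftrightarrow> z \<in> lattice_steps"
proof
  assume "norm (pt z) = 1"
  then have "real_of_int ((fst z)\<^sup>2 + (snd z)\<^sup>2) = 1" using norm_pt[of z] by simp
  then have eq: "(fst z)\<^sup>2 + (snd z)\<^sup>2 = 1" by linarith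
  then have "(fst z)\<^sup>2 \<le> 1\<^sup>2" "(snd z)\<^sup>2 \<le> 1\<^sup>2"
    using zero_le_power2[of "fst z"] zero_le_power2[of "snd z"] unfolding one_power2 by linarith+
  then have "\<bar>fst z\<bar> \<le> 1" "\<bar>snd z\<bar> \<le> 1" by (simp_all add: abs_square_le_1)
  then have "fst z \<in> {-1, 0, 1}" "snd z \<in> {-1, 0, 1}" by auto
  then show "z \<in> lattice_steps" using eq by (cases z) (auto simp: lattice_steps_def)
next
  assume "z \<in> lattice_steps"
  then have "(norm (pt z))\<^sup>2 = 1" unfolding norm_pt by (auto simp: lattice_steps_def)
  then show "norm (pt z) = 1" by (simp add: power2_eq_1_iff) (metis norm_ge_zero not_one_le_zero neg_0_le_iff_le)?
qed

lemma lattice_steps_uminus: "- z \<in> lattice_steps \<longleftrightarrow> z \<in> lattice_steps"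
  by (cases z) (auto simp: lattice_steps_def)

lemma norm_pt_diff: "norm (pt z - pt z') = 1 \<longleftrightarrow> adjacent z' z" "norm (pt z - pt z') = 1 \<longleftrightarrow> adjacent z z'"
  using norm_pt_eq_1[of "z - z'"] lattice_steps_uminus[of "z - z'"] by (auto simp: pt_diff)

lemma pt_inject: "pt z = pt z' \<longleftrightarrow> z = z'"
proof
  assume "pt z = pt z'"
  then have "pt z \<bullet> e = pt z' \<bullet> e" "pt z \<bullet> f = pt z' \<bullet> f" by simp_all
  then show "z = z'" by (simp add: pt_def inner_add_left ef_inner prod_eq_iff)
qed simp

lemma inj_pt: "inj_on pt S"
  by (simp add: inj_on_def pt_inject)

lemma pt_Z2: "pt z \<in> Z2"
  using axes by (auto simp: pt_def Z2_def axis_def)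

lemma Z2_eq: "Z2 = range pt"
proof
  show "range pt \<subseteq> Z2" using pt_Z2 by auto
  show "Z2 \<subseteq> range pt"
  proof
    fix x :: "real^2" assume "x \<in> Z2"
    then have "x $ 1 \<in> \<int>" "x $ 2 \<in> \<int>" by (auto simp: Z2_def)
    then obtain m n where mn: "x $ 1 = of_int m" "x $ 2 = of_int n" by (auto elim!: Ints_cases)
    define s t :: int where "s = (if e = axis 1 1 \<or> e = axis 2 1 then 1 else - 1)"
      and "t = (if f = axis 1 1 \<or> f = axis 2 1 then 1 else - 1)"
    have ax: "axis 1 1 \<noteq> (axis 2 1 :: real^2)" "- axis 1 1 \<noteq> (axis 2 1 :: real^2)" "- axis 2 1 \<noteq> (axis 1 1 :: real^2)"
      "- axis 1 1 \<noteq> (axis 1 1 :: real^2)" "- axis 2 1 \<noteq> (axis 2 1 :: real^2)"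
      by (auto simp: vec_eq_iff axis_def)
    have "x = pt (if e = axis 1 1 \<or> e = - axis 1 1 then (s * m, t * n) else (s * n, t * m))"
      using axes mn ax unfolding vec_eq_iff forall_2 pt_def s_def t_def
      by (auto simp: axis_def)
    then show "x \<in> range pt" by blast
  qed
qed

lemma TQ_eq: "0 < T \<Longrightarrow> TQ T \<nu> = {x. \<bar>x \<bullet> \<nu>\<bar> < T / 2 \<and> \<bar>x \<bullet> perp \<nu>\<bar> < T / 2}"
proof (intro equalityI subsetI)
  fix x assume T: "0 < T" and "x \<in> TQ T \<nu>"
  then obtain y where "x = T *\<^sub>R y" "\<bar>y \<bullet> \<nu>\<bar> < 1 / 2" "\<bar>y \<bullet> perp \<nu>\<bar> < 1 / 2"
    by (auto simp: TQ_def unit_square_def)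
  then show "x \<in> {x. \<bar>x \<bullet> \<nu>\<bar> < T / 2 \<and> \<bar>x \<bullet> perp \<nu>\<bar> < T / 2}"
    using T by (simp add: abs_mult)
next
  fix x assume T: "0 < T" and x: "x \<in> {x. \<bar>x \<bullet> \<nu>\<bar> < T / 2 \<and> \<bar>x \<bullet> perp \<nu>\<bar> < T / 2}"
  then have "(1 / T) *\<^sub>R x \<in> unit_square \<nu>"
    by (simp add: unit_square_def abs_mult field_simps)
  moreover have "x = T *\<^sub>R ((1 / T) *\<^sub>R x)" using T by simp
  ultimately show "x \<in> TQ T \<nu>" unfolding TQ_def by blast
qed

lemma pt_in_TQ: "0 < T \<Longrightarrow> pt z \<in> TQ T \<nu> \<longleftrightarrow> z \<in> D (T / 2)"
  using \<tau> by (auto simp: TQ_eq inner_\<nu> inner_perp D_def abs_mult)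

lemma TQ_Z2: "0 < T \<Longrightarrow> TQ T \<nu> \<inter> Z2 = pt ` D (T / 2)"
  using pt_in_TQ by (auto simp: Z2_eq)

text \<open>The sum over ordered pairs counts every edge twice, which cancels the factor \<open>1/2\<close> in front of it.\<close>
lemma energy_eq:
  assumes T: "0 < T"
  shows "energy l (TQ T \<nu>) v = lattice_energy l (D (T / 2)) (\<lambda>z. 1 - v (pt z))"
proof -
  let ?D = "D (T / 2)"
  let ?u = "\<lambda>z. 1 - v (pt z)"
  let ?h = "\<lambda>g. {z\<in>?D. z + g \<in> ?D}"
  have fin: "finite ?D" by (rule finite_D)
  have mass: "(\<Sum>i\<in>TQ T \<nu> \<inter> Z2. (v i - 1)\<^sup>2) = (\<Sum>z\<in>?D. (?u z)\<^sup>2)"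
    unfolding TQ_Z2[OF T] by (simp add: sum.reindex[OF inj_pt] power2_commute)
  let ?E = "\<lambda>g. (\<lambda>z. (z, z + g)) ` ?h g"
  let ?P = "{(z, z'). z \<in> ?D \<and> z' \<in> ?D \<and> adjacent z z'}"
  have P: "?P = (?E (1, 0) \<union> ?E (- 1, 0)) \<union> (?E (0, 1) \<union> ?E (0, - 1))"
  proof (intro equalityI subsetI)
    fix x assume x: "x \<in> ?P"
    then obtain z z' where zz: "x = (z, z')" "z \<in> ?D" "z' \<in> ?D" "z' - z \<in> lattice_steps" by blast
    have "x \<in> ?E (z' - z)" using zz by auto
    then show "x \<in> (?E (1, 0) \<union> ?E (- 1, 0)) \<union> (?E (0, 1) \<union> ?E (0, - 1))"
      using zz(4) unfolding lattice_steps_def by auto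
  qed (auto simp: lattice_steps_def)
  have disj: "?E g \<inter> ?E g' = {}" if "g \<noteq> g'" for g g' using that by auto
  have finE: "finite (?E g)" for g using fin by simp
  let ?w = "\<lambda>(z, z'). (?u z' - ?u z)\<^sup>2"
  have E: "(\<Sum>x\<in>?E g. ?w x) = (\<Sum>z\<in>?h g. (?u (z + g) - ?u z)\<^sup>2)" for g
    by (subst sum.reindex) (auto simp: inj_on_def)
  have rev: "(\<Sum>z\<in>?h (- g). (?u (z + - g) - ?u z)\<^sup>2) = (\<Sum>z\<in>?h g. (?u (z + g) - ?u z)\<^sup>2)" for g
    by (rule sum_edges_reverse) (rule power2_commute)
  have "{(i, j). i \<in> TQ T \<nu> \<inter> Z2 \<and> j \<in> TQ T \<nu> \<inter> Z2 \<and> norm (i - j) = 1} = map_prod pt pt ` ?P"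
    unfolding TQ_Z2[OF T] by (auto simp: norm_pt_diff(2) image_iff)
  then have "(\<Sum>(i, j)\<in>{(i, j). i \<in> TQ T \<nu> \<inter> Z2 \<and> j \<in> TQ T \<nu> \<inter> Z2 \<and> norm (i - j) = 1}. \<bar>v i - v j\<bar>\<^sup>2)
     = (\<Sum>x\<in>?P. ?w x)"
    by (simp only:) (subst sum.reindex, auto simp: inj_on_def pt_inject case_prod_beta intro!: sum.cong)
  also have "\<dots> = ((\<Sum>x\<in>?E (1, 0). ?w x) + (\<Sum>x\<in>?E (- 1, 0). ?w x)) + ((\<Sum>x\<in>?E (0, 1). ?w x) + (\<Sum>x\<in>?E (0, - 1). ?w x))"
    unfolding P by (subst sum.union_disjoint sum.union_disjoint[OF finE finE disj], use finE in \<open>auto\<close>)+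
  also have "\<dots> = 2 * ((\<Sum>z\<in>?h (1, 0). (?u (z + (1, 0)) - ?u z)\<^sup>2) + (\<Sum>z\<in>?h (0, 1). (?u (z + (0, 1)) - ?u z)\<^sup>2))"
    unfolding E using rev[of "(1, 0)"] rev[of "(0, 1)"] by simp
  finally have pairs: "(\<Sum>(i, j)\<in>{(i, j). i \<in> TQ T \<nu> \<inter> Z2 \<and> j \<in> TQ T \<nu> \<inter> Z2 \<and> norm (i - j) = 1}. \<bar>v i - v j\<bar>\<^sup>2)
     = \<dots>" .
  have half: "1 / (2 * l) * (2 * S) = 1 / l * S" for S by simp
  show ?thesis
    unfolding energy_def lattice_energy_def mass pairs half ..
qed


lemma strong_axes:
  "(i + axis 1 1 \<in> S \<or> i - axis 1 1 \<in> S) \<and> (i + axis 2 1 \<in> S \<or> i - axis 2 1 \<in> S)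
    \<longleftrightarrow> (i + e \<in> S \<or> i - e \<in> S) \<and> (i + f \<in> S \<or> i - f \<in> S)"
  using axes by auto

lemma pt_image_iff: "pt z \<in> pt ` A \<longleftrightarrow> z \<in> A"
  by (auto simp: pt_inject)

lemma strong_pt:
  "(pt z + axis 1 1 \<in> pt ` A \<or> pt z - axis 1 1 \<in> pt ` A) \<and> (pt z + axis 2 1 \<in> pt ` A \<or> pt z - axis 2 1 \<in> pt ` A)
    \<longleftrightarrow> (z + (1, 0) \<in> A \<or> z - (1, 0) \<in> A) \<and> (z + (0, 1) \<in> A \<or> z - (0, 1) \<in> A)"
proof -
  have "pt z + e = pt (z + (1, 0))" "pt z - e = pt (z - (1, 0))" "pt z + f = pt (z + (0, 1))" "pt z - f = pt (z - (0, 1))"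
    by (simp_all only: pt_add pt_diff pt_basis)
  then show ?thesis by (simp only: strong_axes pt_image_iff)
qed

lemma successively_rev_adjacent: "successively adjacent (rev q) \<longleftrightarrow> successively adjacent q"
proof -
  have sym: "adjacent z' z \<longleftrightarrow> adjacent z z'" for z z' using lattice_steps_uminus[of "z' - z"] by simp
  show ?thesis unfolding successively_rev by (rule successively_cong) (auto simp only: sym)
qed

lemma strong_path_pt:
  assumes "q \<noteq> []"
  shows "strong_path (map pt q) \<longleftrightarrow> successively adjacent q \<and>
     (\<forall>z\<in>set q. z \<noteq> hd q \<and> z \<noteq> last q \<longrightarrow>
        (z + (1, 0) \<in> set q \<or> z - (1, 0) \<in> set q) \<and> (z + (0, 1) \<in> set q \<or> z - (0, 1) \<in> set q))"
proof -
  have 1: "is_path (map pt q) \<longleftrightarrow> successively adjacent q"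
    using assms unfolding is_path_def Z2_eq by (auto simp: successively_map norm_pt_diff(1))
  have 2: "hd (map pt q) = pt (hd q)" "last (map pt q) = pt (last q)"
    using assms by (simp_all add: hd_map last_map)
  show ?thesis
    unfolding strong_path_def 1 2 set_map ball_simps pt_inject strong_pt ..
qed

lemma S_set_pt:
  assumes T: "0 < T"
  shows "pt z \<in> S_set T \<nu> \<longleftrightarrow> z \<in> D (T / 2) \<and> (\<exists>z'\<in>D (T / 2). adjacent z z' \<and> sgn (Y z) \<noteq> sgn (Y z'))"
  unfolding S_set_def TQ_Z2[OF T] by (simp add: pt_image_iff inner_\<nu> norm_pt_diff(2))

lemma bd_pt:
  assumes T: "0 < T"
  shows "pt z \<in> bdL T \<nu> \<longleftrightarrow> z \<in> D (T / 2) \<and> (\<exists>z'. adjacent z z' \<and> \<tau> * X z' \<le> - (T / 2))"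
    "pt z \<in> bdR T \<nu> \<longleftrightarrow> z \<in> D (T / 2) \<and> (\<exists>z'. adjacent z z' \<and> T / 2 \<le> \<tau> * X z')"
  unfolding bdL_def bdR_def TQ_Z2[OF T] by (simp_all add: pt_image_iff Z2_eq inner_perp norm_pt_diff(2))

lemma channel_pt_iff:
  assumes T: "0 < T" and q: "q \<noteq> []"
  shows "channel T \<nu> (map pt q) \<longleftrightarrow> lattice_channel (T / 2) (if \<tau> = 1 then q else rev q)"
proof -
  have sub: "set (map pt q) \<subseteq> TQ T \<nu> \<longleftrightarrow> set q \<subseteq> D (T / 2)"
    using pt_in_TQ[OF T] by auto
  have 2: "hd (map pt q) = pt (hd q)" "last (map pt q) = pt (last q)"
    using q by (simp_all add: hd_map last_map)
  have hD: "set q \<subseteq> D (T / 2) \<Longrightarrow> hd q \<in> D (T / 2)" and lD: "set q \<subseteq> D (T / 2) \<Longrightarrow> last q \<in> D (T / 2)"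
    using hd_in_set[OF q] last_in_set[OF q] by blast+
  have fwd: "(S \<Longrightarrow> h) \<Longrightarrow> (S \<Longrightarrow> l) \<Longrightarrow> N \<Longrightarrow>
      ((A \<and> St) \<and> S \<and> ((h \<and> S1) \<and> h \<and> L1) \<and> (l \<and> S2) \<and> l \<and> L2) \<longleftrightarrow> (N \<and> A \<and> S \<and> St \<and> S1 \<and> L1 \<and> S2 \<and> L2)"
    for S h l N A St S1 L1 S2 L2 by blast
  have bwd: "(S \<Longrightarrow> h) \<Longrightarrow> (S \<Longrightarrow> l) \<Longrightarrow> N \<Longrightarrow>
      ((A \<and> St) \<and> S \<and> ((h \<and> S1) \<and> h \<and> L1) \<and> (l \<and> S2) \<and> l \<and> L2) \<longleftrightarrow> (N \<and> A \<and> S \<and> St \<and> S2 \<and> L2 \<and> S1 \<and> L1)"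
    for S h l N A St S1 L1 S2 L2 by blast
  show ?thesis
  proof (cases "\<tau> = 1")
    case True
    show ?thesis
      unfolding channel_def lattice_channel_def strong_path_pt[OF q] sub 2 Int_iff S_set_pt[OF T] bd_pt[OF T]
      unfolding if_P[OF True] unfolding True mult_1
      by (rule fwd[OF hD lD q])
  next
    case False
    then have t: "\<tau> = - 1" using \<tau> by simp
    have neg: "- 1 * x \<le> - c \<longleftrightarrow> c \<le> x" "c \<le> - 1 * x \<longleftrightarrow> x \<le> - c" for x c :: real by auto
    have r: "rev q \<noteq> []" "hd (rev q) = last q" "last (rev q) = hd q" "set (rev q) = set q"
      using q by (simp_all add: hd_rev last_rev)
    show ?thesis
      unfolding channel_def strong_path_pt[OF q] sub 2 Int_iff S_set_pt[OF T] bd_pt[OF T]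
      unfolding if_not_P[OF False]
      unfolding lattice_channel_def r successively_rev_adjacent t neg
        conj_commute[of "_ \<noteq> last q"]
      by (rule bwd[OF hD lD r(1)])
  qed
qed

lemma channel_to_lattice:
  assumes T: "0 < T" and p: "channel T \<nu> p"
  obtains q where "lattice_channel (T / 2) q" "set p = pt ` set q"
proof -
  have "p \<noteq> []" "set p \<subseteq> range pt"
    using p by (auto simp: channel_def strong_path_def is_path_def Z2_eq)
  then have "\<exists>q. p = map pt q" unfolding ex_map_conv by blast
  then obtain q where q: "p = map pt q" by blast
  then have "q \<noteq> []" using \<open>p \<noteq> []\<close> by auto
  note q = q this
  have "lattice_channel (T / 2) (if \<tau> = 1 then q else rev q)"
    using p unfolding q(1) by (rule channel_pt_iff[OF T q(2), THEN iffD1])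
  moreover have "set p = pt ` set (if \<tau> = 1 then q else rev q)" by (simp add: q(1))
  ultimately show ?thesis by (rule that)
qed

lemma lattice_to_channel:
  assumes T: "0 < T" and q: "lattice_channel (T / 2) q"
  obtains p where "channel T \<nu> p" "set p = pt ` set q"
proof -
  have "q \<noteq> []" using q by (simp add: lattice_channel_def)
  then have ne: "(if \<tau> = 1 then q else rev q) \<noteq> []" by simp
  have "(if \<tau> = 1 then (if \<tau> = 1 then q else rev q) else rev (if \<tau> = 1 then q else rev q)) = q" by simp
  then have "channel T \<nu> (map pt (if \<tau> = 1 then q else rev q))"
    using channel_pt_iff[OF T ne] q by simp
  moreover have "set (map pt (if \<tau> = 1 then q else rev q)) = pt ` set q" by simp
  ultimately show ?thesis by (rule that)
qed

lemma cell_dist: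
  assumes "x \<in> cell i" "norm n = 1"
  shows "\<bar>x \<bullet> n - i \<bullet> n\<bar> \<le> 2"
proof -
  have "\<bar>x \<bullet> n - i \<bullet> n\<bar> \<le> norm (x - i)"
    using Cauchy_Schwarz_ineq2[of "x - i" n] assms(2) by (simp add: inner_diff_left)
  also have "\<dots> \<le> (\<Sum>k\<in>UNIV. \<bar>(x - i) $ k\<bar>)" by (rule norm_le_l1_cart)
  also have "\<dots> \<le> (\<Sum>k\<in>(UNIV :: 2 set). 1)"
  proof (rule sum_mono)
    fix k
    have "i $ k \<le> x $ k" "x $ k < i $ k + 1" using assms(1) by (simp_all add: cell_def)
    then show "\<bar>(x - i) $ k\<bar> \<le> 1" unfolding vector_minus_component by linarith
  qed
  finally show ?thesis by simp
qed

lemma cell_unique: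
  assumes "i \<in> Z2" "j \<in> Z2" "x \<in> cell i" "x \<in> cell j"
  shows "i = j"
proof -
  have "i $ k = j $ k" for k
  proof -
    have "i $ k \<in> \<int>" "j $ k \<in> \<int>" using assms(1,2) by (simp_all add: Z2_def)
    then obtain m n where "i $ k = of_int m" "j $ k = of_int n" by (metis Ints_cases)
    moreover have "i $ k \<le> x $ k" "x $ k < i $ k + 1" "j $ k \<le> x $ k" "x $ k < j $ k + 1"
      using assms(3,4) by (simp_all add: cell_def)
    ultimately have "real_of_int m < real_of_int n + 1" "real_of_int n < real_of_int m + 1" "i $ k = of_int m" "j $ k = of_int n"
      by linarith+
    then have "m = n" by linarith
    then show ?thesis using \<open>i $ k = of_int m\<close> \<open>j $ k = of_int n\<close> by simp
  qed
  then show ?thesis by (simp add: vec_eq_iff)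
qed

lemma self_in_cell: "i \<in> cell i"
  by (simp add: cell_def)

lemma bounded_cell: "bounded (cell i)"
  by (rule bounded_subset[OF bounded_cbox[of i "i + (\<chi> k. 1)"]])
    (auto simp: cell_def mem_box_cart less_imp_le)

lemma convex_cell: "convex (cell i)"
proof -
  have "cell i = (\<Inter>k. {x. axis k 1 \<bullet> x \<ge> i $ k} \<inter> {x. axis k 1 \<bullet> x < i $ k + 1})"
    by (auto simp: cell_def inner_axis' )
  then show ?thesis by (auto intro!: convex_INT convex_Int convex_halfspace_ge convex_halfspace_lt)
qed

lemma TQ_open: "0 < T \<Longrightarrow> open (TQ T \<nu>)"
  unfolding TQ_eq
  by (intro open_Collect_conj open_Collect_less continuous_on_rabs continuous_on_inner continuous_on_id continuous_on_const)

lemma TQ_bounded: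
  assumes T: "0 < T"
  shows "bounded (TQ T \<nu>)"
proof -
  have "norm x \<le> T" if x: "x \<in> TQ T \<nu>" for x
  proof -
    have i: "x \<bullet> \<nu> = x $ 1 * \<nu> $ 1 + x $ 2 * \<nu> $ 2" "x \<bullet> perp \<nu> = x $ 1 * \<nu> $ 2 - x $ 2 * \<nu> $ 1"
      "x \<bullet> x = x $ 1 * x $ 1 + x $ 2 * x $ 2" "\<nu> \<bullet> \<nu> = \<nu> $ 1 * \<nu> $ 1 + \<nu> $ 2 * \<nu> $ 2"
      by (simp_all only: inner_vec_def sum_2 perp_def vector_2 inner_real_def mult_minus_right diff_conv_add_uminus)
    have "(x \<bullet> \<nu>)\<^sup>2 + (x \<bullet> perp \<nu>)\<^sup>2 = (x \<bullet> x) * (\<nu> \<bullet> \<nu>)"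
      unfolding i power2_eq_square by (simp add: algebra_simps)
    moreover have "\<nu> \<bullet> \<nu> = 1" using norm_\<nu>(1) by (simp only: norm_eq_1)
    ultimately have n: "(norm x)\<^sup>2 = (x \<bullet> \<nu>)\<^sup>2 + (x \<bullet> perp \<nu>)\<^sup>2" by (simp only: power2_norm_eq_inner mult_1_right)
    have "\<bar>x \<bullet> \<nu>\<bar> \<le> T / 2" "\<bar>x \<bullet> perp \<nu>\<bar> \<le> T / 2" using x unfolding TQ_eq[OF T] by auto
    then have "\<bar>x \<bullet> \<nu>\<bar>\<^sup>2 \<le> (T / 2)\<^sup>2" "\<bar>x \<bullet> perp \<nu>\<bar>\<^sup>2 \<le> (T / 2)\<^sup>2"
      by (simp_all only: power_mono abs_ge_zero)
    then have "(norm x)\<^sup>2 \<le> (T / 2)\<^sup>2 + (T / 2)\<^sup>2" unfolding n power2_abs by linarith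
    also have "\<dots> \<le> T\<^sup>2" by (simp add: power_divide)
    finally show ?thesis by (rule power2_le_imp_le) (use T in simp)
  qed
  then show ?thesis by (auto simp: bounded_iff)
qed

end

section \<open>Bounds for the limit energy\<close>

lemma lattice_energy_cong:
  assumes "\<And>z. z \<in> D \<Longrightarrow> u z = u' z"
  shows "lattice_energy l D u = lattice_energy l D u'"
  unfolding lattice_energy_def using assms by (auto intro!: arg_cong2[of _ _ _ _ "(+)"] arg_cong2[of _ _ _ _ "(*)"] sum.cong)

lemma lattice_energy_nonneg: "0 < l \<Longrightarrow> 0 \<le> lattice_energy l D u"
  unfolding lattice_energy_def by (intro add_nonneg_nonneg mult_nonneg_nonneg sum_nonneg) auto

context lattice_frame
begin

lemma indicator_cell_integrable:
  assumes T: "0 < T"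
  shows "(indicator (cell i) :: real^2 \<Rightarrow> real) absolutely_integrable_on TQ T \<nu>"
proof -
  have "cell i \<inter> TQ T \<nu> \<in> lmeasurable"
    using measurable_convex[OF convex_cell bounded_cell] lmeasurable_open[OF TQ_bounded[OF T] TQ_open[OF T]]
    by (rule fmeasurable.Int)
  then have "integrable lebesgue (indicator (cell i \<inter> TQ T \<nu>) :: real^2 \<Rightarrow> real)"
    by (auto simp: fmeasurable_def)
  moreover have "(\<lambda>x. indicator (TQ T \<nu>) x *\<^sub>R indicator (cell i) x) = (indicator (cell i \<inter> TQ T \<nu>) :: real^2 \<Rightarrow> real)"
    by (auto simp: indicator_def)
  ultimately show ?thesis by (simp add: set_integrable_def)
qed

text \<open>The values \<open>1 - u\<close> on the cells define an admissible function. A cell has diameter at most \<open>2\<close>; hence it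
stays out of the neighbourhood \<open>U\<close> of width \<open>2\<close> of the boundary, where \<open>v\<close> has to be \<open>1\<close>, if its lattice
point is at distance \<open>4\<close> from the boundary.\<close>
lemma exists_admissible:
  assumes T: "0 < T" and q: "lattice_channel (T / 2) q" and u1: "\<And>z. z \<in> set q \<Longrightarrow> u z = 1"
    and supp: "\<And>z. u z \<noteq> 0 \<Longrightarrow> z \<notin> set q \<Longrightarrow> \<bar>X z\<bar> \<le> T / 2 - 4 \<and> \<bar>Y z\<bar> \<le> T / 2 - 4"
  shows "\<exists>v\<in>admissible T \<nu>. energy l (TQ T \<nu>) v = lattice_energy l (D (T / 2)) u"
proof -
  let ?D = "D (T / 2)"
  define v where "v x = 1 - (\<Sum>z\<in>?D. u z * indicator (cell (pt z)) x)" for x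
  have v_cell: "v x = 1 - u z" if "z \<in> ?D" "x \<in> cell (pt z)" for x z
  proof -
    have ind: "indicator (cell (pt z')) x = (of_bool (z' = z) :: real)" for z'
    proof (cases "z' = z")
      case True
      then show ?thesis using that(2) by simp
    next
      case False
      then have "x \<notin> cell (pt z')" using cell_unique[OF pt_Z2 pt_Z2 _ that(2)] pt_inject by blast
      then show ?thesis using False by simp
    qed
    have "(\<Sum>z\<in>?D. u z * indicator (cell (pt z)) x) = (\<Sum>z'\<in>?D. if z' = z then u z' else 0)"
      unfolding ind by (intro sum.cong refl) simp
    then show ?thesis using that(1) finite_D by (simp add: v_def)
  qed
  have v_out: "v x = 1" if "\<And>z. z \<in> ?D \<Longrightarrow> x \<notin> cell (pt z)" for x
    using that by (simp add: v_def)
  obtain p where p: "channel T \<nu> p" "set p = pt ` set q" using lattice_to_channel[OF T q] .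
  have qD: "set q \<subseteq> ?D" using q by (simp add: lattice_channel_def)
  have "(\<lambda>x. 1 - (\<Sum>z\<in>?D. u z * indicator (cell (pt z)) x)) absolutely_integrable_on TQ T \<nu>"
    using lmeasurable_open[OF TQ_bounded[OF T] TQ_open[OF T]]
    by (intro set_integral_diff(1) absolutely_integrable_sum finite_D set_integrable_mult_right
        indicator_cell_integrable T absolutely_integrable_on_const)
  then have int: "v absolutely_integrable_on TQ T \<nu>" by (simp add: v_def[abs_def])
  have const: "v constant_on (cell i \<inter> TQ T \<nu>)" if "i \<in> TQ T \<nu> \<inter> Z2" for i
    using that v_cell unfolding TQ_Z2[OF T] constant_on_def by blast
  have zero: "\<forall>i\<in>set p. v i = 0"
  proof
    fix i assume "i \<in> set p"
    then obtain z where "z \<in> set q" "i = pt z" using p by blast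
    then show "v i = 0" using v_cell[of z i] u1[of z] qD self_in_cell by auto
  qed
  define U where "U = {x. T / 2 - 2 < \<bar>x \<bullet> \<nu>\<bar>} \<union> {x. T / 2 - 2 < \<bar>x \<bullet> perp \<nu>\<bar>}"
  have "open U"
    unfolding U_def by (intro open_Un open_Collect_less continuous_on_rabs continuous_on_inner continuous_on_id continuous_on_const)
  moreover have "frontier (TQ T \<nu>) \<subseteq> U"
  proof -
    have "frontier (TQ T \<nu>) \<subseteq> - TQ T \<nu>" using TQ_open[OF T] by (auto simp: frontier_def interior_open)
    also have "\<dots> \<subseteq> U" by (auto simp: TQ_eq[OF T] U_def)
    finally show ?thesis .
  qed
  moreover have "v x = 1" if x: "x \<in> U \<inter> TQ T \<nu> - (\<Union>i\<in>set p. cell i)" for x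
  proof (cases "\<exists>z\<in>?D. x \<in> cell (pt z)")
    case True
    then obtain z where z: "z \<in> ?D" "x \<in> cell (pt z)" by blast
    have zq: "z \<notin> set q" using x z(2) p(2) by auto
    have "u z = 0"
    proof (rule ccontr)
      assume "u z \<noteq> 0"
      then have s: "\<bar>X z\<bar> \<le> T / 2 - 4" "\<bar>Y z\<bar> \<le> T / 2 - 4" using supp zq by blast+
      have "\<bar>\<tau> * X z\<bar> = \<bar>X z\<bar>" using \<tau> by (auto simp: abs_mult)
      moreover have "\<bar>x \<bullet> \<nu> - Y z\<bar> \<le> 2" "\<bar>x \<bullet> perp \<nu> - \<tau> * X z\<bar> \<le> 2"
        using cell_dist[OF z(2) norm_\<nu>(1)] cell_dist[OF z(2) norm_\<nu>(2)] by (simp_all add: inner_\<nu> inner_perp)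
      ultimately have "\<bar>x \<bullet> \<nu>\<bar> \<le> T / 2 - 2" "\<bar>x \<bullet> perp \<nu>\<bar> \<le> T / 2 - 2" using s by linarith+
      then show False using x by (auto simp: U_def)
    qed
    then show ?thesis using v_cell[OF z] by simp
  next
    case False
    then show ?thesis using v_out by blast
  qed
  ultimately have near: "one_otherwise_near_boundary (TQ T \<nu>) (set p) v"
    unfolding one_otherwise_near_boundary_def by (intro exI[of _ U]) auto
  have "v \<in> admissible T \<nu>"
    using int const p(1) zero near by (auto simp: admissible_def A1_def)
  moreover have "energy l (TQ T \<nu>) v = lattice_energy l ?D u"
    unfolding energy_eq[OF T] using v_cell self_in_cell by (intro lattice_energy_cong) simp
  ultimately show ?thesis by blast
qed

lemma admissible_channel:
  assumes T: "0 < T" and v: "v \<in> admissible T \<nu>"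
  obtains q where "lattice_channel (T / 2) q" "\<And>z. z \<in> set q \<Longrightarrow> 1 - v (pt z) = 1"
proof -
  obtain p where p: "channel T \<nu> p" "\<forall>i\<in>set p. v i = 0" using v by (auto simp: admissible_def)
  obtain q where q: "lattice_channel (T / 2) q" "set p = pt ` set q" using channel_to_lattice[OF T p(1)] .
  show ?thesis by (rule that[OF q(1)]) (use p(2) q(2) in auto)
qed

lemma scaled_min_le:
  assumes T: "0 < T" and l: "0 < l" and q: "lattice_channel (T / 2) q" and u1: "\<And>z. z \<in> set q \<Longrightarrow> u z = 1"
    and supp: "\<And>z. u z \<noteq> 0 \<Longrightarrow> z \<notin> set q \<Longrightarrow> \<bar>X z\<bar> \<le> T / 2 - 4 \<and> \<bar>Y z\<bar> \<le> T / 2 - 4"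
    and E: "lattice_energy l (D (T / 2)) u \<le> E"
  shows "scaled_min l \<nu> T \<le> 1 / (2 * T) * E"
proof -
  obtain v where v: "v \<in> admissible T \<nu>" "energy l (TQ T \<nu>) v = lattice_energy l (D (T / 2)) u"
  proof -
    have "\<exists>v\<in>admissible T \<nu>. energy l (TQ T \<nu>) v = lattice_energy l (D (T / 2)) u"
      by (rule exists_admissible[OF T q u1 supp])
    then show ?thesis using that by blast
  qed
  have "bdd_below (energy l (TQ T \<nu>) ` admissible T \<nu>)"
    using lattice_energy_nonneg[OF l] by (intro bdd_belowI[of _ 0]) (auto simp: energy_eq[OF T])
  then have "(INF v\<in>admissible T \<nu>. energy l (TQ T \<nu>) v) \<le> energy l (TQ T \<nu>) v"
    using v(1) by (rule cINF_lower)
  also have "\<dots> \<le> E" using v(2) E by simp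
  finally show ?thesis unfolding scaled_min_def using T by (intro mult_left_mono) auto
qed

lemma admissible_nonempty:
  assumes T: "4 < T"
  shows "admissible T \<nu> \<noteq> {}"
proof -
  obtain q where q: "lattice_channel (T / 2) q" using exists_channel[of "T / 2"] T by auto
  have "\<exists>v\<in>admissible T \<nu>. energy 1 (TQ T \<nu>) v = lattice_energy 1 (D (T / 2)) (\<lambda>z. of_bool (z \<in> set q))"
    by (rule exists_admissible[OF _ q]) (use T in auto)
  then show ?thesis by blast
qed

lemma scaled_min_ge:
  assumes T: "4 < T"
    and E: "\<And>q u. lattice_channel (T / 2) q \<Longrightarrow> (\<And>z. z \<in> set q \<Longrightarrow> u z = 1) \<Longrightarrow> E \<le> lattice_energy l (D (T / 2)) u"
  shows "1 / (2 * T) * E \<le> scaled_min l \<nu> T"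
proof -
  have T0: "0 < T" using T by simp
  have "E \<le> (INF v\<in>admissible T \<nu>. energy l (TQ T \<nu>) v)"
  proof (rule cINF_greatest[OF admissible_nonempty[OF T]])
    fix v assume "v \<in> admissible T \<nu>"
    then obtain q where "lattice_channel (T / 2) q" "\<And>z. z \<in> set q \<Longrightarrow> 1 - v (pt z) = 1"
      using admissible_channel[OF T0] by blast
    then show "E \<le> energy l (TQ T \<nu>) v" unfolding energy_eq[OF T0] by (rule E)
  qed
  then show ?thesis unfolding scaled_min_def using T0 by (intro mult_left_mono) auto
qed

lemma affine_average: "((\<lambda>T::real. 1 / (2 * T) * (c * T + d)) \<longlongrightarrow> c / 2) at_top"
  by real_asymp

context
  fixes l :: real
  assumes l: "0 < l" and lim: "(scaled_min l \<nu> \<longlongrightarrow> phi l \<nu>) at_top"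
begin

lemma phi_ge:
  assumes "\<And>T q u. t \<le> T \<Longrightarrow> lattice_channel (T / 2) q \<Longrightarrow> (\<And>z. z \<in> set q \<Longrightarrow> u z = 1) \<Longrightarrow>
             c * T + d \<le> lattice_energy l (D (T / 2)) u"
  shows "c / 2 \<le> phi l \<nu>"
proof (rule tendsto_le[OF trivial_limit_at_top_linorder lim affine_average])
  show "\<forall>\<^sub>F T in at_top. 1 / (2 * T) * (c * T + d) \<le> scaled_min l \<nu> T"
    using eventually_gt_at_top[of 4] eventually_ge_at_top[of t]
    by eventually_elim (rule scaled_min_ge, assumption, rule assms)
qed

lemma phi_le:
  assumes "\<And>T. t \<le> T \<Longrightarrow> 0 < T \<Longrightarrow> \<exists>q u. lattice_channel (T / 2) q \<and> (\<forall>z\<in>set q. u z = 1) \<and>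
      (\<forall>z. u z \<noteq> 0 \<longrightarrow> z \<notin> set q \<longrightarrow> \<bar>X z\<bar> \<le> T / 2 - 4 \<and> \<bar>Y z\<bar> \<le> T / 2 - 4) \<and>
      lattice_energy l (D (T / 2)) u \<le> c * T + d"
  shows "phi l \<nu> \<le> c / 2"
proof (rule tendsto_le[OF trivial_limit_at_top_linorder affine_average lim])
  show "\<forall>\<^sub>F T in at_top. scaled_min l \<nu> T \<le> 1 / (2 * T) * (c * T + d)"
    using eventually_gt_at_top[of 0] eventually_ge_at_top[of t]
  proof eventually_elim
    case (elim T)
    from assms[OF elim(2) elim(1)] obtain q u where qu: "lattice_channel (T / 2) q \<and> (\<forall>z\<in>set q. u z = 1) \<and>
      (\<forall>z. u z \<noteq> 0 \<longrightarrow> z \<notin> set q \<longrightarrow> \<bar>X z\<bar> \<le> T / 2 - 4 \<and> \<bar>Y z\<bar> \<le> T / 2 - 4) \<and>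
      lattice_energy l (D (T / 2)) u \<le> c * T + d" by (elim exE)
    show ?case
    proof (rule scaled_min_le[OF elim(1) l])
      show "lattice_channel (T / 2) q" "lattice_energy l (D (T / 2)) u \<le> c * T + d" using qu by simp_all
      show "u z = 1" if "z \<in> set q" for z using qu that by blast
      show "\<bar>X z\<bar> \<le> T / 2 - 4 \<and> \<bar>Y z\<bar> \<le> T / 2 - 4" if "u z \<noteq> 0" "z \<notin> set q" for z using qu that by blast
    qed
  qed
qed

lemma phi_ge_count: "l * b \<le> phi l \<nu>"
proof -
  have "(2 * (l * b)) / 2 \<le> phi l \<nu>"
  proof (rule phi_ge[where t = 0])
    fix T q and u :: "int \<times> int \<Rightarrow> real"
    assume q: "lattice_channel (T / 2) q" and u: "\<And>z. z \<in> set q \<Longrightarrow> u z = 1"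
    have "2 * (l * b) * T + - (10 * l) = l * (4 * b * (T / 2) - 10)" by (simp add: algebra_simps)
    also have "\<dots> \<le> l * real (card (set q))" using lattice_channel_card_ge[OF q] l by (intro mult_left_mono) auto
    also have "real (card (set q)) = (\<Sum>z\<in>set q. (u z)\<^sup>2)" using u by simp
    also have "\<dots> \<le> (\<Sum>z\<in>D (T / 2). (u z)\<^sup>2)"
      using q finite_D by (intro sum_mono2) (auto simp: lattice_channel_def)
    also have "l * \<dots> \<le> lattice_energy l (D (T / 2)) u"
      unfolding lattice_energy_def le_add_same_cancel1
      using l by (intro mult_nonneg_nonneg add_nonneg_nonneg sum_nonneg zero_le_power2) simp
    finally show "2 * (l * b) * T + - (10 * l) \<le> lattice_energy l (D (T / 2)) u" using l by simp
  qed
  then show ?thesis by simp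
qed

lemma phi_le_count: "phi l \<nu> \<le> (l + 4 / l) * b"
proof -
  have "phi l \<nu> \<le> ((l + 4 / l) * (2 * b)) / 2"
  proof (rule phi_le[where t = 5])
    fix T :: real assume T: "5 \<le> T"
    obtain q where q: "lattice_channel (T / 2) q" "real (card (set q)) \<le> 4 * b * (T / 2) + 6"
      using exists_channel[of "T / 2"] T by auto
    let ?u = "\<lambda>z. of_bool (z \<in> set q) :: real"
    have "(\<Sum>z\<in>D (T / 2). (?u z)\<^sup>2) = (\<Sum>z\<in>set q. 1)"
      using q finite_D by (intro sum.mono_neutral_cong_right) (auto simp: lattice_channel_def)
    then have "lattice_energy l (D (T / 2)) ?u \<le> (l + 4 / l) * real (card (set q))"
      using lattice_energy_le_mass[OF finite_D l, of ?u "T / 2"] by simp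
    also have "\<dots> \<le> (l + 4 / l) * (4 * b * (T / 2) + 6)" using l by (intro mult_left_mono q) auto
    also have "\<dots> = (l + 4 / l) * (2 * b) * T + (l + 4 / l) * 6" by (simp only: distrib_left) simp
    finally have "lattice_energy l (D (T / 2)) ?u \<le> (l + 4 / l) * (2 * b) * T + (l + 4 / l) * 6" .
    then show "\<exists>q u. lattice_channel (T / 2) q \<and> (\<forall>z\<in>set q. u z = 1) \<and>
      (\<forall>z. u z \<noteq> 0 \<longrightarrow> z \<notin> set q \<longrightarrow> \<bar>X z\<bar> \<le> T / 2 - 4 \<and> \<bar>Y z\<bar> \<le> T / 2 - 4) \<and>
      lattice_energy l (D (T / 2)) u \<le> (l + 4 / l) * (2 * b) * T + (l + 4 / l) * 6"
      using q(1) by (intro exI[of _ q] exI[of _ ?u]) auto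
  qed
  then show ?thesis by simp
qed

lemma phi_ge_1: "1 \<le> phi l \<nu>"
proof -
  have bound: "(1 - (R + 1) / (2 * R\<^sup>2)) / (1 + 18 / R + 12 / (R * l)) \<le> phi l \<nu>" if R: "3 \<le> R" for R
  proof -
    define s where "s = 1 - (R + 1) / (2 * R\<^sup>2)"
    define t where "t = 1 + 18 / R + 12 / (R * l)"
    define C where "C = 4 * R\<^sup>2 + 4 * R + 13"
    have t: "0 < t" using R l by (auto simp: t_def intro!: add_pos_nonneg)
    have "(2 * s / t) / 2 \<le> phi l \<nu>"
    proof (rule phi_ge[where t = C])
      fix T q and u :: "int \<times> int \<Rightarrow> real"
      assume T: "C \<le> T" and q: "lattice_channel (T / 2) q" and u: "\<And>z. z \<in> set q \<Longrightarrow> u z = 1"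
      have C0: "0 \<le> C" using R by (simp add: C_def)
      have "s * (4 * (T / 2) - C) \<le> t * lattice_energy l (D (T / 2)) u"
        unfolding s_def t_def C_def
        using lattice_channel_ends[OF q] q T C0
        by (intro crossing_energy_ge[OF R _ l _ _ _ u]) (auto simp: C_def lattice_channel_def)
      then show "2 * s / t * T + - (s * C / t) \<le> lattice_energy l (D (T / 2)) u"
        using t by (simp add: field_simps)
    qed
    then have "s / t \<le> phi l \<nu>" by simp
    then show ?thesis unfolding s_def t_def .
  qed
  have "((\<lambda>R. (1 - (R + 1) / (2 * R\<^sup>2)) / (1 + 18 / R + 12 / (R * l))) \<longlongrightarrow> 1) at_top"
    using l by real_asymp
  moreover have "\<forall>\<^sub>F R in at_top. (1 - (R + 1) / (2 * R\<^sup>2)) / (1 + 18 / R + 12 / (R * l)) \<le> phi l \<nu>"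
    using eventually_ge_at_top[of 3] by eventually_elim (rule bound)
  ultimately show ?thesis by (rule tendsto_upperbound) simp
qed

lemma phi_le_profile: "phi l \<nu> \<le> 2 * l * b * ((1 + l) * exp (2 * l))\<^sup>2 / (1 - exp (- (2 * l * b)))"
proof -
  define A where "A = (1 + l) * exp (2 * l)"
  define B where "B = 2 / (1 - exp (- (2 * l * b)))"
  obtain C H0 where C: "\<And>H p. H0 \<le> H \<Longrightarrow> lattice_channel H p \<Longrightarrow> (\<forall>z\<in>set p. \<bar>Y z\<bar> \<le> 1) \<Longrightarrow>
    \<exists>u. (\<forall>z\<in>set p. u z = 1) \<and> (\<forall>z. u z \<noteq> 0 \<longrightarrow> z \<notin> set p \<longrightarrow> \<bar>X z\<bar> \<le> H - 4 \<and> \<bar>Y z\<bar> \<le> H - 4) \<and>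
      lattice_energy l (D H) u \<le> 2 * l * A\<^sup>2 * (2 * b * H) * B + C"
    using exists_profile[OF b_pos l] unfolding A_def B_def by blast
  have "phi l \<nu> \<le> (2 * l * A\<^sup>2 * b * B) / 2"
  proof (rule phi_le[where t = "max 5 (2 * H0)"])
    fix T :: real assume T: "max 5 (2 * H0) \<le> T"
    obtain q where q: "lattice_channel (T / 2) q" "\<forall>z\<in>set q. \<bar>Y z\<bar> \<le> 1"
      using exists_channel[of "T / 2"] T by auto
    have "2 * l * A\<^sup>2 * (2 * b * (T / 2)) * B + C = 2 * l * A\<^sup>2 * b * B * T + C" by simp
    then show "\<exists>q u. lattice_channel (T / 2) q \<and> (\<forall>z\<in>set q. u z = 1) \<and>
      (\<forall>z. u z \<noteq> 0 \<longrightarrow> z \<notin> set q \<longrightarrow> \<bar>X z\<bar> \<le> T / 2 - 4 \<and> \<bar>Y z\<bar> \<le> T / 2 - 4) \<and>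
      lattice_energy l (D (T / 2)) u \<le> 2 * l * A\<^sup>2 * b * B * T + C"
      using C[OF _ q] T q(1) by (metis max.bounded_iff mult.commute pos_le_divide_eq zero_less_numeral)
  qed
  also have "\<dots> = 2 * l * b * A\<^sup>2 / (1 - exp (- (2 * l * b)))"
  proof -
    have "(2 * l * x * b * (2 / y)) / 2 = 2 * l * b * x / y" for x y :: real
      by (cases "y = 0") (simp_all add: field_simps)
    then show ?thesis unfolding B_def .
  qed
  finally show ?thesis unfolding A_def .
qed

end

end

lemma exists_lattice_frame:
  fixes \<nu> :: "real^2"
  assumes \<nu>: "norm \<nu> = 1"
  shows "\<exists>a e f \<tau>. lattice_frame a (max \<bar>\<nu> $ 1\<bar> \<bar>\<nu> $ 2\<bar>) e f \<nu> \<tau>"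
proof -
  define s where "s x = (if 0 \<le> x then 1 else - 1 :: real)" for x :: real
  have s: "s x = 1 \<or> s x = - 1" "\<bar>x\<bar> * s x = x" "s x * s x = 1" for x by (auto simp: s_def)
  have ax: "s x *\<^sub>R axis k (1::real) = axis k 1 \<or> s x *\<^sub>R axis k (1::real) = - axis k 1" for x and k :: 2
    using s(1)[of x] by auto
  have sq: "(\<nu> $ 1)\<^sup>2 + (\<nu> $ 2)\<^sup>2 = 1"
    using \<nu> by (simp add: norm_eq_1 inner_vec_def sum_2 power2_eq_square)
  let ?t = "s (\<nu> $ 1) * s (\<nu> $ 2)"
  have t: "?t = 1 \<or> ?t = - 1" using s(1)[of "\<nu> $ 1"] s(1)[of "\<nu> $ 2"] by auto
  have t1: "?t * (\<bar>\<nu> $ 2\<bar> * s (\<nu> $ 1)) = \<nu> $ 2" "?t * (\<bar>\<nu> $ 1\<bar> * s (\<nu> $ 2)) = \<nu> $ 1"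
  proof -
    have "?t * (\<bar>\<nu> $ 2\<bar> * s (\<nu> $ 1)) = (s (\<nu> $ 1) * s (\<nu> $ 1)) * (\<bar>\<nu> $ 2\<bar> * s (\<nu> $ 2))"
      "?t * (\<bar>\<nu> $ 1\<bar> * s (\<nu> $ 2)) = (s (\<nu> $ 2) * s (\<nu> $ 2)) * (\<bar>\<nu> $ 1\<bar> * s (\<nu> $ 1))"
      by (simp_all only: ac_simps)
    then show "?t * (\<bar>\<nu> $ 2\<bar> * s (\<nu> $ 1)) = \<nu> $ 2" "?t * (\<bar>\<nu> $ 1\<bar> * s (\<nu> $ 2)) = \<nu> $ 1"
      by (simp_all only: s(2,3) mult_1_left)
  qed
  show ?thesis
  proof (cases "\<bar>\<nu> $ 1\<bar> \<le> \<bar>\<nu> $ 2\<bar>")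
    case True
    have "lattice_frame \<bar>\<nu> $ 1\<bar> \<bar>\<nu> $ 2\<bar> (s (\<nu> $ 1) *\<^sub>R axis 1 1) (s (\<nu> $ 2) *\<^sub>R axis 2 1) \<nu> ?t"
    proof unfold_locales
      show "\<nu> = \<bar>\<nu> $ 1\<bar> *\<^sub>R s (\<nu> $ 1) *\<^sub>R axis 1 1 + \<bar>\<nu> $ 2\<bar> *\<^sub>R s (\<nu> $ 2) *\<^sub>R axis 2 1"
        using s(2) by (simp add: vec_eq_iff forall_2 axis_def)
      show "perp \<nu> = ?t *\<^sub>R (\<bar>\<nu> $ 2\<bar> *\<^sub>R s (\<nu> $ 1) *\<^sub>R axis 1 1 - \<bar>\<nu> $ 1\<bar> *\<^sub>R s (\<nu> $ 2) *\<^sub>R axis 2 1)"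
        using t1 by (simp add: vec_eq_iff forall_2 axis_def perp_def vector_2)
    qed (use True sq t ax in auto)
    then show ?thesis using True by (auto simp: max_def)
  next
    case False
    have "lattice_frame \<bar>\<nu> $ 2\<bar> \<bar>\<nu> $ 1\<bar> (s (\<nu> $ 2) *\<^sub>R axis 2 1) (s (\<nu> $ 1) *\<^sub>R axis 1 1) \<nu> (- ?t)"
    proof unfold_locales
      show "\<nu> = \<bar>\<nu> $ 2\<bar> *\<^sub>R s (\<nu> $ 2) *\<^sub>R axis 2 1 + \<bar>\<nu> $ 1\<bar> *\<^sub>R s (\<nu> $ 1) *\<^sub>R axis 1 1"
        using s(2) by (simp add: vec_eq_iff forall_2 axis_def)
      show "perp \<nu> = (- ?t) *\<^sub>R (\<bar>\<nu> $ 1\<bar> *\<^sub>R s (\<nu> $ 2) *\<^sub>R axis 2 1 - \<bar>\<nu> $ 2\<bar> *\<^sub>R s (\<nu> $ 1) *\<^sub>R axis 1 1)"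
        using t1 by (simp add: vec_eq_iff forall_2 axis_def perp_def vector_2)
    qed (use False sq t ax in auto)
    then show ?thesis using False by (auto simp: max_def)
  qed
qed

theorem proposition7p1:
  fixes \<nu> :: "real^2"
  assumes "norm \<nu> = 1"
    and limit_exists: "\<And>l. l > 0 \<Longrightarrow> \<exists>L. (scaled_min l \<nu> \<longlongrightarrow> L) at_top"
  shows "filterlim (\<lambda>l. phi l \<nu>) at_top at_top \<and>
         ((\<lambda>l. phi l \<nu>) \<longlongrightarrow> 1) (at_right 0) \<and>
         ((\<lambda>l. phi l \<nu> / l) \<longlongrightarrow> max \<bar>\<nu> $ 1\<bar> \<bar>\<nu> $ 2\<bar>) at_top"
proof -
  define b where "b = max \<bar>\<nu> $ 1\<bar> \<bar>\<nu> $ 2\<bar>"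
  obtain a e f \<tau> where "lattice_frame a b e f \<nu> \<tau>"
    using exists_lattice_frame[OF assms(1)] unfolding b_def by blast
  then interpret lattice_frame a b e f \<nu> \<tau> .
  have lim: "(scaled_min l \<nu> \<longlongrightarrow> phi l \<nu>) at_top" if "0 < l" for l
    using limit_exists[OF that] tendsto_Lim[OF trivial_limit_at_top_linorder] unfolding phi_def by blast
  note low = phi_ge_count[OF _ lim] and up = phi_le_count[OF _ lim]
    and low1 = phi_ge_1[OF _ lim] and up1 = phi_le_profile[OF _ lim]
  have pos: "0 < b" by (rule b_pos)
  show ?thesis
  proof (intro conjI)
    have "filterlim (\<lambda>l. l * b) at_top at_top" using pos by real_asymp
    moreover have "\<forall>\<^sub>F l in at_top. l * b \<le> phi l \<nu>"
      using eventually_gt_at_top[of 0] by eventually_elim (simp add: low)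
    ultimately show "filterlim (\<lambda>l. phi l \<nu>) at_top at_top" by (rule filterlim_at_top_mono)
  next
    show "((\<lambda>l. phi l \<nu>) \<longlongrightarrow> 1) (at_right 0)"
    proof (rule tendsto_sandwich)
      show "\<forall>\<^sub>F l in at_right 0. 1 \<le> phi l \<nu>"
        using eventually_at_right_less[of 0] by eventually_elim (simp add: low1)
      show "\<forall>\<^sub>F l in at_right 0. phi l \<nu> \<le> 2 * l * b * ((1 + l) * exp (2 * l))\<^sup>2 / (1 - exp (- (2 * l * b)))"
        using eventually_at_right_less[of 0] by eventually_elim (simp add: up1)
      show "((\<lambda>l. 2 * l * b * ((1 + l) * exp (2 * l))\<^sup>2 / (1 - exp (- (2 * l * b)))) \<longlongrightarrow> 1) (at_right 0)"
        using pos by real_asymp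
    qed simp
  next
    show "((\<lambda>l. phi l \<nu> / l) \<longlongrightarrow> max \<bar>\<nu> $ 1\<bar> \<bar>\<nu> $ 2\<bar>) at_top"
      unfolding b_def[symmetric]
    proof (rule tendsto_sandwich)
      show "\<forall>\<^sub>F l in at_top. b \<le> phi l \<nu> / l"
        using eventually_gt_at_top[of 0] by eventually_elim (use low in \<open>simp add: pos_le_divide_eq mult.commute\<close>)
      show "\<forall>\<^sub>F l in at_top. phi l \<nu> / l \<le> (l + 4 / l) * b / l"
        using eventually_gt_at_top[of 0] by eventually_elim (use up in \<open>simp add: divide_right_mono\<close>)
      show "((\<lambda>l. (l + 4 / l) * b / l) \<longlongrightarrow> b) at_top" by real_asymp
    qed simp
  qed
qed

end
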